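(* Let $\mathcal G\in\mathbf G_{\mathrm{fin}}$ be a metric graph with at least one half-line, with edge set $\mathcal E$ and vertex set $\mathcal V$; let $p>2$ and let $m^*$ be a positive integer. Let $W\in L^\infty(\mathcal G)$ and $\rho\in L^\infty(\mathcal G)$ be such that $\inf_{\mathcal K}\rho>0$, where $\mathcal K$ is the compact core of $\mathcal G$ (the metric subgraph consisting of all the bounded edges of $\mathcal G$). Assume that $W\equiv0$ and $\rho\equiv1$ on the half-lines of $\mathcal G$. Consider the problem $$(E)\quad\begin{cases}-u''+W(x)u+\lambda u=\rho(x)|u|^{p-2}u&\text{on every edge } e\in\mathcal E,\\ u\text{ is continuous on }\mathcal G,\\ \sum_{e\succ v}\frac{du_e}{dx}(v)=0&\text{at every vertex }v\in\mathcal V,\end{cases}$$ and define $$q_{m^*}(\lambda):=\sup\bigl\{\|u\|_{L^2(\mathcal G)}\bigm| u\in H^1(\mathcal G)\setminus\{0\},\ (\lambda,u)\text{ solves }(E),\ \mathrm m(u)\le m^*\bigr\},$$ with the convention $q_{m^*}(\lambda)=0$ if no such $u$ exists. Then, for all $\tilde\Lambda>0$, there exist $C=C(\mathcal G,p,m^*,W,\rho,\tilde\Lambda)>0$ and $D=D(\mathcal G,p,m^*,W,\rho,\tilde\Lambda)>0$ such that, for all $\lambda\in\mathbb R$: 1. if $\lambda<0$, then $q_{m^*}(\lambda)=0$; 2. every solution $(\lambda,u)\in[0,\tilde\Lambda]\times H^1(\mathcal G)$ of $(E)$ with $\mathrm m(u)\le m^*$ satisfies $\|u\|_{L^\infty(\mathcal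 G)}\le C$; 3. $q_{m^*}(0)\le C$, and all solutions $u\in H^1(\mathcal G)$ with $\lambda=0$ and $\mathrm m(u)\le m^*$ vanish on every half-line of $\mathcal G$; 4. if $0<\lambda\le\tilde\Lambda$, then $q_{m^*}(\lambda)\le D+C\lambda^{\frac{6-p}{4(p-2)}}$; 5. if $\lambda\ge\tilde\Lambda$, then $q_{m^*}(\lambda)\le C\lambda^{\frac{6-p}{4(p-2)}}$.
   Context: Metric graphs: $\mathcal G=(\mathcal E,\mathcal V)$ with edges $\mathcal E$ and vertices $\mathcal V$; each bounded edge $e$ is identified with $[0,\ell_e]$ and each unbounded edge (half-line) with $[0,+\infty)$. $\mathbf G_{\mathrm{fin}}$ is the class of metric graphs that are connected, have finitely many vertices and edges, and whose edges all have positive (possibly infinite) length. $u_e$ is the restriction of $u$ to $e$. $H^1(\mathcal G)$ is the space of continuous $u:\mathcal G\to\mathbb R$ with $u_e\in H^1(e)$ for every edge. $C_c(\mathcal G)$ is the space of continuous functions with compact support. The notation $e\succ v$ means that $e$ is incident to $v$, and $\frac{du_e}{dx}(v)$ is the derivative along $e$ at $v$ directed away from $v$. Solutions are weak solutions: $\int_{\mathcal G}(u'\varphi'+(W+\lambda)u\varphi)\,dx=\int_{\mathcal G}\rho|u|^{p-2}u\varphi\,dx$ for all $\varphi\in H^1(\mathcal G)\cap C_c(\mathcal G)$. Infima of functions defined a.e. are essential infima. The Morse index $\mathrm m(u)$ of a solution $(\lambda,u)$ is the maximal dimension (or $+\infty$ if there is no maximal integer) of a subspace $X\subset H^1(\mathcal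 G)\cap C_c(\mathcal G)$ such that $\int_{\mathcal G}(|\varphi'|^2+(W+\lambda)\varphi^2-(p-1)\rho|u|^{p-2}\varphi^2)\,dx<0$ for all $\varphi\in X\setminus\{0\}$. *)

theory Defs
  imports "HOL-Analysis.Analysis" "HOL-Probability.Essential_Supremum"
    "HOL-Library.Function_Algebras" "HOL-Library.Extended_Nat"
begin

section \<open>Metric graphs\<close>

text \<open>
  An edge \<open>e\<close> is the interval \<open>[0, \<ell>\<^sub>e]\<close>, or \<open>[0, \<infinity>)\<close> if \<open>\<ell>\<^sub>e = \<infinity>\<close>. Its endpoint at \<open>0\<close> is
  glued to \<open>edge_start G e\<close> and, for a bounded edge, its endpoint at \<open>\<ell>\<^sub>e\<close> to \<open>edge_end G e\<close>; the
  field \<open>edge_end\<close> is ignored for half-lines. Loops and parallel edges are allowed.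
\<close>

record ('v, 'e) metric_graph =
  vertices :: "'v set"
  edges :: "'e set"
  edge_start :: "'e \<Rightarrow> 'v"
  edge_end :: "'e \<Rightarrow> 'v"
  edge_length :: "'e \<Rightarrow> ereal"

definition half_lines :: "('v, 'e) metric_graph \<Rightarrow> 'e set" where
  "half_lines G = {e \<in> edges G. edge_length G e = \<infinity>}"

definition bounded_edges :: "('v, 'e) metric_graph \<Rightarrow> 'e set" where
  "bounded_edges G = {e \<in> edges G. edge_length G e < \<infinity>}"

definition edge_interval :: "('v, 'e) metric_graph \<Rightarrow> 'e \<Rightarrow> real set" where
  "edge_interval G e = {x. 0 \<le> x \<and> ereal x \<le> edge_length G e}"

text \<open>The points of the graph: its vertices and the interior points of its edges.\<close>

datatype ('v, 'e) point = Vertex 'v | Interior 'e real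

definition points :: "('v, 'e) metric_graph \<Rightarrow> ('v, 'e) point set" where
  "points G = Vertex ` vertices G \<union>
     {Interior e x | e x. e \<in> edges G \<and> 0 < x \<and> ereal x < edge_length G e}"

definition edge_point :: "('v, 'e) metric_graph \<Rightarrow> 'e \<Rightarrow> real \<Rightarrow> ('v, 'e) point" where
  "edge_point G e x =
     (if x = 0 then Vertex (edge_start G e)
      else if ereal x = edge_length G e then Vertex (edge_end G e)
      else Interior e x)"

definition restrict_edge ::
  "('v, 'e) metric_graph \<Rightarrow> (('v, 'e) point \<Rightarrow> real) \<Rightarrow> 'e \<Rightarrow> real \<Rightarrow> real" where
  "restrict_edge G u e x = u (edge_point G e x)"

text \<open>
  The topology of the graph is the quotient topology of the disjoint union of its edges; for finitely
  many edges of positive length it is the topology of the path metric.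
\<close>

definition graph_topology :: "('v, 'e) metric_graph \<Rightarrow> ('v, 'e) point topology" where
  "graph_topology G = topology (\<lambda>U. U \<subseteq> points G \<and>
     (\<forall>e \<in> edges G. openin (top_of_set (edge_interval G e))
        {x \<in> edge_interval G e. edge_point G e x \<in> U}))"

lemma openin_graph_topology:
  "openin (graph_topology G) U \<longleftrightarrow> U \<subseteq> points G \<and>
     (\<forall>e \<in> edges G. openin (top_of_set (edge_interval G e))
        {x \<in> edge_interval G e. edge_point G e x \<in> U})"
proof -
  have "istopology (\<lambda>U. U \<subseteq> points G \<and>
     (\<forall>e \<in> edges G. openin (top_of_set (edge_interval G e))
        {x \<in> edge_interval G e. edge_point G e x \<in> U}))"
    unfolding istopology_def
  proof (intro conjI allI impI ballI, goal_cases)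
    case (1 S T)
    then show ?case by blast
  next
    case (2 S T e)
    have "{x \<in> edge_interval G e. edge_point G e x \<in> S \<inter> T} =
        {x \<in> edge_interval G e. edge_point G e x \<in> S} \<inter>
        {x \<in> edge_interval G e. edge_point G e x \<in> T}" by blast
    moreover have "openin (top_of_set (edge_interval G e))
        ({x \<in> edge_interval G e. edge_point G e x \<in> S} \<inter>
         {x \<in> edge_interval G e. edge_point G e x \<in> T})"
      by (rule openin_Int) (use 2 in blast)+
    ultimately show ?case by simp
  next
    case (3 K)
    then show ?case by blast
  next
    case (4 K e)
    have "{x \<in> edge_interval G e. edge_point G e x \<in> \<Union>K} =
        \<Union>((\<lambda>S. {x \<in> edge_interval G e. edge_point G e x \<in> S}) ` K)" by blast
    moreover have "openin (top_of_set (edge_interval G e))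
        (\<Union>((\<lambda>S. {x \<in> edge_interval G e. edge_point G e x \<in> S}) ` K))"
      by (rule openin_Union) (use 4 in blast)
    ultimately show ?case by simp
  qed
  then show ?thesis
    unfolding graph_topology_def by (simp add: topology_inverse')
qed

definition G_fin :: "('v, 'e) metric_graph set" where
  "G_fin = {G. finite (vertices G) \<and> vertices G \<noteq> {} \<and> finite (edges G) \<and>
     (\<forall>e \<in> edges G. edge_start G e \<in> vertices G \<and>
        (edge_length G e < \<infinity> \<longrightarrow> edge_end G e \<in> vertices G) \<and> 0 < edge_length G e) \<and>
     connected_space (graph_topology G)}"

lemma topspace_graph_topology:
  assumes "G \<in> G_fin"
  shows "topspace (graph_topology G) = points G"
proof -
  have "edge_point G e x \<in> points G" if "e \<in> edges G" "x \<in> edge_interval G e" for e x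
    using that assms
    by (auto simp: edge_point_def points_def edge_interval_def G_fin_def less_le)
  then have "{x \<in> edge_interval G e. edge_point G e x \<in> points G} = edge_interval G e"
    if "e \<in> edges G" for e
    using that by blast
  then have "openin (graph_topology G) (points G)"
    unfolding openin_graph_topology by auto
  then show ?thesis
    by (metis openin_graph_topology openin_subset openin_topspace subset_antisym)
qed


section \<open>Function spaces\<close>

definition ess_inf :: "'a measure \<Rightarrow> ('a \<Rightarrow> ereal) \<Rightarrow> ereal" where
  "ess_inf M f = - esssup M (\<lambda>x. - f x)"

definition L2_on :: "real set \<Rightarrow> (real \<Rightarrow> real) set" where
  "L2_on I = {f. f \<in> borel_measurable (lebesgue_on I) \<and>
     integrable (lebesgue_on I) (\<lambda>x. (f x)\<^sup>2)}"

definition C1_compact_support :: "real set \<Rightarrow> (real \<Rightarrow> real) set" where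
  "C1_compact_support J = {\<phi>. \<phi> C1_differentiable_on UNIV \<and>
     compact (closure {x. \<phi> x \<noteq> 0}) \<and> closure {x. \<phi> x \<noteq> 0} \<subseteq> J}"

definition has_weak_deriv :: "real set \<Rightarrow> (real \<Rightarrow> real) \<Rightarrow> (real \<Rightarrow> real) \<Rightarrow> bool" where
  "has_weak_deriv I f g \<longleftrightarrow> (\<forall>\<phi> \<in> C1_compact_support (interior I).
     (LINT x|lebesgue_on I. f x * deriv \<phi> x) = - (LINT x|lebesgue_on I. g x * \<phi> x))"

definition H1_on :: "real set \<Rightarrow> (real \<Rightarrow> real) set" where
  "H1_on I = {f \<in> L2_on I. \<exists>g \<in> L2_on I. has_weak_deriv I f g}"

text \<open>A representative of the derivative of an \<open>H\<^sup>1\<close> function, unique up to null sets.\<close>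

definition weak_deriv :: "real set \<Rightarrow> (real \<Rightarrow> real) \<Rightarrow> real \<Rightarrow> real" where
  "weak_deriv I f = (SOME g. g \<in> L2_on I \<and> has_weak_deriv I f g)"

definition edge_deriv ::
  "('v, 'e) metric_graph \<Rightarrow> (('v, 'e) point \<Rightarrow> real) \<Rightarrow> 'e \<Rightarrow> real \<Rightarrow> real" where
  "edge_deriv G u e = weak_deriv (edge_interval G e) (restrict_edge G u e)"

definition graph_integral :: "('v, 'e) metric_graph \<Rightarrow> ('e \<Rightarrow> real \<Rightarrow> real) \<Rightarrow> real" where
  "graph_integral G F = (\<Sum>e\<in>edges G. LINT x|lebesgue_on (edge_interval G e). F e x)"

definition L2_norm_graph :: "('v, 'e) metric_graph \<Rightarrow> (('v, 'e) point \<Rightarrow> real) \<Rightarrow> real" where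
  "L2_norm_graph G u = sqrt (graph_integral G (\<lambda>e x. (restrict_edge G u e x)\<^sup>2))"

definition Linf_norm_graph :: "('v, 'e) metric_graph \<Rightarrow> (('v, 'e) point \<Rightarrow> real) \<Rightarrow> ereal" where
  "Linf_norm_graph G u = (SUP e \<in> edges G.
     esssup (lebesgue_on (edge_interval G e)) (\<lambda>x. ereal \<bar>restrict_edge G u e x\<bar>))"

definition Linf_graph :: "('v, 'e) metric_graph \<Rightarrow> (('v, 'e) point \<Rightarrow> real) set" where
  "Linf_graph G = {f.
     (\<forall>e \<in> edges G. restrict_edge G f e \<in> borel_measurable (lebesgue_on (edge_interval G e))) \<and>
     Linf_norm_graph G f < \<infinity>}"

text \<open>The essential infimum over the compact core (\<open>\<infinity>\<close> if there are no bounded edges).\<close>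

definition core_ess_inf :: "('v, 'e) metric_graph \<Rightarrow> (('v, 'e) point \<Rightarrow> real) \<Rightarrow> ereal" where
  "core_ess_inf G f = (INF e \<in> bounded_edges G.
     ess_inf (lebesgue_on (edge_interval G e)) (\<lambda>x. ereal (restrict_edge G f e x)))"

text \<open>
  Continuous functions on the graph are represented by total functions that are \<open>0\<close> outside
  \<open>points G\<close>, so that equality of functions is equality on the graph.
\<close>

definition C_graph :: "('v, 'e) metric_graph \<Rightarrow> (('v, 'e) point \<Rightarrow> real) set" where
  "C_graph G = {u. continuous_map (graph_topology G) euclideanreal u \<and>
     (\<forall>P. P \<notin> points G \<longrightarrow> u P = 0)}"

definition Cc_graph :: "('v, 'e) metric_graph \<Rightarrow> (('v, 'e) point \<Rightarrow> real) set" where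
  "Cc_graph G = {u \<in> C_graph G.
     compactin (graph_topology G) (graph_topology G closure_of {P \<in> points G. u P \<noteq> 0})}"

definition H1_graph :: "('v, 'e) metric_graph \<Rightarrow> (('v, 'e) point \<Rightarrow> real) set" where
  "H1_graph G = {u \<in> C_graph G. \<forall>e \<in> edges G. restrict_edge G u e \<in> H1_on (edge_interval G e)}"


section \<open>Solutions and Morse index\<close>

definition solves_E :: "('v, 'e) metric_graph \<Rightarrow> real \<Rightarrow> (('v, 'e) point \<Rightarrow> real) \<Rightarrow>
    (('v, 'e) point \<Rightarrow> real) \<Rightarrow> real \<Rightarrow> (('v, 'e) point \<Rightarrow> real) \<Rightarrow> bool" where
  "solves_E G p W \<rho> l u \<longleftrightarrow> u \<in> H1_graph G \<and>
     (\<forall>\<phi> \<in> H1_graph G \<inter> Cc_graph G.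
        graph_integral G (\<lambda>e x. edge_deriv G u e x * edge_deriv G \<phi> e x +
          (restrict_edge G W e x + l) * restrict_edge G u e x * restrict_edge G \<phi> e x) =
        graph_integral G (\<lambda>e x. restrict_edge G \<rho> e x * \<bar>restrict_edge G u e x\<bar> powr (p - 2) *
          restrict_edge G u e x * restrict_edge G \<phi> e x))"

definition second_variation :: "('v, 'e) metric_graph \<Rightarrow> real \<Rightarrow> (('v, 'e) point \<Rightarrow> real) \<Rightarrow>
    (('v, 'e) point \<Rightarrow> real) \<Rightarrow> real \<Rightarrow> (('v, 'e) point \<Rightarrow> real) \<Rightarrow> (('v, 'e) point \<Rightarrow> real) \<Rightarrow> real"
  where
  "second_variation G p W \<rho> l u \<phi> =
     graph_integral G (\<lambda>e x. \<bar>edge_deriv G \<phi> e x\<bar>\<^sup>2 +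
       (restrict_edge G W e x + l) * (restrict_edge G \<phi> e x)\<^sup>2 -
       (p - 1) * restrict_edge G \<rho> e x * \<bar>restrict_edge G u e x\<bar> powr (p - 2) *
         (restrict_edge G \<phi> e x)\<^sup>2)"

definition fun_scale :: "real \<Rightarrow> ('a \<Rightarrow> real) \<Rightarrow> 'a \<Rightarrow> real" where
  "fun_scale c u = (\<lambda>P. c * u P)"

global_interpretation fun_vs: vector_space fun_scale
  by unfold_locales (auto simp: fun_scale_def fun_eq_iff algebra_simps)

text \<open>\<open>fun_vs.dim\<close> is a natural number, meaningful only for finite-dimensional subspaces.\<close>

definition fun_edim :: "('a \<Rightarrow> real) set \<Rightarrow> enat" where
  "fun_edim X = (if \<exists>B. finite B \<and> X \<subseteq> fun_vs.span B then enat (fun_vs.dim X) else \<infinity>)"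

definition morse_index :: "('v, 'e) metric_graph \<Rightarrow> real \<Rightarrow> (('v, 'e) point \<Rightarrow> real) \<Rightarrow>
    (('v, 'e) point \<Rightarrow> real) \<Rightarrow> real \<Rightarrow> (('v, 'e) point \<Rightarrow> real) \<Rightarrow> enat" where
  "morse_index G p W \<rho> l u = Sup {fun_edim X | X. fun_vs.subspace X \<and>
     X \<subseteq> H1_graph G \<inter> Cc_graph G \<and> (\<forall>\<phi> \<in> X - {0}. second_variation G p W \<rho> l u \<phi> < 0)}"

definition q_mass :: "('v, 'e) metric_graph \<Rightarrow> real \<Rightarrow> (('v, 'e) point \<Rightarrow> real) \<Rightarrow>
    (('v, 'e) point \<Rightarrow> real) \<Rightarrow> nat \<Rightarrow> real \<Rightarrow> ereal" where
  "q_mass G p W \<rho> m l =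
     (let S = {u \<in> H1_graph G - {0}. solves_E G p W \<rho> l u \<and> morse_index G p W \<rho> l u \<le> enat m}
      in if S = {} then 0 else (SUP u \<in> S. ereal (L2_norm_graph G u)))"

end

theory Submission
  imports Defs
begin

text \<open>
  Everything happens in the interior of a single edge; the vertex conditions play no role. For a
  solution \<open>w\<close> and a cutoff \<open>\<eta>\<close>, testing the equation with \<open>w \<eta>\<^sup>2\<close> turns the second variation at \<open>w \<eta>\<close>
  into \<open>\<integral> w\<^sup>2 \<eta>'\<^sup>2 - (p - 2) \<integral> \<rho> \<bar>w\<bar>\<^sup>p \<eta>\<^sup>2\<close>, and a Morse index at most \<open>m\<close> forbids \<open>m + 1\<close> disjoint intervals
  carrying a negative direction.

  Sup bound: split a unit interval (after rescaling) into \<open>m + 1\<close> pieces. On a stable piece the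
  identity and Young's inequality bound \<open>w\<close> and \<open>w'\<close> at some point. Every nodal interval is unstable,
  so at most \<open>m\<close> of them have to be crossed to reach any other point, and on an interval without zeros
  the equation gives a Gronwall type bound. Undoing the rescaling, \<open>\<bar>w\<bar> \<le> C h powr (- 2 / (p - 2))\<close> on
  intervals of length \<open>h\<close> with \<open>h\<^sup>2 \<bar>W + \<lambda>\<bar> \<le> 1/2\<close>. For \<open>\<lambda> = 0\<close> on a half-line, \<open>h \<rightarrow> \<infinity>\<close> yields \<open>w = 0\<close>.

  Mass bound, for \<open>W + \<lambda>\<close> comparable to \<open>\<lambda> > 0\<close>: cut the edge into cells of length \<open>N / sqrt \<lambda>\<close>. In the middle
  of a stable triple of cells, \<open>\<integral> w\<^sup>2\<close> is at most a sixth of its value on the triple; at most \<open>3 m\<close> triples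
  are unstable and there the sup bound applies, so summation absorbs the rest. For \<open>\<lambda> < 0\<close> the half-line
  carries infinitely many negative directions.
\<close>

section \<open>Integration by parts against a primitive\<close>

text \<open>Since \<open>\<rho>\<close> is only bounded and measurable, no energy is conserved along
  an edge, and a solution may grow with every oscillation. The Morse index limits the number of
  oscillations, and each one costs one application of the fixed map \<open>step_bound\<close>; this
  is how the constants become explicit. Between zeros the nonlinear term has a favourable sign, and
  only the linear term, made small by rescaling, has to be controlled.

  As \<open>W\<close> is rough too, there is no classical second derivative: on an edge the equation
  is kept as an integral identity for \<open>w'\<close>.

  The cell argument needs a factor below one third because a cell lies in up to three triples; a
  sixth leaves one half to absorb. It needs \<lambda> large compared with \<open>W\<close> and with
  the inverse square of the shortest edge. Half-lines need neither, so claim 4 has a constant from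
  the core and a power from the half-lines. In claim 5 the gap between the given threshold and the
  required one is bridged by the sup bound, as the power of \<lambda> is bounded below
  there.\<close>

lemma bounded_measurable_times_continuous_integrable:
  fixes r g :: "real \<Rightarrow> real"
  assumes "r \<in> borel_measurable lebesgue" "\<And>x. \<bar>r x\<bar> \<le> K" "continuous_on {a..b} g"
  shows "(\<lambda>x. r x * g x) absolutely_integrable_on {a..b}"
proof (rule absolutely_integrable_bounded_measurable_product_real)
  show "r \<in> borel_measurable (lebesgue_on {a..b})"
    using assms(1) by (simp add: measurable_restrict_space1)
  show "bounded (r ` {a..b})" using assms(2) by (auto simp: bounded_iff)
  show "g absolutely_integrable_on {a..b}"
    using assms(3) absolutely_integrable_continuous_real by blast
qed auto

lemma bounded_measurable_times_continuous_integrable':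
  fixes r g :: "real \<Rightarrow> real"
  assumes "r \<in> borel_measurable lebesgue" "\<And>x. \<bar>r x\<bar> \<le> K" "continuous_on {a..b} g"
  shows "(\<lambda>x. r x * g x) integrable_on {a..b}"
  using bounded_measurable_times_continuous_integrable[OF assms]
  by (simp add: absolutely_integrable_on_def)

lemma continuous_on_Icc_abs_bound:
  fixes f :: "real \<Rightarrow> real"
  assumes "continuous_on {a..b} f"
  obtains M where "\<And>x. x \<in> {a..b} \<Longrightarrow> \<bar>f x\<bar> \<le> M"
  using compact_imp_bounded[OF compact_continuous_image[OF assms compact_Icc]]
  unfolding bounded_iff by force

lemma absolutely_integrable_times_continuous:
  fixes v \<psi> :: "real \<Rightarrow> real"
  assumes "v absolutely_integrable_on {a..b}" "continuous_on {a..b} \<psi>"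
  shows "(\<lambda>t. v t * \<psi> t) absolutely_integrable_on {a..b}"
proof -
  have "(\<lambda>t. \<psi> t * v t) absolutely_integrable_on {a..b}"
    by (intro absolutely_integrable_bounded_measurable_product_real assms(1))
      (use assms(2) in \<open>auto intro: continuous_imp_measurable_on_sets_lebesgue compact_imp_bounded compact_continuous_image\<close>)
  then show ?thesis by (simp add: mult.commute)
qed

lemma integrable_times_continuous_UNIV:
  fixes v \<psi> :: "real \<Rightarrow> real"
  assumes "v absolutely_integrable_on {a..b}" "continuous_on UNIV \<psi>"
  shows "(\<lambda>t. v t * \<psi> t) integrable_on {a..b}"
  using absolutely_integrable_times_continuous[OF assms(1) continuous_on_subset[OF assms(2)]]
  by (simp add: absolutely_integrable_on_def)

lemma quadratic_modulus_imp_const: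
  fixes H :: "real \<Rightarrow> real"
  assumes "\<And>s t. \<lbrakk>a \<le> s; s \<le> t; t \<le> b\<rbrakk> \<Longrightarrow> \<bar>H t - H s\<bar> \<le> C * (t - s)\<^sup>2" "a \<le> b"
  shows "H b = H a"
proof -
  have C: "C \<ge> 0" if "a < b"
    using assms(1)[of a b] that by (smt (verit) mult_nonneg_nonneg mult_neg_pos zero_less_power)
  have "(H has_real_derivative 0) (at x within {a..b})" if x: "x \<in> {a..b}" for x
    unfolding has_field_derivative_iff
  proof (rule Lim_null_comparison)
    show "\<forall>\<^sub>F y in at x within {a..b}. norm ((H y - H x) / (y - x)) \<le> C * \<bar>y - x\<bar>"
      unfolding eventually_at_filter
    proof (intro always_eventually allI impI)
      fix y assume y: "y \<noteq> x" "y \<in> {a..b}"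
      have "\<bar>H y - H x\<bar> \<le> C * \<bar>y - x\<bar> * \<bar>y - x\<bar>"
      proof (cases "x \<le> y")
        case True then show ?thesis using assms(1)[of x y] x y by (simp add: power2_eq_square)
      next
        case False
        then have "\<bar>H x - H y\<bar> \<le> C * (x - y)\<^sup>2" using assms(1)[of y x] x y by simp
        then show ?thesis using False by (simp add: power2_eq_square abs_minus_commute algebra_simps)
      qed
      then show "norm ((H y - H x) / (y - x)) \<le> C * \<bar>y - x\<bar>"
        using y by (simp add: field_simps)
    qed
    have "((\<lambda>y. C * \<bar>y - x\<bar>) \<longlongrightarrow> C * \<bar>x - x\<bar>) (at x within {a..b})"
      by (intro tendsto_intros)
    then show "((\<lambda>y. C * \<bar>y - x\<bar>) \<longlongrightarrow> 0) (at x within {a..b})" by simp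
  qed
  then obtain c where "\<forall>x\<in>{a..b}. H x = c"
    using has_field_derivative_zero_constant[of "{a..b}" H] by (auto)
  then show ?thesis using \<open>a \<le> b\<close> by auto
qed

lemma abs_integral_le_length:
  fixes g :: "real \<Rightarrow> real"
  assumes "g integrable_on {s..t}" "s \<le> t" "\<And>x. x \<in> {s..t} \<Longrightarrow> \<bar>g x\<bar> \<le> B"
  shows "\<bar>integral {s..t} g\<bar> \<le> B * (t - s)"
proof -
  have "norm (integral {s..t} g) \<le> integral {s..t} (\<lambda>x. B)"
    by (rule integral_norm_bound_integral) (use assms in auto)
  then show ?thesis using assms by (simp add: mult.commute)
qed

text \<open>
  Both sides have the same increments up to an error quadratic in the length of the interval; so no
  absolute continuity theory is needed.
\<close>

lemma integral_parts_primitive: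
  fixes f \<phi> \<phi>' :: "real \<Rightarrow> real"
  assumes ab: "a \<le> b"
    and f: "f \<in> borel_measurable (lebesgue_on {a..b})" "\<And>x. x \<in> {a..b} \<Longrightarrow> \<bar>f x\<bar> \<le> K"
    and \<phi>: "\<And>x. x \<in> {a..b} \<Longrightarrow> (\<phi> has_real_derivative \<phi>' x) (at x within {a..b})"
    and \<phi>': "continuous_on {a..b} \<phi>'"
  shows "integral {a..b} (\<lambda>x. f x * \<phi> x) + integral {a..b} (\<lambda>x. integral {a..x} f * \<phi>' x)
    = integral {a..b} f * \<phi> b"
proof -
  define F where "F = (\<lambda>x. integral {a..x} f)"
  have fg: "(\<lambda>x. f x * g x) integrable_on {a..b}" if "continuous_on {a..b} g" for g
  proof -
    have "(\<lambda>x. f x * g x) absolutely_integrable_on {a..b}"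
      by (rule absolutely_integrable_bounded_measurable_product_real)
        (use f that absolutely_integrable_continuous_real in \<open>auto simp: bounded_iff intro!: exI[of _ K]\<close>)
    then show ?thesis by (simp add: absolutely_integrable_on_def)
  qed
  have fi: "f integrable_on {a..b}" using fg[of "\<lambda>_. 1"] by simp
  have c\<phi>: "continuous_on {a..b} \<phi>" using \<phi> by (meson DERIV_continuous_on)
  have cF: "continuous_on {a..b} F" unfolding F_def
    using indefinite_integral_continuous_1[OF fi] by simp
  obtain L where L: "\<And>x. x \<in> {a..b} \<Longrightarrow> \<bar>\<phi>' x\<bar> \<le> L"
    using continuous_on_Icc_abs_bound[OF \<phi>'] by blast
  have K0: "K \<ge> 0" "L \<ge> 0" using f(2)[of a] L[of a] ab by auto
  have sub: "g integrable_on {s..t}" if "g integrable_on {a..b}" "a \<le> s" "t \<le> b" for g :: "real \<Rightarrow> real" and s t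
    using that integrable_on_subinterval[of g "{a..b}" s t] by auto
  have comb: "integral {a..t} g = integral {a..s} g + integral {s..t} g"
    if "g integrable_on {a..b}" "a \<le> s" "s \<le> t" "t \<le> b" for g :: "real \<Rightarrow> real" and s t
    using Henstock_Kurzweil_Integration.integral_combine[of a s t g] sub[of g a t] that by simp
  have F\<phi>': "(\<lambda>x. F x * \<phi>' x) integrable_on {a..b}"
    by (intro integrable_continuous_real continuous_intros cF \<phi>')
  \<comment> \<open>\<open>H s\<close> is the defect of the claimed identity on
    \<open>{a..s}\<close>, and it vanishes at \<open>a\<close>.\<close>
  define H where "H = (\<lambda>s. integral {a..s} (\<lambda>x. f x * \<phi> x) - F s * \<phi> s + integral {a..s} (\<lambda>x. F x * \<phi>' x))"
  have dphi: "(\<phi>' has_integral (\<phi> t - \<phi> s)) {s..t}" if "a \<le> s" "s \<le> t" "t \<le> b" for s t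
  proof (rule fundamental_theorem_of_calculus[OF that(2)])
    fix x assume "x \<in> {s..t}"
    then have "(\<phi> has_real_derivative \<phi>' x) (at x within {s..t})"
      using has_field_derivative_subset[OF \<phi>[of x], of "{s..t}"] that by auto
    then show "(\<phi> has_vector_derivative \<phi>' x) (at x within {s..t})"
      by (simp add: has_real_derivative_iff_has_vector_derivative)
  qed
  have "H b = H a"
  proof (rule quadratic_modulus_imp_const[OF _ ab, where C = "2 * K * L"])
    fix s t assume st: "a \<le> s" "s \<le> t" "t \<le> b"
    have sti: "x \<in> {s..t} \<Longrightarrow> x \<in> {a..b}" for x using st by auto
    have i1: "(\<lambda>x. f x * \<phi> x) integrable_on {s..t}" using sub[OF fg[OF c\<phi>]] st by simp
    have i2: "f integrable_on {s..t}" using sub[OF fi] st by simp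
    have i3: "\<phi>' integrable_on {s..t}" using dphi[OF st] by blast
    have i4: "(\<lambda>x. F x * \<phi>' x) integrable_on {s..t}" using sub[OF F\<phi>'] st by simp
    have e1: "integral {s..t} (\<lambda>x. f x * (\<phi> x - \<phi> s)) =
        integral {s..t} (\<lambda>x. f x * \<phi> x) - (F t - F s) * \<phi> s"
    proof -
      have "integral {s..t} (\<lambda>x. f x * \<phi> x - f x * \<phi> s) =
        integral {s..t} (\<lambda>x. f x * \<phi> x) - integral {s..t} (\<lambda>x. f x * \<phi> s)"
        by (rule Henstock_Kurzweil_Integration.integral_diff[OF i1 integrable_on_mult_left[OF i2]])
      moreover have "integral {s..t} f = F t - F s" unfolding F_def using comb[OF fi st] by simp
      ultimately show ?thesis by (simp add: right_diff_distrib)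
    qed
    have e2: "integral {s..t} (\<lambda>x. (F x - F t) * \<phi>' x) =
        integral {s..t} (\<lambda>x. F x * \<phi>' x) - F t * (\<phi> t - \<phi> s)"
    proof -
      have "integral {s..t} (\<lambda>x. F x * \<phi>' x - F t * \<phi>' x) =
        integral {s..t} (\<lambda>x. F x * \<phi>' x) - integral {s..t} (\<lambda>x. F t * \<phi>' x)"
        by (rule Henstock_Kurzweil_Integration.integral_diff[OF i4 integrable_on_mult_right[OF i3]])
      moreover have "integral {s..t} \<phi>' = \<phi> t - \<phi> s" using dphi[OF st] by blast
      ultimately show ?thesis by (simp add: left_diff_distrib)
    qed
    \<comment> \<open>Replacing \<phi> by \<open>\<phi> x - \<phi> s\<close> and \<open>F\<close> by
      \<open>F x - F t\<close> accounts exactly for the increment of \<open>F * \<phi>\<close>. Each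
      remaining integrand has a factor of size \<open>t - s\<close>, and integration supplies the
      second one.\<close>
    have "H t - H s = integral {s..t} (\<lambda>x. f x * (\<phi> x - \<phi> s)) + integral {s..t} (\<lambda>x. (F x - F t) * \<phi>' x)"
      unfolding e1 e2 H_def using comb[OF fg[OF c\<phi>] st] comb[OF F\<phi>' st] by (simp add: algebra_simps)
    moreover have "\<bar>integral {s..t} (\<lambda>x. f x * (\<phi> x - \<phi> s))\<bar> \<le> (K * (L * (t - s))) * (t - s)"
    proof (rule abs_integral_le_length)
      show "(\<lambda>x. f x * (\<phi> x - \<phi> s)) integrable_on {s..t}"
        by (rule sub[OF fg]) (use st c\<phi> in \<open>auto intro!: continuous_intros\<close>)
      fix x assume x: "x \<in> {s..t}"
      have "\<bar>integral {s..x} \<phi>'\<bar> \<le> L * (x - s)"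
        by (rule abs_integral_le_length) (use x st L sub[of \<phi>' s x] dphi[of s x] in auto)
      also have "integral {s..x} \<phi>' = \<phi> x - \<phi> s" using dphi[of s x] x st by auto
      also have "L * (x - s) \<le> L * (t - s)" using x K0 by (intro mult_left_mono) auto
      finally show "\<bar>f x * (\<phi> x - \<phi> s)\<bar> \<le> K * (L * (t - s))"
        unfolding abs_mult using f(2)[OF sti[OF x]] K0 by (intro mult_mono) auto
    qed (use st in auto)
    moreover have "\<bar>integral {s..t} (\<lambda>x. (F x - F t) * \<phi>' x)\<bar> \<le> ((K * (t - s)) * L) * (t - s)"
    proof (rule abs_integral_le_length)
      show "(\<lambda>x. (F x - F t) * \<phi>' x) integrable_on {s..t}"
        by (rule sub[where s=s and t=t], intro integrable_continuous_real continuous_intros cF \<phi>') (use st in auto)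
      fix x assume x: "x \<in> {s..t}"
      have "\<bar>integral {x..t} f\<bar> \<le> K * (t - x)"
        by (rule abs_integral_le_length) (use x st f sub[OF fi] in auto)
      also have "integral {x..t} f = F t - F x" unfolding F_def using comb[OF fi, of x t] x st by simp
      also have "K * (t - x) \<le> K * (t - s)" using x K0 by (intro mult_left_mono) auto
      finally have "\<bar>F x - F t\<bar> \<le> K * (t - s)" by linarith
      then show "\<bar>(F x - F t) * \<phi>' x\<bar> \<le> (K * (t - s)) * L"
        unfolding abs_mult using L[OF sti[OF x]] K0 st by (intro mult_mono) auto
    qed (use st in auto)
    ultimately show "\<bar>H t - H s\<bar> \<le> 2 * K * L * (t - s)\<^sup>2"
      by (simp add: power2_eq_square algebra_simps)
  qed
  then show ?thesis by (simp add: H_def F_def)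
qed


section \<open>One-dimensional solutions and their instability\<close>

text \<open>The equation is \<open>w'' = nl_rhs p V r w\<close>; on an edge \<open>V\<close> stands
  for \<open>W + \<lambda>\<close> and \<open>r\<close> for \<open>\<rho>\<close>.\<close>

definition nl_rhs :: "real \<Rightarrow> (real \<Rightarrow> real) \<Rightarrow> (real \<Rightarrow> real) \<Rightarrow> (real \<Rightarrow> real) \<Rightarrow> real \<Rightarrow> real" where
  "nl_rhs p V r w x = V x * w x - r x * (\<bar>w x\<bar> powr (p - 2) * w x)"

definition test_fun :: "real \<Rightarrow> real \<Rightarrow> (real \<Rightarrow> real) \<Rightarrow> (real \<Rightarrow> real) \<Rightarrow> bool" where
  "test_fun c d \<phi> \<phi>' \<longleftrightarrow> c < d \<and> \<phi> c = 0 \<and> \<phi> d = 0 \<and> continuous_on {c..d} \<phi>' \<and>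
     (\<forall>x\<in>{c..d}. (\<phi> has_real_derivative \<phi>' x) (at x within {c..d}))"

definition quad_form :: "real \<Rightarrow> (real \<Rightarrow> real) \<Rightarrow> (real \<Rightarrow> real) \<Rightarrow> (real \<Rightarrow> real) \<Rightarrow>
    real \<Rightarrow> real \<Rightarrow> (real \<Rightarrow> real) \<Rightarrow> (real \<Rightarrow> real) \<Rightarrow> real" where
  "quad_form p V r w c d \<phi> \<phi>' = integral {c..d} (\<lambda>x. (\<phi>' x)\<^sup>2 + V x * (\<phi> x)\<^sup>2 -
     (p - 1) * r x * \<bar>w x\<bar> powr (p - 2) * (\<phi> x)\<^sup>2)"

definition unstable_on :: "real \<Rightarrow> (real \<Rightarrow> real) \<Rightarrow> (real \<Rightarrow> real) \<Rightarrow> (real \<Rightarrow> real) \<Rightarrow>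
    real \<Rightarrow> real \<Rightarrow> bool" where
  "unstable_on p V r w c d \<longleftrightarrow>
     (\<exists>\<phi> \<phi>'. test_fun c d \<phi> \<phi>' \<and> quad_form p V r w c d \<phi> \<phi>' < 0)"

text \<open>The intervals come in no particular order and may share endpoints. This is harmless,
  because the test functions vanish there.\<close>

definition disjoint_unstable :: "real \<Rightarrow> (real \<Rightarrow> real) \<Rightarrow> (real \<Rightarrow> real) \<Rightarrow> (real \<Rightarrow> real) \<Rightarrow>
    nat \<Rightarrow> real \<Rightarrow> real \<Rightarrow> bool" where
  "disjoint_unstable p V r w k a b \<longleftrightarrow> (\<exists>c d :: nat \<Rightarrow> real.
     (\<forall>i<k. a \<le> c i \<and> d i \<le> b \<and> unstable_on p V r w (c i) (d i)) \<and>
     (\<forall>i<k. \<forall>j<k. i \<noteq> j \<longrightarrow> d i \<le> c j \<or> d j \<le> c i))"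

section \<open>Families of non-overlapping unstable intervals\<close>

lemma unstable_on_less: "unstable_on p V r w c d \<Longrightarrow> c < d"
  by (auto simp: unstable_on_def test_fun_def)

lemma disjoint_unstable_0 [simp]: "disjoint_unstable p V r w 0 a b"
  by (simp add: disjoint_unstable_def)

lemma disjoint_unstable_mono:
  assumes "disjoint_unstable p V r w k a b" "a' \<le> a" "b \<le> b'" "k' \<le> k"
  shows "disjoint_unstable p V r w k' a' b'"
proof -
  from assms(1) obtain c d where
    1: "\<forall>i<k. a \<le> c i \<and> d i \<le> b \<and> unstable_on p V r w (c i) (d i)" and
    2: "\<forall>i<k. \<forall>j<k. i \<noteq> j \<longrightarrow> d i \<le> c j \<or> d j \<le> c i"
    unfolding disjoint_unstable_def by blast
  have "a' \<le> c i \<and> d i \<le> b' \<and> unstable_on p V r w (c i) (d i)" if "i < k'" for i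
    using 1[rule_format, of i] that assms(2-) by auto
  moreover have "\<forall>i<k'. \<forall>j<k'. i \<noteq> j \<longrightarrow> d i \<le> c j \<or> d j \<le> c i"
    using 2 assms(4) by simp
  ultimately show ?thesis unfolding disjoint_unstable_def by blast
qed

lemma disjoint_unstable_Suc:
  assumes "disjoint_unstable p V r w k a b" "unstable_on p V r w c d" "b \<le> c \<or> d \<le> a"
    "a' \<le> a" "a' \<le> c" "b \<le> b'" "d \<le> b'"
  shows "disjoint_unstable p V r w (Suc k) a' b'"
proof -
  from assms(1) obtain c' d' where *:
    "\<forall>i<k. a \<le> c' i \<and> d' i \<le> b \<and> unstable_on p V r w (c' i) (d' i)"
    "\<forall>i<k. \<forall>j<k. i \<noteq> j \<longrightarrow> d' i \<le> c' j \<or> d' j \<le> c' i"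
    unfolding disjoint_unstable_def by blast
  let ?c = "c'(k := c)" and ?d = "d'(k := d)"
  have "\<forall>i<Suc k. a' \<le> ?c i \<and> ?d i \<le> b' \<and> unstable_on p V r w (?c i) (?d i)"
  proof (intro allI impI)
    fix i assume "i < Suc k"
    then consider "i < k" | "i = k" by linarith
    then show "a' \<le> ?c i \<and> ?d i \<le> b' \<and> unstable_on p V r w (?c i) (?d i)"
    proof cases
      case 1 then show ?thesis using *(1)[rule_format, of i] assms(4-) by auto
    next
      case 2 then show ?thesis using assms by auto
    qed
  qed
  moreover have "\<forall>i<Suc k. \<forall>j<Suc k. i \<noteq> j \<longrightarrow> ?d i \<le> ?c j \<or> ?d j \<le> ?c i"
  proof (intro allI impI)
    fix i j assume ij: "i < Suc k" "j < Suc k" "i \<noteq> j"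
    then consider "i < k" "j < k" | "i = k" "j < k" | "j = k" "i < k" by linarith
    then show "?d i \<le> ?c j \<or> ?d j \<le> ?c i"
    proof cases
      case 1 then show ?thesis using *(2) ij by simp
    next
      case 2
      then have "a \<le> c' j" "d' j \<le> b" using *(1) by auto
      then show ?thesis using 2 assms(3) by auto
    next
      case 3
      then have "a \<le> c' i" "d' i \<le> b" using *(1) by auto
      then show ?thesis using 3 assms(3) by auto
    qed
  qed
  ultimately show ?thesis unfolding disjoint_unstable_def by blast
qed

lemma disjoint_unstable_family:
  assumes "finite I" "\<And>i. i \<in> I \<Longrightarrow> a \<le> c i \<and> d i \<le> b \<and> unstable_on p V r w (c i) (d i)"
    and "\<And>i j. i \<in> I \<Longrightarrow> j \<in> I \<Longrightarrow> i \<noteq> j \<Longrightarrow> d i \<le> c j \<or> d j \<le> c i"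
  shows "disjoint_unstable p V r w (card I) a b"
proof -
  obtain h where h: "bij_betw h {..<card I} I"
    using ex_bij_betw_nat_finite[OF assms(1)] by (auto simp: lessThan_atLeast0)
  have h': "h i \<in> I" "\<lbrakk>j < card I; i \<noteq> j\<rbrakk> \<Longrightarrow> h i \<noteq> h j" if "i < card I" for i j
    using h that by (auto simp: bij_betw_def inj_on_def)
  have "\<forall>i<card I. a \<le> (c \<circ> h) i \<and> (d \<circ> h) i \<le> b \<and> unstable_on p V r w ((c \<circ> h) i) ((d \<circ> h) i)"
    using assms(2) h'(1) by auto
  moreover have "\<forall>i<card I. \<forall>j<card I. i \<noteq> j \<longrightarrow> (d \<circ> h) i \<le> (c \<circ> h) j \<or> (d \<circ> h) j \<le> (c \<circ> h) i"
    using assms(3) h' by simp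
  ultimately show ?thesis unfolding disjoint_unstable_def by blast
qed

text \<open>The bounds hold at every point, not almost everywhere: the coefficients of an edge enter
  through truncated representatives, which leaves all integrals unchanged and avoids null sets in
  the one-dimensional analysis.\<close>

locale edge_coeffs =
  fixes p K \<rho>\<^sub>0 R :: real and V r :: "real \<Rightarrow> real"
  assumes p: "p > 2"
    and V_meas: "V \<in> borel_measurable lebesgue" and V_le: "\<And>x. \<bar>V x\<bar> \<le> K"
    and r_meas: "r \<in> borel_measurable lebesgue"
    and \<rho>\<^sub>0: "0 < \<rho>\<^sub>0" and r_ge: "\<And>x. \<rho>\<^sub>0 \<le> r x" and r_le: "\<And>x. r x \<le> R"
begin

lemma r_abs: "\<bar>r x\<bar> \<le> R" and r_pos: "r x > 0"
  using r_ge[of x] r_le[of x] \<rho>\<^sub>0 by auto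

lemma R_pos: "R > 0" using r_ge[of 0] r_le[of 0] \<rho>\<^sub>0 by auto

lemma K_nonneg: "K \<ge> 0" using V_le[of 0] by auto

lemmas V_int = bounded_measurable_times_continuous_integrable'[OF V_meas V_le]
lemmas r_int = bounded_measurable_times_continuous_integrable'[OF r_meas r_abs]

lemma continuous_on_pot:
  "continuous_on S w \<Longrightarrow> continuous_on S (\<lambda>x. \<bar>w x\<bar> powr (p - 2))"
  using p by (intro continuous_on_powr' continuous_intros) auto

lemma nl_rhs_abs_le:
  assumes "\<bar>w x\<bar> \<le> M"
  shows "\<bar>nl_rhs p V r w x\<bar> \<le> K * M + R * (M powr (p - 2) * M)"
proof -
  have "\<bar>nl_rhs p V r w x\<bar> \<le> \<bar>V x\<bar> * \<bar>w x\<bar> + \<bar>r x\<bar> * (\<bar>w x\<bar> powr (p - 2) * \<bar>w x\<bar>)"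
    unfolding nl_rhs_def by (rule order_trans[OF abs_triangle_ineq4]) (simp add: abs_mult)
  also have "\<dots> \<le> K * M + R * (M powr (p - 2) * M)"
    using assms V_le r_abs K_nonneg R_pos p by (intro add_mono mult_mono powr_mono2) auto
  finally show ?thesis .
qed

lemma quad_form_integrable:
  assumes "continuous_on {c..d} w" "continuous_on {c..d} \<phi>" "continuous_on {c..d} \<phi>'"
  shows "(\<lambda>x. (\<phi>' x)\<^sup>2 + V x * (\<phi> x)\<^sup>2 - (p - 1) * r x * \<bar>w x\<bar> powr (p - 2) * (\<phi> x)\<^sup>2)
    integrable_on {c..d}"
proof -
  have "(\<lambda>x. (\<phi>' x)\<^sup>2 + V x * (\<phi> x)\<^sup>2 - r x * ((p - 1) * \<bar>w x\<bar> powr (p - 2) * (\<phi> x)\<^sup>2))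
    integrable_on {c..d}"
    by (intro integrable_diff integrable_add V_int r_int integrable_continuous_real
        continuous_intros continuous_on_pot assms)
  then show ?thesis by (simp add: mult.assoc mult.left_commute)
qed

end

lemma test_fun_continuous:
  assumes "test_fun c d \<phi> \<phi>'" shows "continuous_on {c..d} \<phi>" "continuous_on {c..d} \<phi>'"
  using assms unfolding test_fun_def by (meson DERIV_continuous_on)+

text \<open>With bounded measurable coefficients \<open>w\<close> is C1 but \<open>dw\<close> need
  not be differentiable, so the equation says that \<open>dw\<close> is a primitive of
  \<open>nl_rhs\<close>. The derivative of \<open>w\<close> is two-sided even at \<open>a\<close>
  and \<open>b\<close>: solutions are given on a slightly larger interval.\<close>

locale edge_solution = edge_coeffs +
  fixes w dw :: "real \<Rightarrow> real" and a b :: real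
  assumes w_deriv: "\<And>x. x \<in> {a..b} \<Longrightarrow> (w has_real_derivative dw x) (at x)"
    and w_eq: "\<And>x y. \<lbrakk>a \<le> x; x \<le> y; y \<le> b\<rbrakk> \<Longrightarrow> (nl_rhs p V r w has_integral (dw y - dw x)) {x..y}"
begin

lemma w_cont: "continuous_on {a..b} w"
  using w_deriv by (meson DERIV_continuous_on has_field_derivative_at_within)

lemma w_cont': "\<lbrakk>a \<le> c; d \<le> b\<rbrakk> \<Longrightarrow> continuous_on {c..d} w"
  by (rule continuous_on_subset[OF w_cont]) auto

lemma dw_cont: "continuous_on {a..b} dw"
proof (cases "a \<le> b")
  case True
  have "continuous_on {a..b} (\<lambda>x. dw a + integral {a..x} (nl_rhs p V r w))"
    by (intro continuous_intros indefinite_integral_continuous_1) (use w_eq[of a b] True in blast)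
  moreover have "dw a + integral {a..x} (nl_rhs p V r w) = dw x" if "x \<in> {a..b}" for x
    using w_eq[of a x] that by (auto dest: integral_unique)
  ultimately show ?thesis by (rule continuous_on_eq)
qed auto

lemma dw_cont': "\<lbrakk>a \<le> c; d \<le> b\<rbrakk> \<Longrightarrow> continuous_on {c..d} dw"
  by (rule continuous_on_subset[OF dw_cont]) auto

lemma weak_eq:
  assumes cd: "a \<le> c" "d \<le> b" and t: "test_fun c d \<psi> \<psi>'"
  shows "integral {c..d} (\<lambda>x. dw x * \<psi>' x + nl_rhs p V r w x * \<psi> x) = 0"
    and "(\<lambda>x. dw x * \<psi>' x + nl_rhs p V r w x * \<psi> x) integrable_on {c..d}"
proof -
  let ?f = "nl_rhs p V r w"
  have c_d: "c < d" "\<psi> c = 0" "\<psi> d = 0" using t by (auto simp: test_fun_def)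
  note cont = test_fun_continuous[OF t] w_cont'[OF cd] dw_cont'[OF cd]
  have f_meas: "?f \<in> borel_measurable (lebesgue_on {c..d})"
    using cd c_d w_eq[of c d] by (intro integrable_imp_measurable) auto
  obtain M where M: "\<And>x. x \<in> {c..d} \<Longrightarrow> \<bar>w x\<bar> \<le> M"
    using continuous_on_Icc_abs_bound[OF cont(3)] by blast
  have f_bd: "\<bar>?f x\<bar> \<le> K * M + R * (M powr (p - 2) * M)" if x: "x \<in> {c..d}" for x
    using M[OF x] by (rule nl_rhs_abs_le)
  have f_int: "?f integrable_on {c..d}" using w_eq[of c d] cd c_d by auto
  have fpsi: "(\<lambda>x. ?f x * \<psi> x) integrable_on {c..d}"
  proof -
    have "(\<lambda>x. V x * (w x * \<psi> x) - r x * ((\<bar>w x\<bar> powr (p - 2) * w x) * \<psi> x)) integrable_on {c..d}"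
      by (intro integrable_diff V_int r_int continuous_intros continuous_on_pot cont)
    then show ?thesis by (simp add: nl_rhs_def left_diff_distrib mult.assoc)
  qed
  have dwpsi: "(\<lambda>x. dw x * \<psi>' x) integrable_on {c..d}"
    by (intro integrable_continuous_real continuous_intros cont)
  have psi': "(\<psi>' has_integral (\<psi> d - \<psi> c)) {c..d}"
    by (rule fundamental_theorem_of_calculus)
      (use t in \<open>auto simp: test_fun_def has_real_derivative_iff_has_vector_derivative[symmetric]\<close>)
  have "integral {c..d} (\<lambda>x. ?f x * \<psi> x) + integral {c..d} (\<lambda>x. integral {c..x} ?f * \<psi>' x) = 0"
    using integral_parts_primitive[OF _ f_meas f_bd _ cont(2)] t c_d by (simp add: test_fun_def)
  \<comment> \<open>The primitive starting at \<open>c\<close> is \<open>dw x - dw c\<close>, and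
    the constant drops out because \<psi> vanishes at both ends.\<close>
  moreover have "integral {c..d} (\<lambda>x. integral {c..x} ?f * \<psi>' x) =
      integral {c..d} (\<lambda>x. (dw x - dw c) * \<psi>' x)"
  proof (rule Henstock_Kurzweil_Integration.integral_cong)
    fix x assume "x \<in> {c..d}"
    then have "(?f has_integral (dw x - dw c)) {c..x}" using w_eq[of c x] cd by simp
    then show "integral {c..x} ?f * \<psi>' x = (dw x - dw c) * \<psi>' x" by (simp add: integral_unique)
  qed
  moreover have "integral {c..d} (\<lambda>x. (dw x - dw c) * \<psi>' x) =
      integral {c..d} (\<lambda>x. dw x * \<psi>' x) - dw c * integral {c..d} \<psi>'"
    unfolding left_diff_distrib
    using Henstock_Kurzweil_Integration.integral_diff[OF dwpsi integrable_on_mult_right[OF has_integral_integrable[OF psi']], of "dw c"]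
    by simp
  moreover have "integral {c..d} \<psi>' = 0" using psi' c_d by (simp add: integral_unique)
  ultimately show "integral {c..d} (\<lambda>x. dw x * \<psi>' x + ?f x * \<psi> x) = 0"
    using Henstock_Kurzweil_Integration.integral_add[OF dwpsi fpsi] by simp
  show "(\<lambda>x. dw x * \<psi>' x + ?f x * \<psi> x) integrable_on {c..d}"
    using integrable_add[OF dwpsi fpsi] .
qed

text \<open>The end conditions concern the product \<open>w * \<eta>\<close>, so that they cover
  both cutoffs vanishing at the ends and the choice \<eta> = 1 between two zeros of
  \<open>w\<close>.\<close>

lemma test_fun_mult:
  assumes cd: "a \<le> c" "d \<le> b" "c < d" "w c * \<eta> c = 0" "w d * \<eta> d = 0"
    and \<eta>: "\<And>x. x \<in> {c..d} \<Longrightarrow> (\<eta> has_real_derivative \<eta>' x) (at x within {c..d})"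
      "continuous_on {c..d} \<eta>'"
  shows "test_fun c d (\<lambda>x. w x * \<eta> x) (\<lambda>x. dw x * \<eta> x + w x * \<eta>' x)"
proof -
  have cont: "continuous_on {c..d} \<eta>" by (rule DERIV_continuous_on[OF \<eta>(1)])
  show ?thesis unfolding test_fun_def
  proof (intro conjI ballI)
    fix x assume x: "x \<in> {c..d}"
    have "(w has_real_derivative dw x) (at x within {c..d})"
      by (rule has_field_derivative_at_within[OF w_deriv]) (use cd(1,2) x in auto)
    from DERIV_mult[OF this \<eta>(1)[OF x]]
    show "((\<lambda>x. w x * \<eta> x) has_real_derivative dw x * \<eta> x + w x * \<eta>' x) (at x within {c..d})"
      by (simp add: algebra_simps)
  next
    show "continuous_on {c..d} (\<lambda>x. dw x * \<eta> x + w x * \<eta>' x)"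
      using cont \<eta>(2) w_cont'[OF cd(1,2)] dw_cont'[OF cd(1,2)] by (intro continuous_intros)
  qed (use cd in simp_all)
qed

text \<open>Pointwise \<open>((w \<eta>)')\<^sup>2 = w' (w \<eta>\<^sup>2)' + (w
  \<eta>')\<^sup>2\<close>, and the weak equation with \<open>w \<eta>\<^sup>2\<close> removes the
  first term. The second identity leaves out the nonlinear part of the second variation; for a
  positive potential its left side controls the integral of \<open>w\<^sup>2\<close>.\<close>

lemma quad_form_times_solution:
  assumes cd: "a \<le> c" "d \<le> b" "c < d" "w c * \<eta> c = 0" "w d * \<eta> d = 0"
    and \<eta>: "\<And>x. x \<in> {c..d} \<Longrightarrow> (\<eta> has_real_derivative \<eta>' x) (at x within {c..d})"
      "continuous_on {c..d} \<eta>'"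
  shows "quad_form p V r w c d (\<lambda>x. w x * \<eta> x) (\<lambda>x. dw x * \<eta> x + w x * \<eta>' x) =
      integral {c..d} (\<lambda>x. (w x * \<eta>' x)\<^sup>2) -
      (p - 2) * integral {c..d} (\<lambda>x. r x * (\<bar>w x\<bar> powr (p - 2) * (w x * \<eta> x)\<^sup>2))"
    and "integral {c..d} (\<lambda>x. (dw x * \<eta> x + w x * \<eta>' x)\<^sup>2 + V x * (w x * \<eta> x)\<^sup>2) =
      integral {c..d} (\<lambda>x. (w x * \<eta>' x)\<^sup>2) +
      integral {c..d} (\<lambda>x. r x * (\<bar>w x\<bar> powr (p - 2) * (w x * \<eta> x)\<^sup>2))"
proof -
  have cont\<eta>: "continuous_on {c..d} \<eta>" by (rule DERIV_continuous_on[OF \<eta>(1)])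
  note cont = w_cont'[OF cd(1,2)] dw_cont'[OF cd(1,2)] cont\<eta> \<eta>(2)
  let ?\<psi> = "\<lambda>x. w x * (\<eta> x)\<^sup>2" and ?\<psi>' = "\<lambda>x. dw x * (\<eta> x)\<^sup>2 + w x * (2 * \<eta> x * \<eta>' x)"
  have t: "test_fun c d ?\<psi> ?\<psi>'"
  proof (rule test_fun_mult)
    fix x assume "x \<in> {c..d}"
    from DERIV_power[OF \<eta>(1)[OF this], of 2]
    show "((\<lambda>x. (\<eta> x)\<^sup>2) has_real_derivative 2 * \<eta> x * \<eta>' x) (at x within {c..d})"
      by (simp add: algebra_simps)
  next
    show "continuous_on {c..d} (\<lambda>x. 2 * \<eta> x * \<eta>' x)"
      by (intro continuous_intros cont)
    show "w c * (\<eta> c)\<^sup>2 = 0" "w d * (\<eta> d)\<^sup>2 = 0" using cd(4,5) by simp_all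
  qed (use cd(1-3) in simp_all)
  let ?Z = "\<lambda>x. dw x * ?\<psi>' x + nl_rhs p V r w x * ?\<psi> x"
  let ?A = "\<lambda>x. (w x * \<eta>' x)\<^sup>2" and ?B = "\<lambda>x. r x * (\<bar>w x\<bar> powr (p - 2) * (w x * \<eta> x)\<^sup>2)"
  have Zh: "(?Z has_integral 0) {c..d}"
    using weak_eq[OF cd(1,2) t] by (simp add: has_integral_integral)
  have A: "?A integrable_on {c..d}" by (intro integrable_continuous_real continuous_intros cont)
  have B: "?B integrable_on {c..d}" by (intro r_int continuous_intros continuous_on_pot cont)
  have e1: "quad_form p V r w c d (\<lambda>x. w x * \<eta> x) (\<lambda>x. dw x * \<eta> x + w x * \<eta>' x) =
     integral {c..d} (\<lambda>x. ?Z x + ?A x - (p - 2) * ?B x)"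
    unfolding quad_form_def nl_rhs_def by (rule Henstock_Kurzweil_Integration.integral_cong) algebra
  have "((\<lambda>x. ?Z x + ?A x - (p - 2) * ?B x) has_integral
      0 + integral {c..d} ?A - (p - 2) * integral {c..d} ?B) {c..d}"
    by (intro has_integral_add has_integral_diff has_integral_mult_right Zh integrable_integral A B)
  then have "integral {c..d} (\<lambda>x. ?Z x + ?A x - (p - 2) * ?B x) =
      integral {c..d} ?A - (p - 2) * integral {c..d} ?B" by (simp add: integral_unique)
  with e1 show "quad_form p V r w c d (\<lambda>x. w x * \<eta> x) (\<lambda>x. dw x * \<eta> x + w x * \<eta>' x) =
      integral {c..d} ?A - (p - 2) * integral {c..d} ?B" by (rule trans)
  have e2: "integral {c..d} (\<lambda>x. (dw x * \<eta> x + w x * \<eta>' x)\<^sup>2 + V x * (w x * \<eta> x)\<^sup>2) =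
     integral {c..d} (\<lambda>x. ?Z x + ?A x + ?B x)"
    unfolding nl_rhs_def by (rule Henstock_Kurzweil_Integration.integral_cong) algebra
  have "((\<lambda>x. ?Z x + ?A x + ?B x) has_integral
      0 + integral {c..d} ?A + integral {c..d} ?B) {c..d}"
    by (intro has_integral_add Zh integrable_integral A B)
  then have "integral {c..d} (\<lambda>x. ?Z x + ?A x + ?B x) =
      integral {c..d} ?A + integral {c..d} ?B" by (simp add: integral_unique)
  with e2 show "integral {c..d} (\<lambda>x. (dw x * \<eta> x + w x * \<eta>' x)\<^sup>2 + V x * (w x * \<eta> x)\<^sup>2) =
      integral {c..d} ?A + integral {c..d} ?B" by (rule trans)
qed

end


section \<open>Propagation of bounds across nodal intervals\<close>

lemma (in edge_solution) edge_solution_uminus: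
  "edge_solution p K \<rho>\<^sub>0 R V r (\<lambda>x. - w x) (\<lambda>x. - dw x) a b"
proof unfold_locales
  fix x y assume "a \<le> x" "x \<le> y" "y \<le> b"
  then have "((\<lambda>x. - nl_rhs p V r w x) has_integral - (dw y - dw x)) {x..y}"
    using w_eq by (intro has_integral_neg)
  then show "(nl_rhs p V r (\<lambda>x. - w x) has_integral - dw y - - dw x) {x..y}"
    by (simp add: nl_rhs_def[abs_def])
qed (auto intro!: DERIV_minus w_deriv)

context edge_solution
begin

text \<open>While \<open>w\<close> is nonnegative the nonlinear term can only lower
  \<open>w''\<close>, so \<open>w'' \<le> w / 2\<close>. At the maximum point \<open>x0\<close> this
  gives \<open>w x0 \<le> B + (B + w x0 / 2)\<close>, since the interval has length at most 1; hence
  the factor 4. The size of the nonlinearity enters only the bound for \<open>dw\<close>.\<close>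

lemma one_sign_step_pos:
  assumes st: "a \<le> s" "s \<le> t" "t \<le> b" "t \<le> s + 1" and K: "K \<le> 1 / 2"
    and pos: "\<And>x. \<lbrakk>s \<le> x; x \<le> t\<rbrakk> \<Longrightarrow> w x \<ge> 0"
    and B: "\<bar>w s\<bar> \<le> B" "\<bar>dw s\<bar> \<le> B" and x: "s \<le> x" "x \<le> t"
  shows "\<bar>w x\<bar> \<le> 4 * B" "\<bar>dw x\<bar> \<le> 4 * B + R * (4 * B) powr (p - 1)"
proof -
  have "compact {s..t}" "{s..t} \<noteq> {}" "continuous_on {s..t} w"
    using st w_cont' by auto
  from continuous_attains_sup[OF this] obtain x0 where
    x0: "s \<le> x0" "x0 \<le> t" "\<And>y. \<lbrakk>s \<le> y; y \<le> t\<rbrakk> \<Longrightarrow> w y \<le> w x0" by auto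
  have rhs_le: "nl_rhs p V r w y \<le> w x0 / 2" if "s \<le> y" "y \<le> t" for y
  proof -
    have "V y * w y \<le> 1 / 2 * w y"
      using V_le[of y] K pos[OF that] by (intro mult_right_mono) auto
    moreover have "0 \<le> r y * (\<bar>w y\<bar> powr (p - 2) * w y)" using r_pos[of y] pos[OF that] by simp
    ultimately show ?thesis unfolding nl_rhs_def using x0(3)[OF that] by simp
  qed
  have dw_le: "dw y \<le> B + w x0 / 2" if "s \<le> y" "y \<le> t" for y
  proof -
    have i: "(nl_rhs p V r w has_integral (dw y - dw s)) {s..y}" using w_eq[of s y] st that by simp
    have "((\<lambda>_. w x0 / 2) has_integral (w x0 / 2 * (y - s))) {s..y}"
      using has_integral_const_real[of "w x0 / 2" s y] that by (simp add: mult.commute)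
    from has_integral_le[OF i this] have "dw y - dw s \<le> w x0 / 2 * (y - s)"
      using rhs_le that by auto
    also have "\<dots> \<le> w x0 / 2 * 1"
      using that st pos[OF x0(1,2)] by (intro mult_left_mono) auto
    finally show ?thesis using B by linarith
  qed
  have "w x0 \<le> 4 * B"
  proof (cases "s = x0")
    case True then show ?thesis using B by auto
  next
    case False
    then have "s < x0" using x0 by auto
    from MVT2[OF this, of w dw] obtain z where z: "s < z" "z < x0" "w x0 - w s = (x0 - s) * dw z"
      using w_deriv st x0(2) by auto
    have "(x0 - s) * dw z \<le> (x0 - s) * (B + w x0 / 2)"
      using dw_le[of z] z x0 by (intro mult_left_mono) auto
    also have "\<dots> \<le> 1 * (B + w x0 / 2)"
      using x0 st B pos[OF x0(1,2)] by (intro mult_right_mono) auto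
    finally have "w x0 - w s \<le> B + w x0 / 2" using z(3) by simp
    then show ?thesis using B by linarith
  qed
  then have w4: "0 \<le> w y \<and> w y \<le> 4 * B" if "s \<le> y" "y \<le> t" for y
    using pos[OF that] x0(3)[OF that] by linarith
  show "\<bar>w x\<bar> \<le> 4 * B" using w4[OF x] by simp
  have B0: "B \<ge> 0" using B by auto
  have i: "(nl_rhs p V r w has_integral (dw x - dw s)) {s..x}" using w_eq[of s x] st x by simp
  have "\<bar>integral {s..x} (nl_rhs p V r w)\<bar> \<le> (2 * B + R * (4 * B) powr (p - 1)) * (x - s)"
  proof (rule abs_integral_le_length)
    fix y assume "y \<in> {s..x}"
    then have wy: "0 \<le> w y" "w y \<le> 4 * B" using w4[of y] x by auto
    have "\<bar>nl_rhs p V r w y\<bar> \<le> \<bar>V y\<bar> * \<bar>w y\<bar> + \<bar>r y\<bar> * (\<bar>w y\<bar> powr (p - 2) * \<bar>w y\<bar>)"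
      unfolding nl_rhs_def by (rule order_trans[OF abs_triangle_ineq4]) (simp add: abs_mult)
    also have "\<dots> \<le> 1 / 2 * (4 * B) + R * ((4 * B) powr (p - 2) * (4 * B))"
      using wy V_le[of y] K r_abs R_pos p B0 by (intro add_mono mult_mono powr_mono2) auto
    also have "(4 * B) powr (p - 2) * (4 * B) = (4 * B) powr (p - 1)"
      using B0 powr_add[of "4 * B" "p - 2" 1] by (cases "B = 0") auto
    finally show "\<bar>nl_rhs p V r w y\<bar> \<le> 2 * B + R * (4 * B) powr (p - 1)" by simp
  qed (use i x in auto)
  also have "\<dots> \<le> (2 * B + R * (4 * B) powr (p - 1)) * 1"
    using x st B0 R_pos by (intro mult_left_mono) auto
  also have "integral {s..x} (nl_rhs p V r w) = dw x - dw s" using i by (rule integral_unique)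
  finally have "\<bar>dw x - dw s\<bar> \<le> 2 * B + R * (4 * B) powr (p - 1)" by simp
  then show "\<bar>dw x\<bar> \<le> 4 * B + R * (4 * B) powr (p - 1)" using B(2) B0 by linarith
qed

end

text \<open>One number dominating both \<open>\<bar>w\<bar>\<close> and
  \<open>\<bar>dw\<bar>\<close> at the end of a step, so that it can be iterated from zero to
  zero.\<close>

definition step_bound :: "real \<Rightarrow> real \<Rightarrow> real \<Rightarrow> real" where
  "step_bound p R B = 4 * B + R * (4 * B) powr (p - 1)"

context edge_solution
begin

text \<open>Zeros are excluded only in the open interval, so a step may start and end at a zero. By
  continuity \<open>w\<close> has one sign up to the ends, and the negative case follows from
  oddness of the equation.\<close>

lemma one_sign_step:
  assumes st: "a \<le> s" "s \<le> t" "t \<le> b" "t \<le> s + 1" and K: "K \<le> 1 / 2"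
    and nz: "\<And>x. \<lbrakk>s < x; x < t\<rbrakk> \<Longrightarrow> w x \<noteq> 0"
    and B: "\<bar>w s\<bar> \<le> B" "\<bar>dw s\<bar> \<le> B" and x: "s \<le> x" "x \<le> t"
  shows "\<bar>w x\<bar> \<le> step_bound p R B" "\<bar>dw x\<bar> \<le> step_bound p R B"
proof -
  have "\<bar>w x\<bar> \<le> 4 * B \<and> \<bar>dw x\<bar> \<le> step_bound p R B"
  proof (cases "s = t")
    case True
    then show ?thesis using B x R_pos by (auto simp: step_bound_def intro!: add_increasing2)
  next
    case False
    then have "s < t" using st by simp
    have cw: "continuous_on {s..t} w" using st w_cont' by simp
    have ivt: "\<exists>z. s < z \<and> z < t \<and> w z = 0" if "s < y" "y < t" "s < z" "z < t" "w y < 0" "w z > 0" for y z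
    proof -
      have "connected (w ` {s<..<t})"
        by (intro connected_continuous_image continuous_on_subset[OF cw]) auto
      then have "0 \<in> w ` {s<..<t}"
        using connectedD_interval[of "w ` {s<..<t}" "w y" "w z" 0] that by auto
      then show ?thesis by force
    qed
    have "(\<forall>y\<in>{s<..<t}. w y \<ge> 0) \<or> (\<forall>y\<in>{s<..<t}. w y \<le> 0)"
    proof (rule ccontr)
      assume "\<not> ?thesis"
      then obtain y z where "s < y" "y < t" "s < z" "z < t" "w y < 0" "w z > 0" by force
      from ivt[OF this] nz show False by auto
    qed
    moreover have "w y \<ge> 0" if "\<forall>y\<in>{s<..<t}. w y \<ge> 0" "y \<in> {s..t}" for y
      using continuous_ge_on_Ioo[OF cw _ \<open>s < t\<close> that(2)] that(1) by blast
    moreover have "- w y \<ge> 0" if "\<forall>y\<in>{s<..<t}. w y \<le> 0" "y \<in> {s..t}" for y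
      by (rule continuous_ge_on_Ioo[OF continuous_on_minus[OF cw] _ \<open>s < t\<close> that(2)]) (use that(1) in simp)
    ultimately have "(\<forall>y\<in>{s..t}. w y \<ge> 0) \<or> (\<forall>y\<in>{s..t}. w y \<le> 0)" by force
    then show ?thesis
    proof
      assume "\<forall>y\<in>{s..t}. w y \<ge> 0"
      then show ?thesis using one_sign_step_pos[OF st K _ B x] by (simp add: step_bound_def)
    next
      interpret neg: edge_solution p K \<rho>\<^sub>0 R V r "\<lambda>x. - w x" "\<lambda>x. - dw x" a b
        by (rule edge_solution_uminus)
      assume "\<forall>y\<in>{s..t}. w y \<le> 0"
      then show ?thesis using neg.one_sign_step_pos[OF st K _ _ _ x, of B] B by (simp add: step_bound_def)
    qed
  qed
  then show "\<bar>w x\<bar> \<le> step_bound p R B" "\<bar>dw x\<bar> \<le> step_bound p R B"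
    using R_pos by (auto simp: step_bound_def intro: order_trans)
qed

text \<open>With \<eta> = 1 the cutoff term disappears and the quadratic form at \<open>w\<close>
  equals \<open>- (p - 2)\<close> times the integral of
  \<open>r \<bar>w\<bar>\<^sup>p\<close>.\<close>

lemma nodal_interval_unstable:
  assumes cd: "a \<le> c" "d \<le> b" "c < d" "w c = 0" "w d = 0"
    and nz: "\<And>x. \<lbrakk>c < x; x < d\<rbrakk> \<Longrightarrow> w x \<noteq> 0"
  shows "unstable_on p V r w c d"
proof -
  note cw = w_cont'[OF cd(1,2)]
  let ?g = "\<lambda>x. \<bar>w x\<bar> powr (p - 2) * (w x)\<^sup>2"
  have cg: "continuous_on {c..d} ?g" by (intro continuous_intros continuous_on_pot cw)
  have "integral {c..d} ?g \<noteq> 0"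
  proof
    assume "integral {c..d} ?g = 0"
    moreover have "(c + d) / 2 \<in> {c..d}" using cd by auto
    ultimately have "?g ((c + d) / 2) = 0"
      using integral_eq_0_iff[OF cg cd(3)] by auto
    then show False using nz[of "(c + d) / 2"] cd by simp
  qed
  moreover have "integral {c..d} ?g \<ge> 0" by (rule Henstock_Kurzweil_Integration.integral_nonneg[OF integrable_continuous_real[OF cg]]) auto
  ultimately have "0 < \<rho>\<^sub>0 * integral {c..d} ?g" using \<rho>\<^sub>0 by simp
  also have "\<dots> = integral {c..d} (\<lambda>x. \<rho>\<^sub>0 * ?g x)" by simp
  also have "\<dots> \<le> integral {c..d} (\<lambda>x. r x * ?g x)"
    by (rule integral_le) (auto intro!: r_int integrable_on_mult_right[OF integrable_continuous_real[OF cg]] cg mult_right_mono r_ge)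
  finally have *: "0 < integral {c..d} (\<lambda>x. r x * ?g x)" .
  have t: "test_fun c d (\<lambda>x. w x * 1) (\<lambda>x. dw x * 1 + w x * 0)"
    by (rule test_fun_mult) (use cd in auto)
  have "quad_form p V r w c d (\<lambda>x. w x * 1) (\<lambda>x. dw x * 1 + w x * 0) =
      integral {c..d} (\<lambda>x. (w x * 0)\<^sup>2) -
      (p - 2) * integral {c..d} (\<lambda>x. r x * (\<bar>w x\<bar> powr (p - 2) * (w x * 1)\<^sup>2))"
    by (rule quad_form_times_solution(1)) (use cd in auto)
  also have "\<dots> < 0" using * p by simp
  finally show ?thesis using t unfolding unstable_on_def by blast
qed

lemma last_zero_before:
  assumes "a \<le> s" "s \<le> z0" "z0 \<le> x" "x \<le> b" "w z0 = 0"
  obtains z where "s \<le> z" "z \<le> x" "w z = 0" "\<And>y. \<lbrakk>z < y; y \<le> x\<rbrakk> \<Longrightarrow> w y \<noteq> 0"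
proof -
  let ?Z = "{y \<in> {s..x}. w y = 0}"
  have "closed ?Z" using w_cont'[of s x] assms
    by (intro continuous_closed_preimage_constant) auto
  then have "compact ?Z" by (metis (no_types, lifting) Collect_mem_eq bounded_closed_interval bounded_subset compact_eq_bounded_closed mem_Collect_eq subsetI)
  moreover have "z0 \<in> ?Z" using assms by auto
  ultimately obtain z where "z \<in> ?Z" "\<And>y. y \<in> ?Z \<Longrightarrow> y \<le> z"
    using compact_attains_sup[of ?Z] by blast
  then have z: "s \<le> z" "z \<le> x" "w z = 0" "\<And>y. \<lbrakk>y \<le> x; s \<le> y; w y = 0\<rbrakk> \<Longrightarrow> y \<le> z" by auto
  have "w y \<noteq> 0" if "z < y" "y \<le> x" for y using z(4)[of y] z(1) that by fastforce
  then show ?thesis using that z by blast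
qed

lemma step_bound_ge: "0 \<le> B \<Longrightarrow> B \<le> step_bound p R B"
  using R_pos by (auto simp: step_bound_def intro!: add_increasing2)

lemma step_bound_pow_ge: "0 \<le> B \<Longrightarrow> B \<le> (step_bound p R ^^ k) B"
  by (induction k) (auto intro: order_trans[OF _ step_bound_ge] order_trans)

lemma step_bound_mono: "\<lbrakk>0 \<le> B; B \<le> B'\<rbrakk> \<Longrightarrow> step_bound p R B \<le> step_bound p R B'"
  using R_pos p unfolding step_bound_def by (intro add_mono mult_left_mono powr_mono2) auto

text \<open>Induction on the number of unstable intervals that do not fit between \<open>x1\<close>
  and the zero \<open>z\<close>. Unless \<open>dw z = 0\<close>, there is a last zero
  \<open>z'\<close> before \<open>z\<close> or no zero at all from \<open>x1\<close> on. In the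
  first case the nodal interval from \<open>z'\<close> to \<open>z\<close> uses up one unstable
  interval, and one sign-constant step leads from \<open>z'\<close> to \<open>z\<close>.\<close>

lemma zero_deriv_bound:
  assumes x1: "a \<le> x1" "\<bar>w x1\<bar> \<le> B" "\<bar>dw x1\<bar> \<le> B" and K: "K \<le> 1 / 2" and len: "b \<le> a + 1"
  shows "\<lbrakk>x1 \<le> z; z \<le> b; w z = 0; \<not> disjoint_unstable p V r w k x1 z\<rbrakk>
    \<Longrightarrow> \<bar>dw z\<bar> \<le> (step_bound p R ^^ k) B"
proof (induction k arbitrary: z)
  \<comment> \<open>The hypothesis is contradictory here, as zero unstable intervals always
    fit.\<close>
  case 0
  then show ?case by simp
next
  case (Suc k)
  have B0: "B \<ge> 0" using x1 by auto
  have nonneg: "0 \<le> (step_bound p R ^^ j) B" for j using step_bound_pow_ge[OF B0, of j] B0 by simp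
  show ?case
  proof (cases "dw z = 0 \<or> z = x1")
    case True
    then show ?thesis using nonneg[of "Suc k"] x1 step_bound_pow_ge[OF B0, of "Suc k"] by auto
  next
    case False
    then have dz: "dw z \<noteq> 0" and lt: "x1 < z" using Suc.prems by auto
    \<comment> \<open>A zero with nonzero derivative is isolated from the left.\<close>
    obtain e where e: "e > 0" "\<And>y. \<lbrakk>z - e < y; y < z\<rbrakk> \<Longrightarrow> w y \<noteq> 0"
    proof -
      have "(w has_real_derivative dw z) (at z)" using w_deriv Suc.prems x1 by auto
      then have "\<exists>e>0. \<forall>h>0. h < e \<longrightarrow> w (z - h) \<noteq> w z"
      proof (cases "dw z > 0")
        case True
        then show ?thesis using DERIV_pos_inc_left[OF \<open>(w has_real_derivative dw z) (at z)\<close>] by force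
      next
        case False
        then show ?thesis using DERIV_neg_dec_left[OF \<open>(w has_real_derivative dw z) (at z)\<close>] dz by force
      qed
      then obtain e where "e > 0" "\<forall>h>0. h < e \<longrightarrow> w (z - h) \<noteq> w z" by blast
      then show ?thesis using that[of e] Suc.prems(3) by (metis diff_diff_eq2 add_diff_cancel_left' add.commute diff_add_cancel diff_gt_0_iff_gt diff_less_eq less_diff_eq)
    qed
    show ?thesis
    proof (cases "\<exists>z0. x1 \<le> z0 \<and> z0 < z \<and> w z0 = 0")
      case False
      have "\<bar>dw z\<bar> \<le> step_bound p R B"
        by (rule one_sign_step(2)[of x1 z]) (use False Suc.prems x1 K len in auto)
      also have "\<dots> \<le> step_bound p R ((step_bound p R ^^ k) B)"
        by (rule step_bound_mono[OF B0 step_bound_pow_ge[OF B0]])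
      finally show ?thesis by simp
    next
      case True
      then obtain z0 where z0: "x1 \<le> z0" "z0 < z" "w z0 = 0" by blast
      \<comment> \<open>Beyond \<open>x\<close> and before \<open>z\<close> there are no zeros, so
        the last zero up to \<open>x\<close> is also the last one before \<open>z\<close>. Searching
        up to \<open>x\<close> keeps \<open>z\<close> itself out.\<close>
      define x where "x = max (z - e / 2) z0"
      have x: "z0 \<le> x" "x < z" "z - e < x" using z0 e by (auto simp: x_def)
      from last_zero_before[of x1 z0 x] obtain z' where
        z': "x1 \<le> z'" "z' \<le> x" "w z' = 0" "\<And>y. \<lbrakk>z' < y; y \<le> x\<rbrakk> \<Longrightarrow> w y \<noteq> 0"
        using z0 x Suc.prems x1 by auto
      have nz: "w y \<noteq> 0" if "z' < y" "y < z" for y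
      proof (cases "y \<le> x")
        case True then show ?thesis using z' that by auto
      next
        case False then show ?thesis using e(2)[of y] x that by auto
      qed
      have lt': "z' < z" using z' x by linarith
      have u: "unstable_on p V r w z' z"
        by (rule nodal_interval_unstable) (use z' x nz Suc.prems x1 lt' in auto)
      have "\<not> disjoint_unstable p V r w k x1 z'"
        using disjoint_unstable_Suc[OF _ u, of k x1 z' x1 z] Suc.prems z' lt' by auto
      then have *: "\<bar>dw z'\<bar> \<le> (step_bound p R ^^ k) B"
        by (intro Suc.IH) (use z' lt' Suc.prems in auto)
      have "\<bar>dw z\<bar> \<le> step_bound p R ((step_bound p R ^^ k) B)"
        by (rule one_sign_step(2)[of z' z]) (use nz * z' lt' x1 Suc.prems K len nonneg in auto)
      then show ?thesis by simp
    qed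
  qed
qed

text \<open>The derivative bound at the last zero before \<open>x\<close> costs \<open>k\<close>
  steps; the step from that zero to \<open>x\<close> is the extra one in
  \<open>Suc k\<close>.\<close>

lemma propagate_right:
  assumes x1: "a \<le> x1" "\<bar>w x1\<bar> \<le> B" "\<bar>dw x1\<bar> \<le> B" and K: "K \<le> 1 / 2" and len: "b \<le> a + 1"
    and k: "\<not> disjoint_unstable p V r w k a b" and x: "x1 \<le> x" "x \<le> b"
  shows "\<bar>w x\<bar> \<le> (step_bound p R ^^ Suc k) B"
proof -
  have B0: "B \<ge> 0" using x1 by auto
  show ?thesis
  proof (cases "\<exists>z0. x1 \<le> z0 \<and> z0 \<le> x \<and> w z0 = 0")
    case False
    have "\<bar>w x\<bar> \<le> step_bound p R B"
      by (rule one_sign_step(1)[of x1 x]) (use False x x1 K len in auto)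
    also have "\<dots> \<le> step_bound p R ((step_bound p R ^^ k) B)"
      by (rule step_bound_mono[OF B0 step_bound_pow_ge[OF B0]])
    finally show ?thesis by simp
  next
    case True
    then obtain z0 where z0: "x1 \<le> z0" "z0 \<le> x" "w z0 = 0" by blast
    from last_zero_before[of x1 z0 x] obtain z where
      z: "x1 \<le> z" "z \<le> x" "w z = 0" "\<And>y. \<lbrakk>z < y; y \<le> x\<rbrakk> \<Longrightarrow> w y \<noteq> 0"
      using z0 x x1 by auto
    have "\<not> disjoint_unstable p V r w k x1 z"
      using disjoint_unstable_mono[of p V r w k x1 z a b k] k x1 z x by auto
    then have *: "\<bar>dw z\<bar> \<le> (step_bound p R ^^ k) B"
      by (intro zero_deriv_bound[OF x1 K len]) (use z x in auto)
    have "\<bar>w x\<bar> \<le> step_bound p R ((step_bound p R ^^ k) B)"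
      by (rule one_sign_step(1)[of z x])
        (use * z x x1 K len step_bound_pow_ge[OF B0, of k] B0 in auto)
    then show ?thesis by simp
  qed
qed

end


section \<open>Rescaling\<close>

text \<open>The factor may be negative, since reflections are used to run a solution backwards;
  hence the \<open>min\<close> and \<open>max\<close> of the new endpoints.\<close>

lemma has_integral_affinity_real:
  fixes g :: "real \<Rightarrow> real"
  assumes "(g has_integral i) {c..d}" "c \<le> d" "m \<noteq> 0"
  shows "((\<lambda>x. g (m * x + q)) has_integral i / \<bar>m\<bar>)
    {min ((c - q) / m) ((d - q) / m)..max ((c - q) / m) ((d - q) / m)}"
proof -
  have "((\<lambda>x. g (m * x + q)) has_integral i / \<bar>m\<bar>) ((\<lambda>x. (1 / m) * x + - ((1 / m) * q)) ` {c..d})"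
    using has_integral_affinity[of g i c d m q] assms by simp
  also have "(\<lambda>x. (1 / m) * x + - ((1 / m) * q)) ` {c..d} =
      {min ((c - q) / m) ((d - q) / m)..max ((c - q) / m) ((d - q) / m)}"
  proof (cases "m > 0")
    case True
    then have "min ((c - q) / m) ((d - q) / m) = (c - q) / m" "max ((c - q) / m) ((d - q) / m) = (d - q) / m"
      using assms by (auto simp: min_def max_def divide_simps)
    then show ?thesis using assms True
      unfolding image_affinity_atLeastAtMost by (simp add: diff_divide_distrib)
  next
    case False
    then have "min ((c - q) / m) ((d - q) / m) = (d - q) / m" "max ((c - q) / m) ((d - q) / m) = (c - q) / m"
      using assms by (auto simp: min_def max_def divide_simps)
    then show ?thesis using assms False
      unfolding image_affinity_atLeastAtMost by (simp add: diff_divide_distrib)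
  qed
  finally show ?thesis .
qed

lemma borel_measurable_lebesgue_affine:
  fixes f :: "real \<Rightarrow> real"
  assumes "f \<in> borel_measurable lebesgue" "h \<noteq> 0"
  shows "(\<lambda>x. f (\<alpha> + h * x)) \<in> borel_measurable lebesgue"
proof -
  have "(\<lambda>x. \<alpha> + h * x) \<in> lebesgue \<rightarrow>\<^sub>M lebesgue"
    using lebesgue_affine_measurable[of "\<lambda>_. h" \<alpha>] assms by simp
  from measurable_compose[OF this assms(1)] show ?thesis .
qed

context edge_solution
begin

text \<open>The exponent is the one for which the nonlinear term keeps its coefficient:
  \<open>V\<close> acquires the factor \<open>h\<^sup>2\<close>, while \<open>r\<close> is only
  reparametrized. So \<open>\<rho>\<^sub>0\<close> and \<open>R\<close> survive the rescaling and
  \<open>K\<close> becomes \<open>h\<^sup>2 * K\<close>.\<close>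

abbreviation rescale :: "real \<Rightarrow> real \<Rightarrow> real \<Rightarrow> real" where
  "rescale \<alpha> h \<equiv> \<lambda>y. \<bar>h\<bar> powr (2 / (p - 2)) * w (\<alpha> + h * y)"

lemma rescale_pot:
  assumes "h \<noteq> 0"
  shows "\<bar>rescale \<alpha> h y\<bar> powr (p - 2) = h\<^sup>2 * \<bar>w (\<alpha> + h * y)\<bar> powr (p - 2)"
proof -
  have "\<bar>rescale \<alpha> h y\<bar> powr (p - 2) = (\<bar>h\<bar> powr (2 / (p - 2))) powr (p - 2) * \<bar>w (\<alpha> + h * y)\<bar> powr (p - 2)"
    by (simp add: abs_mult powr_mult)
  also have "(\<bar>h\<bar> powr (2 / (p - 2))) powr (p - 2) = \<bar>h\<bar> powr 2"
  proof -
    have "2 / (p - 2) * (p - 2) = 2" using p by (simp add: field_simps)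
    then show ?thesis unfolding powr_powr by simp
  qed
  also have "\<dots> = h\<^sup>2" using assms by (simp add: powr_numeral)
  finally show ?thesis .
qed

lemma edge_solution_rescale:
  assumes h: "h \<noteq> 0" and sub: "\<And>y. y \<in> {a'..b'} \<Longrightarrow> \<alpha> + h * y \<in> {a..b}"
  shows "edge_solution p (h\<^sup>2 * K) \<rho>\<^sub>0 R (\<lambda>y. h\<^sup>2 * V (\<alpha> + h * y)) (\<lambda>y. r (\<alpha> + h * y))
    (rescale \<alpha> h) (\<lambda>y. \<bar>h\<bar> powr (2 / (p - 2)) * (h * dw (\<alpha> + h * y))) a' b'"
proof unfold_locales
  let ?s = "\<bar>h\<bar> powr (2 / (p - 2))"
  show "(\<lambda>y. h\<^sup>2 * V (\<alpha> + h * y)) \<in> borel_measurable lebesgue"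
    by (intro borel_measurable_times borel_measurable_const borel_measurable_lebesgue_affine V_meas h)
  show "(\<lambda>y. r (\<alpha> + h * y)) \<in> borel_measurable lebesgue"
    by (intro borel_measurable_lebesgue_affine r_meas h)
  show "\<bar>h\<^sup>2 * V (\<alpha> + h * x)\<bar> \<le> h\<^sup>2 * K" for x
    by (simp add: abs_mult mult_left_mono V_le)
  show "(rescale \<alpha> h has_real_derivative ?s * (h * dw (\<alpha> + h * y))) (at y)" if "y \<in> {a'..b'}" for y
  proof -
    have "((\<lambda>y. \<alpha> + h * y) has_real_derivative h) (at y)"
      by (auto intro!: derivative_eq_intros)
    from DERIV_chain2[OF w_deriv[OF sub[OF that]] this]
    show ?thesis by (intro DERIV_cmult) (simp add: mult.commute)
  qed
  fix x y assume xy: "a' \<le> x" "x \<le> y" "y \<le> b'"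
  let ?X = "\<alpha> + h * x" and ?Y = "\<alpha> + h * y"
  have in_ab: "?X \<in> {a..b}" "?Y \<in> {a..b}" using sub xy by auto
  have "((\<lambda>z. nl_rhs p V r w (h * z + \<alpha>)) has_integral ((dw ?Y - dw ?X) / h)) {x..y}"
  proof (cases "h > 0")
    case True
    then have le: "?X \<le> ?Y" using xy by simp
    have "(nl_rhs p V r w has_integral (dw ?Y - dw ?X)) {?X..?Y}"
      by (rule w_eq) (use in_ab le in auto)
    from has_integral_affinity_real[OF this le h, of \<alpha>] show ?thesis using True xy by simp
  next
    case False
    then have le: "?Y \<le> ?X" using xy by (simp add: mult_left_mono_neg)
    have "(nl_rhs p V r w has_integral (dw ?X - dw ?Y)) {?Y..?X}"
      by (rule w_eq) (use in_ab le in auto)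
    moreover have "(dw ?X - dw ?Y) / \<bar>h\<bar> = (dw ?Y - dw ?X) / h"
      using False h by (simp add: field_simps)
    moreover have "min ((?Y - \<alpha>) / h) ((?X - \<alpha>) / h) = x" "max ((?Y - \<alpha>) / h) ((?X - \<alpha>) / h) = y"
      using h xy by auto
    ultimately show ?thesis using has_integral_affinity_real[OF _ le h, of "nl_rhs p V r w" _ \<alpha>] by metis
  qed
  then have "((\<lambda>z. ?s * h\<^sup>2 * nl_rhs p V r w (h * z + \<alpha>)) has_integral
      (?s * h\<^sup>2 * ((dw ?Y - dw ?X) / h))) {x..y}"
    by (rule has_integral_mult_right)
  also have "?s * h\<^sup>2 * ((dw ?Y - dw ?X) / h) = ?s * (h * dw ?Y) - ?s * (h * dw ?X)"
    using h by (simp add: power2_eq_square field_simps)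
  also have "(\<lambda>z. ?s * h\<^sup>2 * nl_rhs p V r w (h * z + \<alpha>)) =
      nl_rhs p (\<lambda>y. h\<^sup>2 * V (\<alpha> + h * y)) (\<lambda>y. r (\<alpha> + h * y)) (rescale \<alpha> h)"
    unfolding nl_rhs_def rescale_pot[OF h] by (simp add: fun_eq_iff algebra_simps)
  finally show "(nl_rhs p (\<lambda>y. h\<^sup>2 * V (\<alpha> + h * y)) (\<lambda>y. r (\<alpha> + h * y)) (rescale \<alpha> h)
     has_integral ?s * (h * dw ?Y) - ?s * (h * dw ?X)) {x..y}" .
qed (auto intro: p \<rho>\<^sub>0 r_ge r_le)

lemma unstable_on_rescale:
  assumes h: "h \<noteq> 0" and sub: "\<And>y. y \<in> {a'..b'} \<Longrightarrow> \<alpha> + h * y \<in> {a..b}" and cd: "a' \<le> c" "d \<le> b'"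
    and u: "unstable_on p (\<lambda>y. h\<^sup>2 * V (\<alpha> + h * y)) (\<lambda>y. r (\<alpha> + h * y)) (rescale \<alpha> h) c d"
  shows "unstable_on p V r w (min (\<alpha> + h * c) (\<alpha> + h * d)) (max (\<alpha> + h * c) (\<alpha> + h * d))"
proof -
  let ?V = "\<lambda>y. h\<^sup>2 * V (\<alpha> + h * y)" and ?r = "\<lambda>y. r (\<alpha> + h * y)"
  let ?lo = "min (\<alpha> + h * c) (\<alpha> + h * d)" and ?hi = "max (\<alpha> + h * c) (\<alpha> + h * d)"
  interpret S: edge_solution p "h\<^sup>2 * K" \<rho>\<^sub>0 R ?V ?r "rescale \<alpha> h"
      "\<lambda>y. \<bar>h\<bar> powr (2 / (p - 2)) * (h * dw (\<alpha> + h * y))" a' b'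
    by (rule edge_solution_rescale[OF h sub])
  obtain \<phi> \<phi>' where t: "test_fun c d \<phi> \<phi>'" and q: "quad_form p ?V ?r (rescale \<alpha> h) c d \<phi> \<phi>' < 0"
    using u unfolding unstable_on_def by blast
  have lt: "c < d" using t by (simp add: test_fun_def)
  let ?q = "\<lambda>x. (\<phi>' x)\<^sup>2 + ?V x * (\<phi> x)\<^sup>2 - (p - 1) * ?r x * \<bar>rescale \<alpha> h x\<bar> powr (p - 2) * (\<phi> x)\<^sup>2"
  have "?q integrable_on {c..d}"
    by (rule S.quad_form_integrable[OF S.w_cont'[OF cd] test_fun_continuous[OF t]])
  then have qi: "(?q has_integral quad_form p ?V ?r (rescale \<alpha> h) c d \<phi> \<phi>') {c..d}"
    unfolding quad_form_def by (rule integrable_integral)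
  \<comment> \<open>The inverse of \<open>y \<mapsto> \<alpha> + h * y\<close>; it carries the test
    function back to the original interval.\<close>
  let ?g = "\<lambda>x. (1 / h) * x + (- \<alpha> / h)"
  have pre: "(z - - \<alpha> / h) / (1 / h) = \<alpha> + h * z" for z using h by (simp add: field_simps)
  have lohi: "min ((c - - \<alpha> / h) / (1 / h)) ((d - - \<alpha> / h) / (1 / h)) = ?lo"
      "max ((c - - \<alpha> / h) / (1 / h)) ((d - - \<alpha> / h) / (1 / h)) = ?hi"
    by (simp_all only: pre)
  have inv: "\<alpha> + h * ?g x = x" for x using h by (simp add: field_simps)
  have g_in: "?g x \<in> {c..d}" if "x \<in> {?lo..?hi}" for x
  proof (cases "h > 0")
    case True
    then have "?lo = \<alpha> + h * c" "?hi = \<alpha> + h * d" using lt by (auto simp: min_def max_def)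
    then show ?thesis using that True by (auto simp: field_simps)
  next
    case False
    then have "h < 0" "?lo = \<alpha> + h * d" "?hi = \<alpha> + h * c" using lt h by (auto simp: min_def max_def mult_left_mono_neg)
    then show ?thesis using that by (auto simp: field_simps)
  qed
  have cg: "continuous_on {?lo..?hi} ?g" by (intro continuous_intros)
  define \<psi> \<psi>' where "\<psi> = (\<lambda>x. \<phi> (?g x))" and "\<psi>' = (\<lambda>x. \<phi>' (?g x) * (1 / h))"
  have ends: "{?g ?lo, ?g ?hi} \<subseteq> {c, d}"
    using h by (auto simp: min_def max_def field_simps)
  have "test_fun ?lo ?hi \<psi> \<psi>'"
    unfolding test_fun_def
  proof (intro conjI ballI)
    have "\<alpha> + h * c \<noteq> \<alpha> + h * d" using lt h by simp
    then show "?lo < ?hi" by linarith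
    show "\<psi> ?lo = 0" "\<psi> ?hi = 0" using ends t by (auto simp: \<psi>_def test_fun_def)
    show "continuous_on {?lo..?hi} \<psi>'" unfolding \<psi>'_def
      by (intro continuous_intros continuous_on_compose2[OF test_fun_continuous(2)[OF t] cg]) (use g_in h in auto)
    fix x assume x: "x \<in> {?lo..?hi}"
    have 1: "(\<phi> has_real_derivative \<phi>' (?g x)) (at (?g x) within ?g ` {?lo..?hi})"
      by (rule has_field_derivative_subset[of _ _ _ "{c..d}"]) (use t g_in x in \<open>auto simp: test_fun_def\<close>)
    have "(?g has_real_derivative 1 / h) (at x within {?lo..?hi})"
      using h by (auto intro!: derivative_eq_intros)
    from DERIV_image_chain[OF 1 this]
    show "(\<psi> has_real_derivative \<psi>' x) (at x within {?lo..?hi})" by (simp add: \<psi>_def \<psi>'_def o_def)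
  qed
  moreover have "quad_form p V r w ?lo ?hi \<psi> \<psi>' < 0"
  proof -
    have "((\<lambda>x. ?q (?g x)) has_integral quad_form p ?V ?r (rescale \<alpha> h) c d \<phi> \<phi>' / \<bar>1 / h\<bar>) {?lo..?hi}"
      using has_integral_affinity_real[OF qi, of "1 / h" "- \<alpha> / h"] lt h unfolding lohi by simp
    \<comment> \<open>Dividing by \<open>h\<^sup>2\<close> supplies the chain rule factor of
      \<open>\<psi>'\<close> squared and cancels the factor that both potential terms carry. The
      sign of the quadratic form is unaffected.\<close>
    then have "((\<lambda>x. (1 / h\<^sup>2) * ?q (?g x)) has_integral
        (1 / h\<^sup>2) * (quad_form p ?V ?r (rescale \<alpha> h) c d \<phi> \<phi>' / \<bar>1 / h\<bar>)) {?lo..?hi}"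
      by (rule has_integral_mult_right)
    also have "(\<lambda>x. (1 / h\<^sup>2) * ?q (?g x)) = (\<lambda>x. (\<psi>' x)\<^sup>2 + V x * (\<psi> x)\<^sup>2 -
        (p - 1) * r x * \<bar>w x\<bar> powr (p - 2) * (\<psi> x)\<^sup>2)"
      unfolding rescale_pot[OF h] unfolding inv \<psi>_def \<psi>'_def using h
      by (simp add: fun_eq_iff field_simps power_mult_distrib)
    finally have "quad_form p V r w ?lo ?hi \<psi> \<psi>' =
        (1 / h\<^sup>2) * (quad_form p ?V ?r (rescale \<alpha> h) c d \<phi> \<phi>' / \<bar>1 / h\<bar>)"
      unfolding quad_form_def by (rule integral_unique)
    also have "\<dots> < 0" using q h by (intro mult_pos_neg divide_neg_pos) auto
    finally show ?thesis .
  qed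
  ultimately show ?thesis unfolding unstable_on_def by blast
qed

lemma disjoint_unstable_rescale:
  assumes h: "h \<noteq> 0" and sub: "\<And>y. y \<in> {a'..b'} \<Longrightarrow> \<alpha> + h * y \<in> {a..b}"
    and u: "disjoint_unstable p (\<lambda>y. h\<^sup>2 * V (\<alpha> + h * y)) (\<lambda>y. r (\<alpha> + h * y)) (rescale \<alpha> h) k a' b'"
  shows "disjoint_unstable p V r w k a b"
proof -
  let ?U = "unstable_on p (\<lambda>y. h\<^sup>2 * V (\<alpha> + h * y)) (\<lambda>y. r (\<alpha> + h * y)) (rescale \<alpha> h)"
  obtain c d where 1: "\<And>i. i < k \<Longrightarrow> a' \<le> c i \<and> d i \<le> b' \<and> ?U (c i) (d i)"
    and 2: "\<And>i j. \<lbrakk>i < k; j < k; i \<noteq> j\<rbrakk> \<Longrightarrow> d i \<le> c j \<or> d j \<le> c i"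
    using u unfolding disjoint_unstable_def by blast
  define lo hi where "lo = (\<lambda>i. min (\<alpha> + h * c i) (\<alpha> + h * d i))"
    and "hi = (\<lambda>i. max (\<alpha> + h * c i) (\<alpha> + h * d i))"
  have "disjoint_unstable p V r w (card {..<k}) a b"
  proof (rule disjoint_unstable_family[where c = lo and d = hi])
    fix i assume "i \<in> {..<k}"
    then have i: "a' \<le> c i" "d i \<le> b'" "?U (c i) (d i)" using 1 by auto
    then have lt: "c i < d i" by (simp add: unstable_on_less)
    show "a \<le> lo i \<and> hi i \<le> b \<and> unstable_on p V r w (lo i) (hi i)"
      using unstable_on_rescale[OF h sub i] sub[of "c i"] sub[of "d i"] i lt
      by (auto simp: lo_def hi_def)
  next
    fix i j assume ij: "i \<in> {..<k}" "j \<in> {..<k}" "i \<noteq> j"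
    then have lt: "c i < d i" "c j < d j" using 1[of i] 1[of j] unstable_on_less by blast+
    show "hi i \<le> lo j \<or> hi j \<le> lo i"
    proof (cases "h > 0")
      case True
      then show ?thesis using 2[of i j] ij lt by (auto simp: lo_def hi_def)
    next
      case False
      then have "h < 0" using h by simp
      then show ?thesis using 2[of i j] ij lt by (auto simp: lo_def hi_def)
    qed
  qed simp
  then show ?thesis by simp
qed

text \<open>To the left of \<open>x1\<close> the reflection \<open>y \<mapsto> a + b - y\<close>, a
  rescaling with \<open>h = - 1\<close>, reduces the claim to propagation to the right.\<close>

lemma propagate:
  assumes x1: "x1 \<in> {a..b}" "\<bar>w x1\<bar> \<le> B" "\<bar>dw x1\<bar> \<le> B" and K: "K \<le> 1 / 2" and len: "b \<le> a + 1"
    and k: "\<not> disjoint_unstable p V r w k a b" and x: "x \<in> {a..b}"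
  shows "\<bar>w x\<bar> \<le> (step_bound p R ^^ Suc k) B"
proof (cases "x1 \<le> x")
  case True
  then show ?thesis using propagate_right[of x1 B k x] assms by auto
next
  case False
  have sub: "(a + b) + (- 1) * y \<in> {a..b}" if "y \<in> {a..b}" for y using that by auto
  have h: "(- 1 :: real) \<noteq> 0" by simp
  interpret S: edge_solution p "(- 1)\<^sup>2 * K" \<rho>\<^sub>0 R "\<lambda>y. (- 1)\<^sup>2 * V ((a + b) + (- 1) * y)"
      "\<lambda>y. r ((a + b) + (- 1) * y)" "rescale (a + b) (- 1)"
      "\<lambda>y. \<bar>- 1\<bar> powr (2 / (p - 2)) * (- 1 * dw ((a + b) + (- 1) * y))" a b
    by (rule edge_solution_rescale[OF h sub])
  have "\<not> disjoint_unstable p (\<lambda>y. (- 1)\<^sup>2 * V ((a + b) + (- 1) * y))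
      (\<lambda>y. r ((a + b) + (- 1) * y)) (rescale (a + b) (- 1)) k a b"
    using disjoint_unstable_rescale[OF h sub] k by blast
  from S.propagate_right[OF _ _ _ _ len this, of "a + b - x1" B "a + b - x"]
  show ?thesis using False assms by simp
qed

end


section \<open>Local sup bounds\<close>

text \<open>With \<open>T = 2 n\<^sup>2 / ((p - 2) \<rho>\<^sub>0)\<close> this is
  \<open>2 n\<^sup>2 T powr (2 / (p - 2)) / ((p - 2) \<rho>\<^sub>0)\<close>: the bounded part left
  by Young's inequality, after half of the nonlinear term has been absorbed.\<close>

definition stable_const :: "real \<Rightarrow> real \<Rightarrow> nat \<Rightarrow> real" where
  "stable_const p \<rho>\<^sub>0 n =
     2 * (real n)\<^sup>2 * (2 * (real n)\<^sup>2 / ((p - 2) * \<rho>\<^sub>0)) powr (2 / (p - 2)) / ((p - 2) * \<rho>\<^sub>0)"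

text \<open>For a stable interval of length \<delta>: \<open>C\<close> bounds the integral of
  \<open>\<bar>w\<bar>\<^sup>p\<close> over its middle half, where the cutoff base is at least
  \<open>\<delta>\<^sup>2 / 16\<close>. \<open>A\<close> bounds \<open>\<bar>w\<bar>\<close>
  somewhere on each piece of length \<open>\<delta> / 8\<close> of that half,
  \<open>8 * A / \<delta>\<close> is a mean value bound for the derivative, and
  \<open>(1 + R) * (1 + C)\<close> bounds the oscillation of \<open>dw\<close>.\<close>

definition start_const :: "real \<Rightarrow> real \<Rightarrow> real \<Rightarrow> real \<Rightarrow> nat \<Rightarrow> real" where
  "start_const p \<rho>\<^sub>0 R \<delta> n =
     (let C = stable_const p \<rho>\<^sub>0 n / (\<delta>\<^sup>2 / 16) ^ (2 * n); A = 1 + 8 * C / \<delta>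
      in A + 8 * A / \<delta> + (1 + R) * (1 + C))"

context edge_solution
begin

text \<open>Stability, tested with the cutoff \<open>\<eta> = \<zeta> ^ n\<close>, bounds
  \<open>(p - 2)\<close> times the integral of \<open>r \<bar>w\<bar>\<^sup>p \<eta>\<^sup>2\<close>
  by that of \<open>w\<^sup>2 \<eta>'\<^sup>2\<close>. As \<open>p > 2\<close>, the latter can be
  absorbed up to a constant, provided the cutoff vanishes to sufficiently high order at the
  ends.\<close>

lemma stable_integral_bound:
  assumes cd: "a \<le> c" "d \<le> b" "c < d" "d \<le> c + 1" and stable: "\<not> unstable_on p V r w c d"
    and n: "p / (p - 2) \<le> real n"
  shows "integral {c..d} (\<lambda>x. \<bar>w x\<bar> powr (p - 2) * (w x * ((x - c) * (d - x)) ^ n)\<^sup>2)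
    \<le> stable_const p \<rho>\<^sub>0 n"
proof -
  define \<zeta> where "\<zeta> = (\<lambda>x. (x - c) * (d - x))"
  define \<eta> where "\<eta> = (\<lambda>x. \<zeta> x ^ n)"
  define \<eta>' where "\<eta>' = (\<lambda>x. real n * (c + d - 2 * x) * \<zeta> x ^ (n - 1))"
  have "1 < p / (p - 2)" using p by simp
  then have n2: "2 \<le> n" using n by linarith
  have \<eta>: "(\<eta> has_real_derivative \<eta>' x) (at x within {c..d})" for x
    unfolding \<eta>_def \<eta>'_def \<zeta>_def by (auto intro!: derivative_eq_intros simp: algebra_simps)
  have c\<zeta>: "continuous_on {c..d} \<zeta>" unfolding \<zeta>_def by (intro continuous_intros)
  have c\<eta>: "continuous_on {c..d} \<eta>" "continuous_on {c..d} \<eta>'"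
    unfolding \<eta>_def \<eta>'_def by (intro continuous_intros c\<zeta>)+
  have ends: "w c * \<eta> c = 0" "w d * \<eta> d = 0" using n2 by (auto simp: \<eta>_def \<zeta>_def)
  \<comment> \<open>\<open>?\<epsilon>\<close> spends half of the available coefficient.
    \<open>?T\<close> is the value of \<open>\<bar>w\<bar> powr (p - 2) * \<zeta>\<^sup>2\<close> at
    which \<open>?\<epsilon> * ?g\<close> equals
    \<open>n\<^sup>2 w\<^sup>2 \<zeta> ^ (2 * (n - 1))\<close>, the bound for
    \<open>(w \<eta>')\<^sup>2\<close>.\<close>
  let ?\<epsilon> = "(p - 2) * \<rho>\<^sub>0 / 2" and ?T = "2 * (real n)\<^sup>2 / ((p - 2) * \<rho>\<^sub>0)"
  have pos: "?\<epsilon> > 0" "?T > 0" "(p - 2) * \<rho>\<^sub>0 > 0" using p \<rho>\<^sub>0 n2 by auto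
  let ?g = "\<lambda>x. \<bar>w x\<bar> powr (p - 2) * (w x * \<eta> x)\<^sup>2"
  note cw = w_cont'[OF cd(1,2)]
  have cg: "continuous_on {c..d} ?g" by (intro continuous_intros continuous_on_pot cw c\<eta>)
  \<comment> \<open>Young's inequality by cases: where \<open>\<bar>w\<bar>\<^sup>p\<^sup>-\<^sup>2\<zeta>\<^sup>2\<close> is large the first term absorbs,
    otherwise \<open>n \<ge> p/(p - 2)\<close> makes the left side bounded\<close>
  have young: "(w x * \<eta>' x)\<^sup>2 \<le> ?\<epsilon> * ?g x + (real n)\<^sup>2 * ?T powr (2 / (p - 2))" if x: "x \<in> {c..d}" for x
  proof -
    have \<zeta>0: "0 \<le> \<zeta> x" using x by (simp add: \<zeta>_def)
    have "\<zeta> x \<le> 1 * 1" unfolding \<zeta>_def using x cd by (intro mult_mono) auto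
    then have \<zeta>1: "\<zeta> x \<le> 1" by simp
    have "\<bar>c + d - 2 * x\<bar> \<le> 1" using x cd by auto
    then have "(c + d - 2 * x)\<^sup>2 \<le> 1" by (simp add: abs_square_le_1)
    have "(w x * \<eta>' x)\<^sup>2 = (c + d - 2 * x)\<^sup>2 * ((real n)\<^sup>2 * (w x)\<^sup>2 * (\<zeta> x ^ (n - 1))\<^sup>2)"
      unfolding \<eta>'_def by (simp add: power_mult_distrib)
    also have "\<dots> \<le> 1 * ((real n)\<^sup>2 * (w x)\<^sup>2 * (\<zeta> x ^ (n - 1))\<^sup>2)"
      using \<open>(c + d - 2 * x)\<^sup>2 \<le> 1\<close> by (intro mult_right_mono) auto
    finally have 1: "(w x * \<eta>' x)\<^sup>2 \<le> (real n)\<^sup>2 * (w x)\<^sup>2 * (\<zeta> x ^ (n - 1))\<^sup>2" by simp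
    have \<eta>eq: "\<eta> x = \<zeta> x * \<zeta> x ^ (n - 1)"
      unfolding \<eta>_def using n2 by (metis Suc_diff_1 less_le_trans pos2 power_Suc)
    have g0: "0 \<le> ?g x" by simp
    show ?thesis
    proof (cases "?T \<le> \<bar>w x\<bar> powr (p - 2) * (\<zeta> x)\<^sup>2")
      case True
      have "(real n)\<^sup>2 = ?\<epsilon> * ?T" using p \<rho>\<^sub>0 by (simp add: field_simps)
      also have "\<dots> \<le> ?\<epsilon> * (\<bar>w x\<bar> powr (p - 2) * (\<zeta> x)\<^sup>2)"
        using pos True by (intro mult_left_mono) auto
      finally have "(real n)\<^sup>2 * ((w x)\<^sup>2 * (\<zeta> x ^ (n - 1))\<^sup>2) \<le>
          ?\<epsilon> * (\<bar>w x\<bar> powr (p - 2) * (\<zeta> x)\<^sup>2) * ((w x)\<^sup>2 * (\<zeta> x ^ (n - 1))\<^sup>2)"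
        by (rule mult_right_mono) simp
      also have "\<dots> = ?\<epsilon> * ?g x" unfolding \<eta>eq by (simp add: power_mult_distrib)
      finally have "(real n)\<^sup>2 * (w x)\<^sup>2 * (\<zeta> x ^ (n - 1))\<^sup>2 \<le> ?\<epsilon> * ?g x" by (simp add: mult.assoc)
      moreover have "0 \<le> (real n)\<^sup>2 * ?T powr (2 / (p - 2))" by simp
      ultimately show ?thesis using 1 by linarith
    next
      case False
      have "(w x)\<^sup>2 * (\<zeta> x ^ (n - 1))\<^sup>2 \<le> ?T powr (2 / (p - 2))"
      proof (cases "\<zeta> x = 0 \<or> w x = 0")
        case True
        then have "(w x)\<^sup>2 * (\<zeta> x ^ (n - 1))\<^sup>2 = 0" using n2 by auto
        then show ?thesis by (simp only: powr_ge_zero)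
      next
        case nz: False
        have e: "(p - 2) * (2 / (p - 2)) = 2" using p by (simp add: field_simps)
        have "(\<zeta> x ^ (n - 1))\<^sup>2 = \<zeta> x ^ (2 * (n - 1))"
          by (simp add: power_mult[symmetric] mult.commute)
        also have "\<dots> = \<zeta> x powr (real (2 * (n - 1)))"
          by (rule powr_realpow[symmetric]) (use \<zeta>0 nz in auto)
        \<comment> \<open>Since \<open>0 < \<zeta> x \<le> 1\<close>, lowering the exponent
          increases the power; the lower bound on \<open>n\<close> is exactly
          \<open>2 * (n - 1) \<ge> 4 / (p - 2)\<close>. The new exponent is the one that combines
          with \<open>w\<^sup>2\<close> into a power of
          \<open>\<bar>w\<bar> powr (p - 2) * \<zeta>\<^sup>2\<close>.\<close>
        also have "\<dots> \<le> \<zeta> x powr (4 / (p - 2))"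
        proof (rule powr_mono')
          have "p / (p - 2) = 1 + 2 / (p - 2)" using p by (simp add: field_simps)
          then show "4 / (p - 2) \<le> real (2 * (n - 1))" using n n2 by (simp add: of_nat_diff)
        qed (use \<zeta>0 \<zeta>1 in auto)
        finally have "(w x)\<^sup>2 * (\<zeta> x ^ (n - 1))\<^sup>2 \<le> (w x)\<^sup>2 * \<zeta> x powr (4 / (p - 2))"
          by (rule mult_left_mono) simp
        also have "\<dots> = (\<bar>w x\<bar> powr (p - 2) * (\<zeta> x)\<^sup>2) powr (2 / (p - 2))"
        proof -
          have "(\<bar>w x\<bar> powr (p - 2)) powr (2 / (p - 2)) = (w x)\<^sup>2"
            unfolding powr_powr e using nz by simp
          moreover have "((\<zeta> x)\<^sup>2) powr (2 / (p - 2)) = \<zeta> x powr (4 / (p - 2))"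
          proof -
            have "(\<zeta> x)\<^sup>2 = \<zeta> x powr 2" using \<zeta>0 nz by simp
            then show ?thesis by (simp add: powr_powr)
          qed
          ultimately show ?thesis by (simp add: powr_mult)
        qed
        also have "\<dots> \<le> ?T powr (2 / (p - 2))"
          using False p by (intro powr_mono2) auto
        finally show ?thesis .
      qed
      then have "(real n)\<^sup>2 * ((w x)\<^sup>2 * (\<zeta> x ^ (n - 1))\<^sup>2) \<le> (real n)\<^sup>2 * ?T powr (2 / (p - 2))"
        by (rule mult_left_mono) simp
      moreover have "0 \<le> ?\<epsilon> * ?g x" using pos g0 by (intro mult_nonneg_nonneg) auto
      ultimately show ?thesis using 1 by (simp add: mult.assoc)
    qed
  qed
  let ?C = "(real n)\<^sup>2 * ?T powr (2 / (p - 2))"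
  have "test_fun c d (\<lambda>x. w x * \<eta> x) (\<lambda>x. dw x * \<eta> x + w x * \<eta>' x)"
    by (rule test_fun_mult[OF cd(1-3) ends \<eta> c\<eta>(2)])
  then have "\<not> quad_form p V r w c d (\<lambda>x. w x * \<eta> x) (\<lambda>x. dw x * \<eta> x + w x * \<eta>' x) < 0"
    using stable unfolding unstable_on_def by blast
  then have "(p - 2) * integral {c..d} (\<lambda>x. r x * ?g x) \<le> integral {c..d} (\<lambda>x. (w x * \<eta>' x)\<^sup>2)"
    using quad_form_times_solution(1)[OF cd(1-3) ends \<eta> c\<eta>(2)] by simp
  also have "\<dots> \<le> integral {c..d} (\<lambda>x. ?\<epsilon> * ?g x + ?C)"
    by (rule integral_le)
      (use young in \<open>auto intro!: integrable_continuous_real continuous_intros cw c\<eta> cg\<close>)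
  also have "\<dots> = ?\<epsilon> * integral {c..d} ?g + ?C * (d - c)"
    using cd cg by (subst Henstock_Kurzweil_Integration.integral_add)
      (auto intro!: integrable_continuous_real continuous_intros)
  also have "\<dots> \<le> ?\<epsilon> * integral {c..d} ?g + ?C * 1"
    using cd by (intro add_left_mono mult_left_mono) auto
  finally have 1: "(p - 2) * integral {c..d} (\<lambda>x. r x * ?g x) \<le> ?\<epsilon> * integral {c..d} ?g + ?C" by simp
  have "\<rho>\<^sub>0 * integral {c..d} ?g = integral {c..d} (\<lambda>x. \<rho>\<^sub>0 * ?g x)" by simp
  also have "\<dots> \<le> integral {c..d} (\<lambda>x. r x * ?g x)"
  proof (rule integral_le)
    show "(\<lambda>x. \<rho>\<^sub>0 * ?g x) integrable_on {c..d}"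
      by (intro integrable_continuous_real continuous_intros cg)
    show "(\<lambda>x. r x * ?g x) integrable_on {c..d}" by (rule r_int[OF cg])
    show "\<rho>\<^sub>0 * ?g x \<le> r x * ?g x" for x by (intro mult_right_mono r_ge) auto
  qed
  finally have "(p - 2) * (\<rho>\<^sub>0 * integral {c..d} ?g) \<le> (p - 2) * integral {c..d} (\<lambda>x. r x * ?g x)"
    using p by (intro mult_left_mono) auto
  from order_trans[OF this 1]
  have "(p - 2) * \<rho>\<^sub>0 * integral {c..d} ?g \<le> ?\<epsilon> * integral {c..d} ?g + ?C" by (simp only: mult.assoc)
  moreover have "?\<epsilon> * integral {c..d} ?g = (p - 2) * \<rho>\<^sub>0 * integral {c..d} ?g / 2" by simp
  ultimately have "(p - 2) * \<rho>\<^sub>0 * integral {c..d} ?g \<le> 2 * ?C" by linarith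
  then have "integral {c..d} ?g \<le> 2 * ?C / ((p - 2) * \<rho>\<^sub>0)"
    using pos(3) by (simp add: pos_le_divide_eq mult.commute)
  then show ?thesis by (simp add: stable_const_def \<eta>_def \<zeta>_def mult.assoc)
qed

text \<open>Propagation needs a point where \<open>w\<close> and \<open>dw\<close> are both bounded.
  Near each end of the middle half \<open>\<bar>w\<bar> \<le> A\<close> at some point; between these
  two points the mean value theorem gives a point with bounded derivative. Since the integral of
  \<open>\<bar>nl_rhs\<bar>\<close> is bounded, the derivative bound is transferred to the first of
  the two points.\<close>

lemma start_point:
  assumes cd: "a \<le> c" "d \<le> b" "c < d" "d \<le> c + 1" and stable: "\<not> unstable_on p V r w c d"
    and n: "p / (p - 2) \<le> real n" and K: "K \<le> 1 / 2"
  obtains x where "x \<in> {c..d}" "\<bar>w x\<bar> \<le> start_const p \<rho>\<^sub>0 R (d - c) n"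
    "\<bar>dw x\<bar> \<le> start_const p \<rho>\<^sub>0 R (d - c) n"
proof -
  define \<delta> where "\<delta> = d - c"
  have \<delta>: "0 < \<delta>" "\<delta> \<le> 1" using cd by (auto simp: \<delta>_def)
  have dc: "d = c + \<delta>" by (simp add: \<delta>_def)
  define C where "C = stable_const p \<rho>\<^sub>0 n / (\<delta>\<^sup>2 / 16) ^ (2 * n)"
  define A where "A = 1 + 8 * C / \<delta>"
  have B: "start_const p \<rho>\<^sub>0 R (d - c) n = A + 8 * A / \<delta> + (1 + R) * (1 + C)"
    by (simp add: start_const_def Let_def A_def C_def \<delta>_def)
  define s t where "s = c + \<delta> / 4" and "t = d - \<delta> / 4"
  have st: "c \<le> s" "s \<le> t" "t \<le> d" "t - s = \<delta> / 2" "t - s \<le> 1"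
    using \<delta> dc unfolding s_def t_def by linarith+
  let ?g = "\<lambda>x. \<bar>w x\<bar> powr (p - 2) * (w x)\<^sup>2"
  let ?G = "\<lambda>x. \<bar>w x\<bar> powr (p - 2) * (w x * ((x - c) * (d - x)) ^ n)\<^sup>2"
  note cw = w_cont'[OF cd(1,2)]
  have cg: "continuous_on {c..d} ?g" and cG: "continuous_on {c..d} ?G"
    by (intro continuous_intros continuous_on_pot cw)+
  have gi: "?g integrable_on {x..y}" if "c \<le> x" "y \<le> d" for x y
    by (rule integrable_continuous_real[OF continuous_on_subset[OF cg]]) (use that in auto)
  have Gi: "?G integrable_on {x..y}" if "c \<le> x" "y \<le> d" for x y
    by (rule integrable_continuous_real[OF continuous_on_subset[OF cG]]) (use that in auto)
  let ?k = "(\<delta>\<^sup>2 / 16) ^ (2 * n)"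
  have k: "?k > 0" using \<delta> by simp
  have "?k * integral {s..t} ?g = integral {s..t} (\<lambda>x. ?k * ?g x)" by simp
  also have "\<dots> \<le> integral {s..t} ?G"
  proof (rule integral_le)
    show "(\<lambda>x. ?k * ?g x) integrable_on {s..t}" using gi[of s t] st by (intro integrable_on_mult_right) auto
    show "?G integrable_on {s..t}" using Gi st by auto
    fix x assume x: "x \<in> {s..t}"
    have "(\<delta> / 4) * (\<delta> / 4) \<le> (x - c) * (d - x)"
      using x \<delta> by (intro mult_mono) (auto simp: s_def t_def)
    then have "\<delta>\<^sup>2 / 16 \<le> (x - c) * (d - x)" by (simp add: power2_eq_square)
    then have "(\<delta>\<^sup>2 / 16) ^ (2 * n) \<le> ((x - c) * (d - x)) ^ (2 * n)" by (intro power_mono) auto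
    then have "?k \<le> (((x - c) * (d - x)) ^ n)\<^sup>2" by (simp add: power_mult[symmetric] mult.commute)
    then have "?k * ?g x \<le> (((x - c) * (d - x)) ^ n)\<^sup>2 * ?g x" by (rule mult_right_mono) simp
    then show "?k * ?g x \<le> ?G x" by (simp only: power_mult_distrib mult_ac)
  qed
  also have "\<dots> \<le> integral {c..d} ?G"
    using st by (intro integral_subset_le Gi) auto
  also have "\<dots> \<le> stable_const p \<rho>\<^sub>0 n" by (rule stable_integral_bound[OF cd stable n])
  finally have gC: "integral {s..t} ?g \<le> C" using k by (simp add: C_def pos_le_divide_eq mult.commute)
  have gC': "integral {x..y} ?g \<le> C" if "s \<le> x" "y \<le> t" for x y
    using that st by (intro order_trans[OF integral_subset_le gC] gi) auto
  have "0 \<le> integral {s..t} ?g" by (rule Henstock_Kurzweil_Integration.integral_nonneg[OF gi]) (use st in auto)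
  then have C0: "0 \<le> C" using gC by simp
  then have A1: "1 \<le> A" using \<delta> by (simp add: A_def)
  \<comment> \<open>Both terms of the equation are dominated by
    \<open>1 + \<bar>w\<bar>\<^sup>p\<close>, so the integral bound for
    \<open>\<bar>w\<bar>\<^sup>p\<close> controls the oscillation of \<open>dw\<close>.\<close>
  have g_ge: "\<bar>w x\<bar> \<le> 1 + ?g x" "\<bar>w x\<bar> powr (p - 2) * \<bar>w x\<bar> \<le> 1 + ?g x" for x
  proof -
    have "\<bar>w x\<bar> \<le> 1 + ?g x \<and> \<bar>w x\<bar> powr (p - 2) * \<bar>w x\<bar> \<le> 1 + ?g x"
    proof (cases "\<bar>w x\<bar> \<le> 1")
      case True
      then have "\<bar>w x\<bar> powr (p - 2) \<le> 1" using p by (simp add: powr_le1)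
      then have "\<bar>w x\<bar> powr (p - 2) * \<bar>w x\<bar> \<le> 1 * 1" using True by (intro mult_mono) auto
      moreover have "0 \<le> ?g x" by simp
      ultimately show ?thesis using True by linarith
    next
      case False
      have w2: "\<bar>w x\<bar> \<le> (w x)\<^sup>2" using False mult_right_mono[of 1 "\<bar>w x\<bar>" "\<bar>w x\<bar>"]
        by (simp add: power2_eq_square)
      have "1 \<le> \<bar>w x\<bar> powr (p - 2)" using False p by (simp add: ge_one_powr_ge_zero)
      then have "1 * (w x)\<^sup>2 \<le> ?g x" by (rule mult_right_mono) simp
      moreover have "\<bar>w x\<bar> powr (p - 2) * \<bar>w x\<bar> \<le> ?g x" using w2 by (rule mult_left_mono) simp
      ultimately show ?thesis using w2 by linarith
    qed
    then show "\<bar>w x\<bar> \<le> 1 + ?g x" "\<bar>w x\<bar> powr (p - 2) * \<bar>w x\<bar> \<le> 1 + ?g x" by auto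
  qed
  \<comment> \<open>If \<open>\<bar>w\<bar> > A \<ge> 1\<close> on a piece of length
    \<open>\<delta> / 8\<close>, then \<open>\<bar>w\<bar>\<^sup>p \<ge> A\<close> there, and the
    integral is at least \<open>A * \<delta> / 8 = C + \<delta> / 8\<close>, which exceeds
    \<open>C\<close>.\<close>
  have small: "\<exists>x\<in>{y..z}. \<bar>w x\<bar> \<le> A" if yz: "s \<le> y" "z \<le> t" "z - y = \<delta> / 8" for y z
  proof (rule ccontr)
    assume "\<not> ?thesis"
    then have big: "\<bar>w x\<bar> > A" if "x \<in> {y..z}" for x using that by force
    have "A * (z - y) = integral {y..z} (\<lambda>x. A)" using yz \<delta> by simp
    also have "\<dots> \<le> integral {y..z} (\<lambda>x. ?g x)"
    proof (rule integral_le)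
      fix x assume "x \<in> {y..z}"
      from big[OF this] have w: "\<bar>w x\<bar> > A" .
      have w2: "\<bar>w x\<bar> \<le> (w x)\<^sup>2" using w A1 mult_right_mono[of 1 "\<bar>w x\<bar>" "\<bar>w x\<bar>"]
        by (simp add: power2_eq_square)
      have "1 \<le> \<bar>w x\<bar> powr (p - 2)" using w A1 p by (simp add: ge_one_powr_ge_zero)
      then have "1 * (w x)\<^sup>2 \<le> ?g x" by (rule mult_right_mono) simp
      then show "A \<le> ?g x" using w w2 by linarith
    qed (use gi yz st in auto)
    also have "\<dots> \<le> C" using gC' yz by auto
    finally have "A * (\<delta> / 8) \<le> C" using yz by simp
    moreover have "A * (\<delta> / 8) = \<delta> / 8 + C" using \<delta> by (simp add: A_def field_simps)
    ultimately show False using \<delta> by linarith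
  qed
  have dw_osc: "\<bar>dw y - dw x\<bar> \<le> (1 + R) * (1 + C)" if "s \<le> x" "x \<le> y" "y \<le> t" for x y
  proof -
    have i: "(nl_rhs p V r w has_integral (dw y - dw x)) {x..y}"
      using w_eq[of x y] that st cd by auto
    have "norm (integral {x..y} (nl_rhs p V r w)) \<le> integral {x..y} (\<lambda>x. (1 + R) * (1 + ?g x))"
    proof (rule integral_norm_bound_integral)
      show "(\<lambda>x. (1 + R) * (1 + ?g x)) integrable_on {x..y}"
        using gi[of x y] that st by (intro integrable_on_mult_right integrable_add) auto
      fix z assume z: "z \<in> {x..y}"
      have "\<bar>nl_rhs p V r w z\<bar> \<le> \<bar>V z\<bar> * \<bar>w z\<bar> + \<bar>r z\<bar> * (\<bar>w z\<bar> powr (p - 2) * \<bar>w z\<bar>)"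
        unfolding nl_rhs_def by (rule order_trans[OF abs_triangle_ineq4]) (simp add: abs_mult)
      also have "\<dots> \<le> 1 * (1 + ?g z) + R * (1 + ?g z)"
        using g_ge[of z] V_le[of z] K r_abs R_pos by (intro add_mono mult_mono) auto
      finally show "norm (nl_rhs p V r w z) \<le> (1 + R) * (1 + ?g z)" by (simp add: algebra_simps)
    qed (use i in auto)
    also have "\<dots> = (1 + R) * (integral {x..y} (\<lambda>x. 1 + ?g x))" by simp
    also have "integral {x..y} (\<lambda>x. 1 + ?g x) = (y - x) + integral {x..y} ?g"
      using gi[of x y] that st by (subst Henstock_Kurzweil_Integration.integral_add) auto
    also have "(1 + R) * ((y - x) + integral {x..y} ?g) \<le> (1 + R) * (1 + C)"
      using R_pos that st gC'[of x y] by (intro mult_left_mono add_mono) auto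
    finally show ?thesis using integral_unique[OF i] by simp
  qed
  obtain x where x: "x \<in> {s..s + \<delta> / 8}" "\<bar>w x\<bar> \<le> A"
    using small[of s "s + \<delta> / 8"] \<delta> st by auto
  obtain y where y: "y \<in> {t - \<delta> / 8..t}" "\<bar>w y\<bar> \<le> A"
    using small[of "t - \<delta> / 8" t] \<delta> st by auto
  have xy: "x < y" "y - x \<ge> \<delta> / 4" using x y st \<delta> by auto
  have "\<exists>z>x. z < y \<and> w y - w x = (y - x) * dw z"
    by (rule MVT2[OF xy(1)]) (use w_deriv x y st cd in auto)
  then obtain z where z: "x < z" "z < y" "w y - w x = (y - x) * dw z" by blast
  have "\<delta> / 4 * \<bar>dw z\<bar> \<le> (y - x) * \<bar>dw z\<bar>" using xy by (intro mult_right_mono) auto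
  also have "\<dots> = \<bar>w y - w x\<bar>" using z xy by (simp add: abs_mult)
  also have "\<dots> \<le> 2 * A" using x y by linarith
  finally have "\<bar>dw z\<bar> \<le> 8 * A / \<delta>" using \<delta> by (simp add: field_simps)
  moreover have "\<bar>dw z - dw x\<bar> \<le> (1 + R) * (1 + C)" by (rule dw_osc) (use x y z in auto)
  ultimately have d: "\<bar>dw x\<bar> \<le> 8 * A / \<delta> + (1 + R) * (1 + C)" by linarith
  have "0 \<le> 8 * A / \<delta>" "0 \<le> (1 + R) * (1 + C)" using A1 \<delta> R_pos C0 by auto
  then have "\<bar>w x\<bar> \<le> start_const p \<rho>\<^sub>0 R (d - c) n" "\<bar>dw x\<bar> \<le> start_const p \<rho>\<^sub>0 R (d - c) n"
    unfolding B using d x A1 by linarith+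
  moreover have "x \<in> {c..d}" using x st \<delta> by auto
  ultimately show ?thesis using that by blast
qed

end

text \<open>Here \<open>m\<close> is a number of non-overlapping unstable intervals that is
  excluded; a Morse index at most \<open>m\<close> leads to the argument \<open>Suc m\<close>. The
  rounded-up \<open>p / (p - 2)\<close> is the cutoff exponent required for stable
  intervals.\<close>

definition window_const :: "real \<Rightarrow> real \<Rightarrow> real \<Rightarrow> nat \<Rightarrow> real" where
  "window_const p \<rho>\<^sub>0 R m = (step_bound p R ^^ Suc m)
     (start_const p \<rho>\<^sub>0 R (1 / real m) (nat \<lceil>p / (p - 2)\<rceil>))"

context edge_solution
begin

lemma unit_window_bound:
  assumes len: "b = a + 1" and K: "K \<le> 1 / 2" and m: "m > 0"
    and k: "\<not> disjoint_unstable p V r w m a b" and x: "x \<in> {a..b}"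
  shows "\<bar>w x\<bar> \<le> window_const p \<rho>\<^sub>0 R m"
proof -
  define c where "c = (\<lambda>i. a + real i / real m)"
  have "\<exists>i<m. \<not> unstable_on p V r w (c i) (c (Suc i))"
  proof (rule ccontr)
    assume *: "\<not> ?thesis"
    have "disjoint_unstable p V r w (card {..<m}) a b"
    proof (rule disjoint_unstable_family[where c = c and d = "\<lambda>i. c (Suc i)"])
      fix i assume i: "i \<in> {..<m}"
      then have "real (Suc i) \<le> real m" by (metis Suc_leI lessThan_iff of_nat_le_iff)
      then show "a \<le> c i \<and> c (Suc i) \<le> b \<and> unstable_on p V r w (c i) (c (Suc i))"
        using * i m by (auto simp: c_def len)
    next
      fix i j assume "i \<in> {..<m}" "j \<in> {..<m}" "i \<noteq> j"
      then have "Suc i \<le> j \<or> Suc j \<le> i" by auto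
      then have "real (Suc i) \<le> real j \<or> real (Suc j) \<le> real i" by (simp only: of_nat_le_iff)
      then show "c (Suc i) \<le> c j \<or> c (Suc j) \<le> c i" using m by (auto simp: c_def divide_right_mono)
    qed simp
    then show False using k by simp
  qed
  then obtain i where i: "i < m" "\<not> unstable_on p V r w (c i) (c (Suc i))" by blast
  then have "real (Suc i) \<le> real m" by (metis Suc_leI of_nat_le_iff)
  then have "c (Suc i) \<le> b" using m by (simp add: c_def len)
  moreover have "c (Suc i) - c i = 1 / real m" by (simp add: c_def add_divide_distrib)
  moreover have "0 < 1 / real m" "1 / real m \<le> 1" using m by auto
  moreover have "a \<le> c i" by (simp add: c_def)
  ultimately have ci: "a \<le> c i" "c (Suc i) \<le> b" "c (Suc i) - c i = 1 / real m" "c i < c (Suc i)"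
    "c (Suc i) \<le> c i + 1" by linarith+
  have n: "p / (p - 2) \<le> real (nat \<lceil>p / (p - 2)\<rceil>)" by linarith
  obtain y where y: "y \<in> {c i..c (Suc i)}" "\<bar>w y\<bar> \<le> start_const p \<rho>\<^sub>0 R (1 / real m) (nat \<lceil>p / (p - 2)\<rceil>)"
    "\<bar>dw y\<bar> \<le> start_const p \<rho>\<^sub>0 R (1 / real m) (nat \<lceil>p / (p - 2)\<rceil>)"
    using start_point[OF ci(1,2,4,5) i(2) n K] unfolding ci(3) by blast
  show ?thesis unfolding window_const_def
    by (rule propagate[OF _ y(2,3) K _ k x]) (use y ci len in auto)
qed

text \<open>After rescaling to unit length the potential is bounded by \<open>h\<^sup>2 * K\<close>,
  hence the smallness condition on that product. Undoing the amplitude factor produces the power of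
  \<open>h\<close>.\<close>

lemma window_bound:
  assumes h: "0 < h" "h\<^sup>2 * K \<le> 1 / 2" and sub: "a \<le> s" "s + h \<le> b" and m: "m > 0"
    and k: "\<not> disjoint_unstable p V r w m a b" and x: "x \<in> {s..s + h}"
  shows "\<bar>w x\<bar> \<le> window_const p \<rho>\<^sub>0 R m * h powr (- 2 / (p - 2))"
proof -
  have in_ab: "s + h * y \<in> {a..b}" if "y \<in> {0..1}" for y
  proof -
    have "0 \<le> h * y" "h * y \<le> h * 1" using that h by (auto intro: mult_left_mono)
    then show ?thesis using sub by auto
  qed
  have h0: "h \<noteq> 0" using h by simp
  interpret S: edge_solution p "h\<^sup>2 * K" \<rho>\<^sub>0 R "\<lambda>y. h\<^sup>2 * V (s + h * y)" "\<lambda>y. r (s + h * y)"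
      "rescale s h" "\<lambda>y. \<bar>h\<bar> powr (2 / (p - 2)) * (h * dw (s + h * y))" 0 1
    by (rule edge_solution_rescale[OF h0 in_ab])
  have k': "\<not> disjoint_unstable p (\<lambda>y. h\<^sup>2 * V (s + h * y)) (\<lambda>y. r (s + h * y)) (rescale s h) m 0 1"
    using disjoint_unstable_rescale[OF h0 in_ab] k by blast
  have x': "(x - s) / h \<in> {0..1}" using x h by (auto simp: field_simps)
  have "\<bar>rescale s h ((x - s) / h)\<bar> \<le> window_const p \<rho>\<^sub>0 R m"
    by (rule S.unit_window_bound[OF _ h(2) m k' x']) simp
  then have "h powr (2 / (p - 2)) * \<bar>w x\<bar> \<le> window_const p \<rho>\<^sub>0 R m"
    using h by (simp add: abs_mult)
  then show ?thesis using h by (simp add: powr_minus_divide field_simps)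
qed

end


section \<open>Local mass bounds\<close>

text \<open>For the parabola \<open>(x - c) * (d - x)\<close> on an interval of length
  \<open>L\<close> the integral of the squared derivative is \<open>L ^ 3 / 3\<close> and that of
  the square is \<open>L ^ 5 / 30\<close>, so \<open>\<mu> * L\<^sup>2 > 10\<close> makes the linear
  part negative. The nonlinear part only helps, whatever \<open>w\<close> is.\<close>

lemma (in edge_coeffs) unstable_on_negative_potential:
  assumes cw: "continuous_on {c..d} w" and cd: "c < d" and V: "\<And>x. V x \<le> - \<mu>" and \<mu>: "10 < \<mu> * (d - c)\<^sup>2"
  shows "unstable_on p V r w c d"
proof -
  let ?\<phi> = "\<lambda>x. (x - c) * (d - x)" and ?\<phi>' = "\<lambda>x. c + d - 2 * x"
  define L where "L = d - c"
  have d: "d = c + L" and L: "L > 0" "10 < \<mu> * L\<^sup>2" using cd \<mu> by (auto simp: L_def)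
  have t: "test_fun c d ?\<phi> ?\<phi>'"
    using cd unfolding test_fun_def
    by (auto intro!: derivative_eq_intros continuous_intros simp: algebra_simps)
  \<comment> \<open>An explicit antiderivative: in the variable \<open>x - c\<close> the parabola
    and its derivative are polynomials with coefficients in \<open>L\<close>.\<close>
  let ?P = "\<lambda>x. L\<^sup>2 * (x - c) - 2 * L * (x - c)\<^sup>2 + 4 * (x - c) ^ 3 / 3 -
      \<mu> * (L\<^sup>2 * (x - c) ^ 3 / 3 - L * (x - c) ^ 4 / 2 + (x - c) ^ 5 / 5)"
  have "((\<lambda>x. (?\<phi>' x)\<^sup>2 - \<mu> * (?\<phi> x)\<^sup>2) has_integral ?P d - ?P c) {c..d}"
  proof (rule fundamental_theorem_of_calculus)
    fix x
    have "(?P has_real_derivative (?\<phi>' x)\<^sup>2 - \<mu> * (?\<phi> x)\<^sup>2) (at x within {c..d})"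
      unfolding d by (rule derivative_eq_intros refl | simp)+ (simp add: field_simps power2_eq_square power3_eq_cube power4_eq_xxxx)
    then show "(?P has_vector_derivative (?\<phi>' x)\<^sup>2 - \<mu> * (?\<phi> x)\<^sup>2) (at x within {c..d})"
      by (simp add: has_real_derivative_iff_has_vector_derivative)
  qed (use cd in simp)
  moreover have "?P d - ?P c = L ^ 3 / 3 - \<mu> * L ^ 5 / 30"
    unfolding d by (simp add: field_simps power2_eq_square power3_eq_cube eval_nat_numeral)
  ultimately have i: "((\<lambda>x. (?\<phi>' x)\<^sup>2 - \<mu> * (?\<phi> x)\<^sup>2) has_integral L ^ 3 / 3 - \<mu> * L ^ 5 / 30) {c..d}"
    by simp
  have "quad_form p V r w c d ?\<phi> ?\<phi>' \<le> L ^ 3 / 3 - \<mu> * L ^ 5 / 30"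
    unfolding quad_form_def
  proof (rule has_integral_le[OF integrable_integral i])
    show "(\<lambda>x. (?\<phi>' x)\<^sup>2 + V x * (?\<phi> x)\<^sup>2 - (p - 1) * r x * \<bar>w x\<bar> powr (p - 2) * (?\<phi> x)\<^sup>2) integrable_on {c..d}"
      by (rule quad_form_integrable[OF cw test_fun_continuous[OF t]])
    fix x
    have "V x * (?\<phi> x)\<^sup>2 \<le> - \<mu> * (?\<phi> x)\<^sup>2" by (rule mult_right_mono[OF V]) simp
    moreover have "0 \<le> (p - 1) * r x * \<bar>w x\<bar> powr (p - 2) * (?\<phi> x)\<^sup>2"
      using p r_pos[of x] by simp
    ultimately show "(?\<phi>' x)\<^sup>2 + V x * (?\<phi> x)\<^sup>2 - (p - 1) * r x * \<bar>w x\<bar> powr (p - 2) * (?\<phi> x)\<^sup>2 \<le>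
      (?\<phi>' x)\<^sup>2 - \<mu> * (?\<phi> x)\<^sup>2" by simp
  qed
  also have "\<dots> = L ^ 3 * (10 - \<mu> * L\<^sup>2) / 30" by (simp add: field_simps eval_nat_numeral)
  also have "\<dots> < 0" using L by (simp add: mult_pos_neg divide_neg_pos)
  finally show ?thesis using t unfolding unstable_on_def by blast
qed

text \<open>Summing the hypothesis over good indices counts each term at most three times, so the
  good part is at most \<open>3 / 6\<close> of the total. The bad indices therefore carry at least
  half of it, which explains the factor 2.\<close>

lemma sum_le_of_local_averages:
  fixes S :: "nat \<Rightarrow> real"
  assumes S: "\<And>i. i < n \<Longrightarrow> 0 \<le> S i" and Q: "\<And>i. i < n \<Longrightarrow> S i \<le> Q" and Q0: "0 \<le> Q"
    and bad: "B \<subseteq> {..<n}" "card B \<le> N"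
    and good: "\<And>i. \<lbrakk>i < n; i \<notin> B\<rbrakk> \<Longrightarrow> 1 \<le> i \<and> Suc i < n \<and> S i \<le> (S (i - 1) + S i + S (Suc i)) / 6"
  shows "(\<Sum>i<n. S i) \<le> 2 * real N * Q"
proof -
  let ?T = "\<Sum>i<n. S i" and ?A = "{..<n} - B"
  have fin: "finite B" using bad(1) finite_subset by blast
  have shift: "(\<Sum>i\<in>?A. S (f i)) \<le> ?T" if "inj_on f ?A" "f ` ?A \<subseteq> {..<n}" for f
  proof -
    have "(\<Sum>i\<in>?A. S (f i)) = sum S (f ` ?A)" using sum.reindex[OF that(1), of S] by simp
    also have "\<dots> \<le> ?T" by (rule sum_mono2) (use that S in auto)
    finally show ?thesis .
  qed
  have "(\<Sum>i\<in>?A. S i) \<le> (\<Sum>i\<in>?A. (S (i - 1) + S i + S (Suc i)) / 6)"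
    by (rule sum_mono) (use good in auto)
  also have "\<dots> = ((\<Sum>i\<in>?A. S (i - 1)) + (\<Sum>i\<in>?A. S i) + (\<Sum>i\<in>?A. S (Suc i))) / 6"
    by (simp add: sum.distrib flip: sum_divide_distrib)
  also have "\<dots> \<le> (?T + ?T + ?T) / 6"
  proof (intro divide_right_mono add_mono)
    show "(\<Sum>i\<in>?A. S (i - 1)) \<le> ?T"
    proof (rule shift)
      show "inj_on (\<lambda>i. i - 1) ?A"
      proof (rule inj_onI)
        fix x y assume "x \<in> ?A" "y \<in> ?A" "x - 1 = y - 1"
        then show "x = y" using good[of x] good[of y] by auto
      qed
    qed auto
    show "(\<Sum>i\<in>?A. S i) \<le> ?T" using shift[of "\<lambda>i. i"] by auto
    show "(\<Sum>i\<in>?A. S (Suc i)) \<le> ?T" by (rule shift) (use good in auto)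
  qed simp
  finally have 1: "(\<Sum>i\<in>?A. S i) \<le> ?T / 2" by simp
  have "?T = (\<Sum>i\<in>?A. S i) + (\<Sum>i\<in>B. S i)"
    using sum.subset_diff[of B "{..<n}" S] bad(1) by simp
  moreover have "(\<Sum>i\<in>B. S i) \<le> real (card B) * Q"
    using sum_bounded_above[of B S Q] Q bad by (auto simp: subset_iff)
  moreover have "real (card B) * Q \<le> real N * Q"
    using bad(2) Q0 by (intro mult_right_mono) auto
  ultimately show ?thesis using 1 by simp
qed

context edge_solution
begin

text \<open>The cutoff is at least 1 on the middle cell and has slope at most
  \<open>3 / (2 * H)\<close>. Stability bounds the nonlinear term by \<open>1 / (p - 2)\<close>
  times the cutoff term, so \<open>\<kappa> / 2\<close> times the middle integral is at most
  \<open>(p - 1) / (p - 2) * 9 / (4 * H\<^sup>2)\<close> times the integral over the triple. The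
  constant 27 is what turns the resulting ratio into a sixth.\<close>

lemma stable_triple:
  assumes H: "0 < H" "27 * (p - 1) / (p - 2) \<le> \<kappa> * H\<^sup>2" and \<kappa>: "0 < \<kappa>" and V: "\<And>x. \<kappa> / 2 \<le> V x"
    and c: "a \<le> c" "c + 3 * H \<le> b" and stable: "\<not> unstable_on p V r w c (c + 3 * H)"
  shows "integral {c + H..c + 2 * H} (\<lambda>x. (w x)\<^sup>2) \<le> integral {c..c + 3 * H} (\<lambda>x. (w x)\<^sup>2) / 6"
proof -
  define d where "d = c + 3 * H"
  define \<eta> where "\<eta> = (\<lambda>x. (x - c) * (d - x) / (2 * H\<^sup>2))"
  define \<eta>' where "\<eta>' = (\<lambda>x. (c + d - 2 * x) / (2 * H\<^sup>2))"
  have cd: "a \<le> c" "d \<le> b" "c < d" using c H by (auto simp: d_def)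
  have \<eta>: "(\<eta> has_real_derivative \<eta>' x) (at x within {c..d})" for x
    unfolding \<eta>_def \<eta>'_def
    by (rule DERIV_cdivide) (auto intro!: derivative_eq_intros simp: algebra_simps)
  have c\<eta>: "continuous_on {c..d} \<eta>" "continuous_on {c..d} \<eta>'"
    unfolding \<eta>_def \<eta>'_def using H by (auto intro!: continuous_intros)
  have ends: "w c * \<eta> c = 0" "w d * \<eta> d = 0" by (auto simp: \<eta>_def)
  note cw = w_cont'[OF cd(1,2)] and cdw = dw_cont'[OF cd(1,2)]
  let ?A = "integral {c..d} (\<lambda>x. (w x * \<eta>' x)\<^sup>2)"
  let ?B = "integral {c..d} (\<lambda>x. r x * (\<bar>w x\<bar> powr (p - 2) * (w x * \<eta> x)\<^sup>2))"
  let ?W = "\<lambda>x. (w x)\<^sup>2"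
  have cW: "continuous_on {c..d} ?W" by (intro continuous_intros cw)
  have Wi: "?W integrable_on {x..y}" if "c \<le> x" "y \<le> d" for x y
    by (rule integrable_continuous_real[OF continuous_on_subset[OF cW]]) (use that in auto)
  have "test_fun c d (\<lambda>x. w x * \<eta> x) (\<lambda>x. dw x * \<eta> x + w x * \<eta>' x)"
    by (rule test_fun_mult[OF cd ends \<eta> c\<eta>(2)])
  then have "\<not> quad_form p V r w c d (\<lambda>x. w x * \<eta> x) (\<lambda>x. dw x * \<eta> x + w x * \<eta>' x) < 0"
    using stable unfolding unstable_on_def d_def by blast
  then have B: "(p - 2) * ?B \<le> ?A"
    using quad_form_times_solution(1)[OF cd ends \<eta> c\<eta>(2)] by simp
  have "\<kappa> / 2 * integral {c + H..c + 2 * H} ?W = integral {c + H..c + 2 * H} (\<lambda>x. \<kappa> / 2 * ?W x)" by simp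
  also have "\<dots> \<le> integral {c..d} (\<lambda>x. (dw x * \<eta> x + w x * \<eta>' x)\<^sup>2 + V x * (w x * \<eta> x)\<^sup>2)"
  proof -
    let ?F = "\<lambda>x. (dw x * \<eta> x + w x * \<eta>' x)\<^sup>2 + V x * (w x * \<eta> x)\<^sup>2"
    have F0: "0 \<le> V x * (w x * \<eta> x)\<^sup>2" for x using V[of x] \<kappa> by simp
    have Fi: "?F integrable_on {c..d}"
      by (intro integrable_add V_int integrable_continuous_real continuous_intros cw cdw c\<eta>)
    have Fi': "?F integrable_on {c + H..c + 2 * H}"
      by (rule integrable_on_subinterval[OF Fi]) (use H in \<open>auto simp: d_def\<close>)
    have "integral {c + H..c + 2 * H} (\<lambda>x. \<kappa> / 2 * ?W x) \<le> integral {c + H..c + 2 * H} ?F"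
    proof (rule integral_le[OF integrable_on_mult_right[OF Wi] Fi'])
      fix x assume x: "x \<in> {c + H..c + 2 * H}"
      have "0 \<le> (x - c - H) * (c + 2 * H - x)" using x by (intro mult_nonneg_nonneg) auto
      also have "\<dots> = (x - c) * (d - x) - 2 * H\<^sup>2" by (simp add: d_def algebra_simps power2_eq_square)
      finally have "1 \<le> \<eta> x" using H by (simp add: \<eta>_def field_simps)
      then have "1\<^sup>2 \<le> (\<eta> x)\<^sup>2" by (intro power_mono) auto
      then have "?W x * 1 \<le> ?W x * (\<eta> x)\<^sup>2" by (intro mult_left_mono) auto
      then have "\<kappa> / 2 * ?W x \<le> V x * (w x * \<eta> x)\<^sup>2"
        using V[of x] \<kappa> by (intro mult_mono) (auto simp: power_mult_distrib)
      then show "\<kappa> / 2 * ?W x \<le> ?F x" by (simp add: add_increasing)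
    qed (use H in \<open>auto simp: d_def\<close>)
    also have "\<dots> \<le> integral {c..d} ?F"
      by (rule integral_subset_le[OF _ Fi' Fi]) (use H F0 in \<open>auto simp: d_def\<close>)
    finally show ?thesis .
  qed
  also have "\<dots> = ?A + ?B" by (rule quad_form_times_solution(2)[OF cd ends \<eta> c\<eta>(2)])
  finally have 1: "\<kappa> / 2 * integral {c + H..c + 2 * H} ?W \<le> ?A + ?B" .
  have "?A \<le> integral {c..d} (\<lambda>x. 9 / (4 * H\<^sup>2) * ?W x)"
  proof (rule integral_le[OF _ integrable_on_mult_right[OF Wi]])
    fix x assume x: "x \<in> {c..d}"
    have "\<bar>\<eta>' x\<bar> \<le> 3 * H / (2 * H\<^sup>2)" unfolding \<eta>'_def abs_divide
      using x H(1) by (intro frac_le) (auto simp: d_def)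
    also have "\<dots> = 3 / (2 * H)" using H by (simp add: power2_eq_square)
    finally have "\<bar>\<eta>' x\<bar>\<^sup>2 \<le> (3 / (2 * H))\<^sup>2" by (intro power_mono) auto
    then have "(\<eta>' x)\<^sup>2 \<le> 9 / (4 * H\<^sup>2)" by (simp add: power_divide power_mult_distrib)
    then have "(\<eta>' x)\<^sup>2 * ?W x \<le> 9 / (4 * H\<^sup>2) * ?W x" by (rule mult_right_mono) simp
    then show "(w x * \<eta>' x)\<^sup>2 \<le> 9 / (4 * H\<^sup>2) * ?W x" by (simp add: power_mult_distrib mult.commute)
  qed (use H in \<open>auto intro!: integrable_continuous_real continuous_intros cw c\<eta>\<close>)
  also have "\<dots> = 9 / (4 * H\<^sup>2) * integral {c..d} ?W" by simp
  finally have A: "?A \<le> 9 / (4 * H\<^sup>2) * integral {c..d} ?W" .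
  have "?B \<le> ?A / (p - 2)" using B p by (simp add: field_simps)
  then have "\<kappa> / 2 * integral {c + H..c + 2 * H} ?W \<le> ?A + ?A / (p - 2)" using 1 by linarith
  also have "\<dots> = (p - 1) / (p - 2) * ?A" using p by (simp add: field_simps)
  also have "\<dots> \<le> (p - 1) / (p - 2) * (9 / (4 * H\<^sup>2) * integral {c..d} ?W)"
    using p by (intro mult_left_mono A) auto
  also have "\<dots> = (27 * (p - 1) / (p - 2)) * (integral {c..d} ?W / (12 * H\<^sup>2))"
    using p H(1) by (simp add: divide_simps)
  also have "\<dots> \<le> (\<kappa> * H\<^sup>2) * (integral {c..d} ?W / (12 * H\<^sup>2))"
    using H(2) Henstock_Kurzweil_Integration.integral_nonneg[OF Wi, of c d] by (intro mult_right_mono) auto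
  also have "\<dots> = \<kappa> / 2 * (integral {c..d} ?W / 6)" using H by (simp add: field_simps)
  finally show ?thesis using \<kappa> unfolding d_def by simp
qed

text \<open>Cells that are the middle of a stable triple are absorbed by their neighbours. Only the
  two end cells and the middles of unstable triples remain; on these the pointwise bound gives at
  most \<open>M\<^sup>2 * H\<close>.\<close>

lemma square_integral_cells:
  assumes n: "n > 0" and H: "0 < H" "27 * (p - 1) / (p - 2) \<le> \<kappa> * H\<^sup>2" "real n * H = b - a"
    and \<kappa>: "0 < \<kappa>" and V: "\<And>x. \<kappa> / 2 \<le> V x"
    and M: "\<And>x. x \<in> {a..b} \<Longrightarrow> \<bar>w x\<bar> \<le> M" and m: "\<not> disjoint_unstable p V r w m a b"
  shows "integral {a..b} (\<lambda>x. (w x)\<^sup>2) \<le> 2 * real (3 * m + 2) * (M\<^sup>2 * H)"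
proof -
  let ?W = "\<lambda>x. (w x)\<^sup>2"
  have Wi: "?W integrable_on {x..y}" if "a \<le> x" "y \<le> b" for x y
    by (rule integrable_continuous_real) (use that w_cont' in \<open>auto intro!: continuous_intros\<close>)
  define t where "t = (\<lambda>i. a + real i * H)"
  have tSuc: "t (Suc i) = t i + H" for i by (simp add: t_def algebra_simps)
  have t_ge: "a \<le> t i" for i using H by (simp add: t_def)
  have t_le: "t i \<le> b" if "i \<le> n" for i
  proof -
    have "real i * H \<le> real n * H" using that H by (intro mult_right_mono) auto
    then show ?thesis using H(3) by (simp add: t_def)
  qed
  have tn: "t n = b" using H(3) by (simp add: t_def)
  define S where "S = (\<lambda>i. integral {t i..t (Suc i)} ?W)"
  have total: "integral {a..t k} ?W = (\<Sum>i<k. S i)" if "k \<le> n" for k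
    using that
  proof (induction k)
    case (Suc k)
    have "integral {a..t (Suc k)} ?W = integral {a..t k} ?W + S k"
      unfolding S_def using H t_ge[of k] tSuc[of k] Suc.prems t_le[of "Suc k"]
      by (intro Henstock_Kurzweil_Integration.integral_combine[symmetric] Wi) auto
    then show ?case using Suc by simp
  qed (simp add: t_def)
  define I where "I = {i. 1 \<le> i \<and> Suc i < n \<and> unstable_on p V r w (t (i - 1)) (t (i - 1) + 3 * H)}"
  have cardI: "card I \<le> 3 * m"
  proof -
    \<comment> \<open>Triples overlap, but those whose middle indices agree modulo 3 do not, so each
      residue class is limited by the unstable intervals that fit.\<close>
    have each: "card {i \<in> I. i mod 3 = j} \<le> m" for j
    proof (rule ccontr)
      let ?J = "{i \<in> I. i mod 3 = j}"
      assume "\<not> ?thesis"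
      then have mJ: "m \<le> card ?J" by simp
      have finJ: "finite ?J" by (rule finite_subset[of _ "{..<n}"]) (auto simp: I_def)
      have "disjoint_unstable p V r w (card ?J) a b"
      proof (rule disjoint_unstable_family[OF finJ, where c = "\<lambda>i. t (i - 1)" and d = "\<lambda>i. t (i - 1) + 3 * H"])
        fix i assume i: "i \<in> ?J"
        then have "t (i - 1) + 3 * H = t (i + 2)" "i + 2 \<le> n"
          by (auto simp: I_def t_def of_nat_diff algebra_simps)
        then show "a \<le> t (i - 1) \<and> t (i - 1) + 3 * H \<le> b \<and>
            unstable_on p V r w (t (i - 1)) (t (i - 1) + 3 * H)"
          using i t_ge t_le[of "i + 2"] by (auto simp: I_def)
      next
        fix i k assume ik: "i \<in> ?J" "k \<in> ?J" "i \<noteq> k"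
        have sep: "t (x - 1) + 3 * H \<le> t (y - 1)" if "1 \<le> x" "x + 3 \<le> y" for x y
        proof -
          have "real (x - 1) + 3 \<le> real (y - 1)" using that by linarith
          then have "(real (x - 1) + 3) * H \<le> real (y - 1) * H" using H by (intro mult_right_mono) auto
          then show ?thesis by (simp add: t_def algebra_simps)
        qed
        have "i mod 3 = k mod 3" using ik by simp
        then have "i + 3 \<le> k \<or> k + 3 \<le> i" using ik(3) by presburger
        then show "t (i - 1) + 3 * H \<le> t (k - 1) \<or> t (k - 1) + 3 * H \<le> t (i - 1)"
          using sep[of i k] sep[of k i] ik(1,2) unfolding I_def by blast
      qed
      then show False using m disjoint_unstable_mono[OF _ order_refl order_refl mJ] by blast
    qed
    have "I \<subseteq> {i \<in> I. i mod 3 = 0} \<union> {i \<in> I. i mod 3 = 1} \<union> {i \<in> I. i mod 3 = 2}" by auto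
    moreover have finI: "finite I" by (rule finite_subset[of _ "{..<n}"]) (auto simp: I_def)
    ultimately have "card I \<le> card ({i \<in> I. i mod 3 = 0} \<union> {i \<in> I. i mod 3 = 1} \<union> {i \<in> I. i mod 3 = 2})"
      by (intro card_mono) auto
    also have "\<dots> \<le> card {i \<in> I. i mod 3 = 0} + card {i \<in> I. i mod 3 = 1} + card {i \<in> I. i mod 3 = 2}"
      by (intro order_trans[OF card_Un_le] add_right_mono card_Un_le)
    also have "\<dots> \<le> m + m + m" by (intro add_mono each)
    finally show ?thesis by simp
  qed
  \<comment> \<open>The first and the last cell have a neighbour on one side only and are counted as
    bad; when \<open>n = 1\<close> they coincide.\<close>
  have cardB: "card ({0, n - 1} \<union> I) \<le> 3 * m + 2"
    using card_Un_le[of "{0, n - 1}" I] cardI card_insert_le_m1[of 2 "{n - 1}" 0] by auto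
  have "(\<Sum>i<n. S i) \<le> 2 * real (3 * m + 2) * (M\<^sup>2 * H)"
  proof (rule sum_le_of_local_averages[OF _ _ _ _ cardB])
    fix i assume i: "i < n"
    have ti: "a \<le> t i" "t (Suc i) \<le> b" "t i \<le> t (Suc i)" using t_ge t_le[of "Suc i"] i H tSuc[of i] by auto
    show "0 \<le> S i" unfolding S_def by (rule Henstock_Kurzweil_Integration.integral_nonneg[OF Wi]) (use ti in auto)
    have "S i \<le> integral {t i..t (Suc i)} (\<lambda>x. M\<^sup>2)"
      unfolding S_def
    proof (rule integral_le[OF Wi])
      fix x assume "x \<in> {t i..t (Suc i)}"
      then have "\<bar>w x\<bar> \<le> M" using M ti by auto
      then show "(w x)\<^sup>2 \<le> M\<^sup>2" using power_mono[of "\<bar>w x\<bar>" M 2] by simp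
    qed (use ti in auto)
    also have "\<dots> = M\<^sup>2 * H" using ti tSuc[of i] H by simp
    finally show "S i \<le> M\<^sup>2 * H" .
    assume nb: "i \<notin> {0, n - 1} \<union> I"
    then have i': "1 \<le> i" "Suc i < n" using i by auto
    then have stable: "\<not> unstable_on p V r w (t (i - 1)) (t (i - 1) + 3 * H)" using nb by (auto simp: I_def)
    have eqs: "t i = t (i - 1) + H" "t (Suc i) = t (i - 1) + 2 * H" "t (Suc (Suc i)) = t (i - 1) + 3 * H"
      using tSuc[of "i - 1"] i'(1) tSuc[of i] tSuc[of "Suc i"] by auto
    have Sm: "S (i - 1) = integral {t (i - 1)..t i} ?W" using i'(1) by (simp add: S_def)
    have le: "t (Suc (Suc i)) \<le> b" using t_le i' by auto
    have "S i \<le> integral {t (i - 1)..t (i - 1) + 3 * H} ?W / 6"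
      using stable_triple[OF H(1,2) \<kappa> V t_ge _ stable] le eqs by (simp add: S_def)
    also have "integral {t (i - 1)..t (i - 1) + 3 * H} ?W = S (i - 1) + S i + S (Suc i)"
    proof -
      have "S (i - 1) + S i = integral {t (i - 1)..t (Suc i)} ?W"
        unfolding Sm unfolding S_def using eqs H le t_ge[of "i - 1"]
        by (intro Henstock_Kurzweil_Integration.integral_combine Wi) auto
      moreover have "integral {t (i - 1)..t (Suc i)} ?W + S (Suc i) = integral {t (i - 1)..t (Suc (Suc i))} ?W"
        unfolding S_def using eqs H le t_ge[of "i - 1"]
        by (intro Henstock_Kurzweil_Integration.integral_combine Wi) auto
      ultimately show ?thesis using eqs(3) by simp
    qed
    finally show "1 \<le> i \<and> Suc i < n \<and> S i \<le> (S (i - 1) + S i + S (Suc i)) / 6" using i' by simp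
  qed (use H n in \<open>auto simp: I_def\<close>)
  then show ?thesis using total[of n] tn by simp
qed

lemma sup_bound:
  assumes h: "0 < h" "h\<^sup>2 * K \<le> 1 / 2" "h \<le> b - a" and m: "m > 0"
    and k: "\<not> disjoint_unstable p V r w m a b" and x: "x \<in> {a..b}"
  shows "\<bar>w x\<bar> \<le> window_const p \<rho>\<^sub>0 R m * h powr (- 2 / (p - 2))"
  \<comment> \<open>Near the right end the window is pushed to the left so that it stays inside the
    interval.\<close>
  by (rule window_bound[OF h(1,2) _ _ m k, of "min x (b - h)"]) (use x h in auto)

end

text \<open>The bound \<open>2 * (3 * m + 2) * M\<^sup>2 * H\<close> without its power of \<kappa>:
  cells have length at most twice \<open>sqrt (27 * (p - 1) / (p - 2)) / sqrt \<kappa>\<close>, and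
  the factor \<open>2 powr (2 / (p - 2))\<close> in \<open>M\<close> comes from the window length
  \<open>1 / (2 * sqrt \<kappa>)\<close>.\<close>

definition mass_const :: "real \<Rightarrow> real \<Rightarrow> real \<Rightarrow> nat \<Rightarrow> real" where
  "mass_const p \<rho>\<^sub>0 R m = 4 * real (3 * m + 2) * sqrt (27 * (p - 1) / (p - 2)) *
     (window_const p \<rho>\<^sub>0 R m * 2 powr (2 / (p - 2)))\<^sup>2"

context edge_solution
begin

text \<open>Windows and cells both have length of order \<open>\<kappa> powr (- 1 / 2)\<close>. The
  sup bound is then of order \<open>\<kappa> powr (1 / (p - 2))\<close>; its square times a cell
  length gives the exponent \<open>2 / (p - 2) - 1 / 2\<close>.\<close>

lemma square_integral_bound:
  assumes \<kappa>: "0 < \<kappa>" and V: "\<And>x. \<kappa> / 2 \<le> V x" and K: "K \<le> 2 * \<kappa>"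
    and len: "sqrt (27 * (p - 1) / (p - 2)) \<le> (b - a) * sqrt \<kappa>"
    and m: "m > 0" "\<not> disjoint_unstable p V r w m a b"
  shows "integral {a..b} (\<lambda>x. (w x)\<^sup>2) \<le> mass_const p \<rho>\<^sub>0 R m * \<kappa> powr ((6 - p) / (2 * (p - 2)))"
proof -
  define N where "N = sqrt (27 * (p - 1) / (p - 2))"
  have "1 \<le> 27 * (p - 1) / (p - 2)" using p by (simp add: field_simps)
  then have N1: "1 \<le> N" unfolding N_def by simp
  have N2: "N\<^sup>2 = 27 * (p - 1) / (p - 2)" unfolding N_def using p by simp
  \<comment> \<open>The quotient is at least 1, so rounding it down at most halves it. With
    \<open>n\<close> equal cells, \<open>H * sqrt \<kappa>\<close> thus lies between
    \<open>N\<close> and \<open>2 * N\<close>.\<close>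
  define n where "n = nat \<lfloor>(b - a) * sqrt \<kappa> / N\<rfloor>"
  have q1: "1 \<le> (b - a) * sqrt \<kappa> / N" using len N1 unfolding N_def[symmetric] by simp
  then have n: "n > 0" "real n \<le> (b - a) * sqrt \<kappa> / N" "(b - a) * sqrt \<kappa> / N < real n + 1"
    unfolding n_def by linarith+
  have s\<kappa>: "sqrt \<kappa> > 0" "(sqrt \<kappa>)\<^sup>2 = \<kappa>" using \<kappa> by auto
  have ab: "b - a > 0"
  proof -
    have "0 < (b - a) * sqrt \<kappa>" using len N1 unfolding N_def[symmetric] by linarith
    then show ?thesis using s\<kappa> by (simp add: zero_less_mult_iff)
  qed
  define H where "H = (b - a) / real n"
  have H0: "0 < H" "real n * H = b - a" using ab n by (auto simp: H_def)
  have Hge: "N \<le> H * sqrt \<kappa>"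
    using n N1 unfolding H_def by (simp add: field_simps)
  have Hle: "H * sqrt \<kappa> \<le> 2 * N"
  proof -
    have "(b - a) * sqrt \<kappa> / N \<le> 2 * real n" using n by linarith
    then show ?thesis using n N1 unfolding H_def by (simp add: field_simps)
  qed
  have H2: "27 * (p - 1) / (p - 2) \<le> \<kappa> * H\<^sup>2"
  proof -
    have "N\<^sup>2 \<le> (H * sqrt \<kappa>)\<^sup>2" using Hge N1 by (intro power_mono) auto
    then show ?thesis using N2 s\<kappa> by (simp add: power_mult_distrib mult.commute)
  qed
  \<comment> \<open>Chosen so that
    \<open>h\<^sup>2 * K = K / (4 * \<kappa>) \<le> 1 / 2\<close>.\<close>
  define h where "h = 1 / (2 * sqrt \<kappa>)"
  have h: "0 < h" "h\<^sup>2 = 1 / (4 * \<kappa>)" using s\<kappa> by (auto simp: h_def power_divide power_mult_distrib)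
  have hK: "h\<^sup>2 * K \<le> 1 / 2" unfolding h(2) using K \<kappa> by (simp add: field_simps)
  have hl: "h \<le> b - a"
  proof -
    have "1 \<le> (b - a) * sqrt \<kappa>" using len N1 unfolding N_def[symmetric] by linarith
    then have "1 \<le> (b - a) * (2 * sqrt \<kappa>)" by simp
    then show ?thesis unfolding h_def using s\<kappa> by (simp add: field_simps)
  qed
  let ?Wc = "window_const p \<rho>\<^sub>0 R m" and ?q = "2 / (p - 2)"
  have hp: "h powr (- 2 / (p - 2)) = 2 powr ?q * \<kappa> powr (1 / (p - 2))"
  proof -
    have "h powr (- 2 / (p - 2)) = (2 * sqrt \<kappa>) powr ?q"
      using s\<kappa> by (simp add: h_def powr_minus_divide powr_divide)
    also have "\<dots> = 2 powr ?q * (\<kappa> powr (1 / 2)) powr ?q" using s\<kappa> \<kappa> by (simp add: powr_mult powr_half_sqrt)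
    also have "\<dots> = 2 powr ?q * \<kappa> powr (1 / (p - 2))" by (simp add: powr_powr)
    finally show ?thesis .
  qed
  have M: "\<bar>w x\<bar> \<le> ?Wc * (2 powr ?q * \<kappa> powr (1 / (p - 2)))" if "x \<in> {a..b}" for x
    using sup_bound[OF h(1) hK hl m that] unfolding hp .
  have "integral {a..b} (\<lambda>x. (w x)\<^sup>2) \<le> 2 * real (3 * m + 2) * ((?Wc * (2 powr ?q * \<kappa> powr (1 / (p - 2))))\<^sup>2 * H)"
    by (rule square_integral_cells[OF n(1) H0(1) H2 H0(2) \<kappa> V M m(2)])
  also have "\<dots> \<le> 2 * real (3 * m + 2) * ((?Wc * (2 powr ?q * \<kappa> powr (1 / (p - 2))))\<^sup>2 * (2 * N / sqrt \<kappa>))"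
    using Hle s\<kappa> by (intro mult_left_mono) (auto simp: field_simps)
  also have "\<dots> = 4 * real (3 * m + 2) * N * (?Wc * 2 powr ?q)\<^sup>2 * ((\<kappa> powr (1 / (p - 2)))\<^sup>2 / sqrt \<kappa>)"
    by (simp add: power_mult_distrib)
  also have "(\<kappa> powr (1 / (p - 2)))\<^sup>2 / sqrt \<kappa> = \<kappa> powr ((6 - p) / (2 * (p - 2)))"
  proof -
    have "(\<kappa> powr (1 / (p - 2)))\<^sup>2 = \<kappa> powr (2 / (p - 2))" using \<kappa> by (simp add: powr_power)
    moreover have "sqrt \<kappa> = \<kappa> powr (1 / 2)" using \<kappa> by (simp add: powr_half_sqrt)
    moreover have "2 / (p - 2) - 1 / 2 = (6 - p) / (2 * (p - 2))" using p by (simp add: field_simps)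
    ultimately show ?thesis by (simp flip: powr_diff)
  qed
  finally show ?thesis by (simp add: mass_const_def N_def)
qed

end


section \<open>Regularity of weak solutions\<close>

lemma DERIV_square_pos_part:
  "((\<lambda>s :: real. (max 0 s)\<^sup>2) has_real_derivative 2 * max 0 s) (at s)"
proof -
  consider "s > 0" | "s < 0" | "s = 0" by linarith
  then show ?thesis
  proof cases
    case 1
    have "((\<lambda>s. s\<^sup>2) has_real_derivative 2 * max 0 s) (at s)"
      using 1 by (auto intro!: derivative_eq_intros)
    moreover have "\<forall>\<^sub>F x in nhds s. (max 0 x)\<^sup>2 = x\<^sup>2"
      using 1 by (auto simp: eventually_nhds intro!: exI[of _ "{0<..}"])
    ultimately show ?thesis by (subst DERIV_cong_ev[OF refl _ refl])
  next
    case 2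
    have "((\<lambda>s. 0) has_real_derivative 2 * max 0 s) (at s)" using 2 by simp
    moreover have "\<forall>\<^sub>F x in nhds s. (max 0 x)\<^sup>2 = 0"
      using 2 by (auto simp: eventually_nhds intro!: exI[of _ "{..<0}"])
    ultimately show ?thesis by (subst DERIV_cong_ev[OF refl _ refl])
  next
    case 3
    have "((\<lambda>y. (max 0 y)\<^sup>2 / y) \<longlongrightarrow> 0) (at (0 :: real))"
    proof (rule Lim_null_comparison)
      show "\<forall>\<^sub>F y in at 0. norm ((max 0 y)\<^sup>2 / y) \<le> \<bar>y :: real\<bar>"
        by (rule always_eventually) (auto simp: max_def power2_eq_square)
      show "((\<lambda>y. \<bar>y\<bar>) \<longlongrightarrow> 0) (at (0 :: real))" by (intro tendsto_rabs_zero tendsto_ident_at)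
    qed
    then show ?thesis using 3 by (simp add: has_field_derivative_iff)
  qed
qed

text \<open>Of the form \<open>q / (1 + q)\<close> with \<open>q\<close> a large multiple of a
  squared positive part: the square makes it C1, the quotient keeps it in the unit interval, and as
  \<open>k\<close> grows it tends to the indicator of the open interval from \<open>x\<close> to
  \<open>y\<close>.\<close>

definition bump :: "nat \<Rightarrow> real \<Rightarrow> real \<Rightarrow> real \<Rightarrow> real" where
  "bump k x y t = real k * (max 0 ((t - x) * (y - t)))\<^sup>2 / (1 + real k * (max 0 ((t - x) * (y - t)))\<^sup>2)"

lemma C1_compact_supportI:
  assumes "\<And>x. (\<phi> has_real_derivative D x) (at x)" "continuous_on UNIV D"
    and "\<And>x. x \<notin> {a..b} \<Longrightarrow> \<phi> x = 0"
  shows "\<phi> \<in> C1_compact_support {a..b}"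
proof -
  have sub: "closure {x. \<phi> x \<noteq> 0} \<subseteq> {a..b}"
  proof (rule closure_minimal)
    show "{x. \<phi> x \<noteq> 0} \<subseteq> {a..b}" using assms(3) by blast
  qed simp
  moreover from this have "compact (closure {x. \<phi> x \<noteq> 0})"
    by (meson bounded_closed_interval bounded_subset closed_closure compact_eq_bounded_closed)
  moreover have "\<phi> C1_differentiable_on UNIV"
    unfolding C1_differentiable_on_def
    using assms(1,2) by (auto simp: has_real_derivative_iff_has_vector_derivative)
  ultimately show ?thesis by (simp add: C1_compact_support_def)
qed

lemma C1_compact_supportD:
  assumes "\<phi> \<in> C1_compact_support J"
  shows "(\<phi> has_real_derivative deriv \<phi> x) (at x)" "continuous_on UNIV (deriv \<phi>)" "continuous_on UNIV \<phi>"
    "x \<notin> J \<Longrightarrow> \<phi> x = 0"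
proof -
  obtain D where D: "\<And>x. (\<phi> has_real_derivative D x) (at x)" "continuous_on UNIV D"
    using assms by (auto simp: C1_compact_support_def C1_differentiable_on_def
        has_real_derivative_iff_has_vector_derivative)
  have "deriv \<phi> = D" by (rule ext) (rule DERIV_imp_deriv[OF D(1)])
  then show "(\<phi> has_real_derivative deriv \<phi> x) (at x)" "continuous_on UNIV (deriv \<phi>)"
    using D by auto
  show "continuous_on UNIV \<phi>" by (rule continuous_at_imp_continuous_on) (use D(1) DERIV_isCont in blast)
  have "closure {x. \<phi> x \<noteq> 0} \<subseteq> J" using assms by (simp add: C1_compact_support_def)
  then have "{x. \<phi> x \<noteq> 0} \<subseteq> J" using closure_subset by (rule order_trans[rotated])
  then show "\<phi> x = 0" if "x \<notin> J" using that by blast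
qed

lemma C1_compact_support_deriv_outside:
  assumes "\<phi> \<in> C1_compact_support {a..b}" "x \<notin> {a..b}"
  shows "deriv \<phi> x = 0"
proof -
  have "open (- {a..b})" "x \<in> - {a..b}" using assms(2) by auto
  then have "\<forall>\<^sub>F y in nhds x. \<phi> y = 0"
    unfolding eventually_nhds using C1_compact_supportD(4)[OF assms(1)] by (intro exI[of _ "- {a..b}"]) auto
  then have "(\<phi> has_real_derivative 0) (at x)" by (subst DERIV_cong_ev[of x x \<phi> "\<lambda>_. 0"]) auto
  then show ?thesis by (rule DERIV_imp_deriv)
qed

lemma C1_compact_support_mono: "J \<subseteq> J' \<Longrightarrow> C1_compact_support J \<subseteq> C1_compact_support J'"
  by (auto simp: C1_compact_support_def)

lemma C1_compact_support_Icc_ends: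
  assumes "\<phi> \<in> C1_compact_support {a..b}"
  shows "\<phi> a = 0" "\<phi> b = 0"
proof -
  have c: "isCont \<phi> x" for x
    using C1_compact_supportD(3)[OF assms] by (simp add: continuous_on_eq_continuous_at)
  have z: "x \<notin> {a..b} \<Longrightarrow> \<phi> x = 0" for x using C1_compact_supportD(4)[OF assms] .
  have "((\<lambda>x. 0) \<longlongrightarrow> \<phi> a) (at_left a)"
    by (rule Lim_transform_eventually[of \<phi>])
      (use c[of a] z in \<open>auto simp: isCont_def filterlim_at_split eventually_at_left_field intro!: exI[of _ "a - 1"]\<close>)
  then show "\<phi> a = 0" by (simp add: tendsto_const_iff)
  have "((\<lambda>x. 0) \<longlongrightarrow> \<phi> b) (at_right b)"
    by (rule Lim_transform_eventually[of \<phi>])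
      (use c[of b] z in \<open>auto simp: isCont_def filterlim_at_split eventually_at_right_field intro!: exI[of _ "b + 1"]\<close>)
  then show "\<phi> b = 0" by (simp add: tendsto_const_iff)
qed

lemma bump_C1: 
  assumes "a \<le> x" "x \<le> y" "y \<le> b"
  shows "bump k x y \<in> C1_compact_support {a..b}"
proof (rule C1_compact_supportI)
  let ?s = "\<lambda>t. (t - x) * (y - t)"
  let ?\<sigma> = "\<lambda>t. (max 0 (?s t))\<^sup>2" and ?\<sigma>' = "\<lambda>t. 2 * max 0 (?s t) * (x + y - 2 * t)"
  have pos: "0 < 1 + real k * ?\<sigma> t" for t by (intro add_pos_nonneg mult_nonneg_nonneg) auto
  let ?D = "\<lambda>t. (real k * ?\<sigma>' t) / (1 + real k * ?\<sigma> t)\<^sup>2"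
  show "(bump k x y has_real_derivative ?D t) (at t)" for t
  proof -
    have "(?s has_real_derivative (x + y - 2 * t)) (at t)"
      by (auto intro!: derivative_eq_intros)
    from DERIV_chain2[OF DERIV_square_pos_part this]
    have \<sigma>: "(?\<sigma> has_real_derivative ?\<sigma>' t) (at t)" .
    have "(bump k x y has_real_derivative ((real k * ?\<sigma>' t) * (1 + real k * ?\<sigma> t) -
        (real k * ?\<sigma> t) * (0 + real k * ?\<sigma>' t)) / ((1 + real k * ?\<sigma> t) * (1 + real k * ?\<sigma> t))) (at t)"
      unfolding bump_def
      by (intro DERIV_divide DERIV_add DERIV_const DERIV_cmult \<sigma>) (use pos[of t] in auto)
    then show ?thesis by (rule DERIV_cong) (simp add: power2_eq_square algebra_simps)
  qed
  show "continuous_on UNIV ?D"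
    using pos by (intro continuous_intros) (auto simp: less_le)
  fix t assume "t \<notin> {a..b}"
  then have "t < x \<or> y < t" using assms by auto
  then have "?s t \<le> 0" using assms by (auto simp: mult_le_0_iff)
  then show "bump k x y t = 0" by (simp add: bump_def max_def)
qed

lemma bump_bounds: "0 \<le> bump k x y t" "bump k x y t \<le> 1"
proof -
  have "0 \<le> q / (1 + q) \<and> q / (1 + q) \<le> 1" if "0 \<le> q" for q :: real
    using that by (auto simp: divide_simps)
  from this[of "real k * (max 0 ((t - x) * (y - t)))\<^sup>2"]
  show "0 \<le> bump k x y t" "bump k x y t \<le> 1" unfolding bump_def by auto
qed

lemma bump_tendsto:
  "(\<lambda>k. bump k x y t) \<longlonglongrightarrow> indicator {x<..<y} t" if "x < y"
proof (cases "t \<in> {x<..<y}")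
  case True
  define c where "c = (max 0 ((t - x) * (y - t)))\<^sup>2"
  have "(t - x) * (y - t) > 0" using True by simp
  then have c: "c > 0" unfolding c_def by (intro zero_less_power) linarith
  have "(\<lambda>k. real k * c / (1 + real k * c)) \<longlonglongrightarrow> 1"
    using c by real_asymp
  then show ?thesis using True by (simp add: bump_def c_def)
next
  case False
  then have "t \<le> x \<or> y \<le> t" by auto
  then have "(t - x) * (y - t) \<le> 0" using that by (auto simp: mult_le_0_iff)
  then show ?thesis using False by (simp add: bump_def max_def)
qed

text \<open>The fundamental lemma of the calculus of variations. Letting bumps tend to indicators
  shows that \<open>g\<close> integrates to zero over every subinterval; Lebesgue differentiation
  then gives \<open>g = 0\<close> almost everywhere.\<close>

lemma negligible_nonzero_if_orthogonal_C1:
  fixes g :: "real \<Rightarrow> real"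
  assumes g: "g absolutely_integrable_on {a..b}"
    and orth: "\<And>\<psi>. \<psi> \<in> C1_compact_support {a..b} \<Longrightarrow> integral {a..b} (\<lambda>t. g t * \<psi> t) = 0"
  shows "\<exists>N. negligible N \<and> (\<forall>t\<in>{a..b} - N. g t = 0)"
proof -
  note mult_int = integrable_times_continuous_UNIV[OF g]
  have zero: "integral {x..y} g = 0" if xy: "a \<le> x" "x < y" "y \<le> b" for x y
  proof -
    have sub: "{x..y} \<subseteq> {a..b}" using xy by auto
    note C = bump_C1[OF xy(1) less_imp_le[OF xy(2)] xy(3)]
    have int: "(\<lambda>t. g t * bump k x y t) integrable_on {a..b}" for k
      by (rule mult_int[OF C1_compact_supportD(3)[OF C]])
    have habs: "(\<lambda>t. \<bar>g t\<bar>) integrable_on {a..b}" using g by (simp add: absolutely_integrable_on_def)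
    have "(\<lambda>k. integral {a..b} (\<lambda>t. g t * bump k x y t)) \<longlonglongrightarrow>
        integral {a..b} (\<lambda>t. g t * indicator {x<..<y} t)"
    proof (rule dominated_convergence(2)[OF int habs])
      fix k t
      have "\<bar>g t\<bar> * \<bar>bump k x y t\<bar> \<le> \<bar>g t\<bar> * 1"
        by (intro mult_left_mono) (use bump_bounds[of k x y t] in auto)
      then show "norm (g t * bump k x y t) \<le> \<bar>g t\<bar>" by (simp add: abs_mult)
    qed (intro tendsto_mult tendsto_const bump_tendsto xy)
    then have "integral {a..b} (\<lambda>t. g t * indicator {x<..<y} t) = 0"
      using orth[OF C] by (simp add: LIMSEQ_const_iff)
    moreover have "integral {a..b} (\<lambda>t. g t * indicator {x<..<y} t) = integral {x<..<y} g"
    proof -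
      have "integral {a..b} (\<lambda>t. g t * indicator {x<..<y} t) =
          integral {a..b} (\<lambda>t. if t \<in> {x<..<y} then g t else 0)"
        by (intro arg_cong2[where f = integral]) (auto simp: fun_eq_iff)
      also have "\<dots> = integral ({x<..<y} \<inter> {a..b}) g" by (rule integral_restrict_Int)
      also have "{x<..<y} \<inter> {a..b} = {x<..<y}" using sub by auto
      finally show ?thesis .
    qed
    ultimately show ?thesis by (simp add: integral_open_interval_real)
  qed
  \<comment> \<open>Extension by zero, because the differentiation theorem used below is about
    functions integrable on all intervals of the line.\<close>
  define F where "F = (\<lambda>t. if t \<in> {a..b} then g t else 0)"
  have F0: "integral {x..y} F = 0" for x y
  proof -
    have "integral {x..y} F = integral ({a..b} \<inter> {x..y}) g"
      unfolding F_def by (rule integral_restrict_Int)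
    also have "{a..b} \<inter> {x..y} = {max a x..min b y}" by auto
    also have "integral {max a x..min b y} g = 0"
    proof (cases "max a x < min b y")
      case True then show ?thesis by (intro zero) auto
    next
      case False
      then show ?thesis by (cases "max a x = min b y") auto
    qed
    finally show ?thesis .
  qed
  have Fint: "F integrable_on cbox x y" for x y
  proof -
    have "g integrable_on {max a x..min b y}"
      by (rule integrable_on_subinterval[of g "{a..b}"]) (use g in \<open>auto simp: absolutely_integrable_on_def\<close>)
    moreover have "{a..b} \<inter> {x..y} = {max a x..min b y}" by auto
    ultimately have "g integrable_on ({a..b} \<inter> {x..y})" by simp
    then show ?thesis unfolding F_def cbox_interval by (rule iffD2[OF integrable_restrict_Int])
  qed
  \<comment> \<open>Lebesgue differentiation: outside \<open>N\<close> the averages over small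
    intervals to the right of \<open>x\<close> approximate \<open>F x\<close>, and all of them are
    zero.\<close>
  obtain N where N: "negligible N" "\<And>x e. \<lbrakk>x \<notin> N; 0 < e\<rbrakk> \<Longrightarrow>
      \<exists>d>0. \<forall>h. 0 < h \<and> h < d \<longrightarrow>
        norm (integral (cbox x (x + h *\<^sub>R One)) F /\<^sub>R h ^ DIM(real) - F x) < e"
    using integrable_ccontinuous_explicit[OF Fint] by metis
  have Fz: "F x = 0" if "x \<notin> N" for x
  proof (rule ccontr)
    assume "F x \<noteq> 0"
    then have "0 < \<bar>F x\<bar>" by simp
    from N(2)[OF \<open>x \<notin> N\<close> this] obtain d where d: "d > 0" "\<And>h. 0 < h \<and> h < d \<Longrightarrow>
        norm (integral (cbox x (x + h *\<^sub>R One)) F /\<^sub>R h ^ DIM(real) - F x) < \<bar>F x\<bar>" by blast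
    from d(2)[of "d / 2"] d(1) show False using F0 by simp
  qed
  have "g t = 0" if "t \<in> {a..b} - N" for t
    using Fz[of t] that by (simp add: F_def)
  then show ?thesis using N(1) by blast
qed

text \<open>The lemma of du Bois-Reymond. Subtracting a multiple of the fixed bump \<theta> gives
  any test function mean zero; its primitive is then an admissible test function, so
  \<open>h\<close> minus its \<theta>-weighted mean is orthogonal to everything.\<close>

lemma negligible_nonconst_if_orthogonal_deriv:
  fixes h :: "real \<Rightarrow> real"
  assumes ab: "a < b" and h: "h absolutely_integrable_on {a..b}"
    and orth: "\<And>\<phi>. \<phi> \<in> C1_compact_support {a..b} \<Longrightarrow> integral {a..b} (\<lambda>t. h t * deriv \<phi> t) = 0"
  shows "\<exists>k N. negligible N \<and> (\<forall>t\<in>{a..b} - N. h t = k)"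
proof -
  define \<theta> where "\<theta> = bump 1 a b"
  have \<theta>C: "\<theta> \<in> C1_compact_support {a..b}" unfolding \<theta>_def by (rule bump_C1) (use ab in auto)
  note \<theta> = C1_compact_supportD[OF \<theta>C]
  note mult_int = integrable_times_continuous_UNIV[OF h]
  have cont_int: "\<psi> integrable_on {x..y}" if "continuous_on UNIV \<psi>" for \<psi> :: "real \<Rightarrow> real" and x y
    using that continuous_on_subset integrable_continuous_real by blast
  define c where "c = integral {a..b} \<theta>"
  have "c \<noteq> 0"
  proof
    assume "c = 0"
    moreover have "(a + b) / 2 \<in> {a..b}" using ab by auto
    moreover have "continuous_on {a..b} \<theta>" using \<theta>(3) continuous_on_subset by blast
    ultimately have "\<theta> ((a + b) / 2) = 0"
      using integral_eq_0_iff[of a b \<theta>] ab bump_bounds(1) unfolding c_def \<theta>_def by auto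
    moreover have "((a + b) / 2 - a) * (b - (a + b) / 2) > 0" using ab by (intro mult_pos_pos) auto
    moreover from this have "bump 1 a b ((a + b) / 2) > 0"
      unfolding bump_def by (intro divide_pos_pos add_pos_nonneg) (auto simp del: mult_pos_pos)
    ultimately show False by (simp add: \<theta>_def)
  qed
  define k where "k = integral {a..b} (\<lambda>t. h t * \<theta> t) / c"
  have "\<exists>N. negligible N \<and> (\<forall>t\<in>{a..b} - N. h t - k = 0)"
  proof (rule negligible_nonzero_if_orthogonal_C1)
    show "(\<lambda>t. h t - k) absolutely_integrable_on {a..b}"
      by (intro set_integral_diff h) (auto intro: absolutely_integrable_continuous_real)
    fix \<psi> assume \<psi>C: "\<psi> \<in> C1_compact_support {a..b}"
    note \<psi> = C1_compact_supportD[OF \<psi>C]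
    define m where "m = integral {a..b} \<psi> / c"
    define \<omega> where "\<omega> = (\<lambda>t. \<psi> t - m * \<theta> t)"
    have \<omega>c: "continuous_on UNIV \<omega>" unfolding \<omega>_def by (intro continuous_intros \<psi> \<theta>)
    have \<omega>0: "\<omega> t = 0" if "t \<notin> {a..b}" for t using \<psi>(4)[OF that] \<theta>(4)[OF that] by (simp add: \<omega>_def)
    have \<omega>int: "integral {a..b} \<omega> = 0"
    proof -
      have "integral {a..b} \<omega> = integral {a..b} \<psi> - integral {a..b} (\<lambda>t. m * \<theta> t)"
        unfolding \<omega>_def by (intro Henstock_Kurzweil_Integration.integral_diff cont_int continuous_intros \<psi> \<theta>)
      also have "integral {a..b} (\<lambda>t. m * \<theta> t) = m * c" by (simp add: c_def)
      finally show ?thesis using \<open>c \<noteq> 0\<close> by (simp add: m_def)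
    qed
    define \<Phi> where "\<Phi> = (\<lambda>t. integral {a..t} \<omega>)"
    have \<Phi>: "(\<Phi> has_real_derivative \<omega> t) (at t)" for t
    proof -
      \<comment> \<open>Starting the integral at \<open>A\<close>, left of both \<open>t\<close> and
        \<open>a\<close>, makes the derivative two-sided at every \<open>t\<close>. The value does
        not change, since \<omega> vanishes outside \<open>{a..b}\<close>.\<close>
      define A B where "A = min a t - 1" and "B = max b t + 1"
      have AB: "A < t" "t < B" "A < a" by (auto simp: A_def B_def)
      have "((\<lambda>s. integral {A..s} \<omega>) has_vector_derivative \<omega> t) (at t within {A..B})"
        by (rule integral_has_vector_derivative) (use AB \<omega>c continuous_on_subset in auto)
      then have "((\<lambda>s. integral {A..s} \<omega>) has_vector_derivative \<omega> t) (at t)"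
        using AB by (simp add: at_within_Icc_at)
      moreover have "integral {A..s} \<omega> = \<Phi> s" if "A < s" for s
      proof (cases "s < a")
        case True
        have "integral {A..s} \<omega> = integral {A..s} (\<lambda>_. 0)"
          by (rule Henstock_Kurzweil_Integration.integral_cong) (use True \<omega>0 in auto)
        then show ?thesis using True by (simp add: \<Phi>_def)
      next
        case False
        have "integral {A..a} \<omega> = integral {A..a} (\<lambda>_. 0)"
          by (rule integral_spike[of "{a}"]) (use \<omega>0 in auto)
        then show ?thesis
          using Henstock_Kurzweil_Integration.integral_combine[of A a s \<omega>] False AB cont_int[OF \<omega>c]
          by (simp add: \<Phi>_def)
      qed
      moreover have "\<forall>\<^sub>F s in nhds t. A < s"
        using AB(1) by (metis eventually_nhds greaterThan_iff open_greaterThan)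
      ultimately show ?thesis
        unfolding has_real_derivative_iff_has_vector_derivative[symmetric]
        by (subst DERIV_cong_ev[of t t \<Phi> "\<lambda>s. integral {A..s} \<omega>"]) (auto elim: eventually_mono)
    qed
    have "\<Phi> t = 0" if "t \<notin> {a..b}" for t
    proof (cases "t < a")
      case False
      then have t: "b < t" using that by auto
      have "integral {b..t} \<omega> = integral {b..t} (\<lambda>_. 0)"
        by (rule integral_spike[of "{b}"]) (use \<omega>0 in auto)
      then show ?thesis
        using Henstock_Kurzweil_Integration.integral_combine[of a b t \<omega>] t ab cont_int[OF \<omega>c] \<omega>int
        by (simp add: \<Phi>_def)
    qed (simp add: \<Phi>_def)
    then have "\<Phi> \<in> C1_compact_support {a..b}" by (intro C1_compact_supportI[OF \<Phi> \<omega>c])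
    from orth[OF this] have "integral {a..b} (\<lambda>t. h t * \<omega> t) = 0"
      using DERIV_imp_deriv[OF \<Phi>] by simp
    moreover have "integral {a..b} (\<lambda>t. h t * \<omega> t) =
        integral {a..b} (\<lambda>t. h t * \<psi> t) - m * integral {a..b} (\<lambda>t. h t * \<theta> t)"
    proof -
      have "integral {a..b} (\<lambda>t. h t * \<psi> t - m * (h t * \<theta> t)) =
        integral {a..b} (\<lambda>t. h t * \<psi> t) - integral {a..b} (\<lambda>t. m * (h t * \<theta> t))"
        by (intro Henstock_Kurzweil_Integration.integral_diff integrable_on_mult_right mult_int \<psi> \<theta>)
      then show ?thesis by (simp add: \<omega>_def algebra_simps)
    qed
    moreover have "integral {a..b} (\<lambda>t. (h t - k) * \<psi> t) =
        integral {a..b} (\<lambda>t. h t * \<psi> t) - k * integral {a..b} \<psi>"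
    proof -
      have "integral {a..b} (\<lambda>t. h t * \<psi> t - k * \<psi> t) =
        integral {a..b} (\<lambda>t. h t * \<psi> t) - integral {a..b} (\<lambda>t. k * \<psi> t)"
        by (intro Henstock_Kurzweil_Integration.integral_diff integrable_on_mult_right mult_int \<psi> cont_int)
      then show ?thesis by (simp add: left_diff_distrib)
    qed
    ultimately show "integral {a..b} (\<lambda>t. (h t - k) * \<psi> t) = 0"
      by (simp add: m_def k_def)
  qed
  then show ?thesis by auto
qed

lemma continuous_zero_off_negligible:
  fixes v :: "real \<Rightarrow> real"
  assumes "continuous_on {a..b} v" "a < b" "negligible N" "\<And>t. t \<in> {a..b} - N \<Longrightarrow> v t = 0" "t \<in> {a..b}"
  shows "v t = 0"
proof -
  have c: "continuous_on {a..b} (\<lambda>t. \<bar>v t\<bar>)" using assms(1) by (intro continuous_intros)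
  have "integral {a..b} (\<lambda>t. \<bar>v t\<bar>) = integral {a..b} (\<lambda>_. 0)"
    by (rule integral_spike[OF assms(3)]) (use assms(4) in auto)
  then have "\<forall>t\<in>{a..b}. \<bar>v t\<bar> = 0" using integral_eq_0_iff[OF c assms(2)] by simp
  then show ?thesis using assms(5) by auto
qed

text \<open>Two applications of the lemma of du Bois-Reymond. The weak equation makes
  \<open>g\<close> equal to a primitive of \<open>f\<close> plus a constant almost everywhere;
  calling this continuous function \<open>dw\<close>, the weak derivative relation makes
  \<open>u\<close> a primitive of \<open>dw\<close> up to a constant, everywhere by continuity.
  Two-sided derivatives result in the open interval only.\<close>

lemma weak_solution_regular:
  fixes u g f :: "real \<Rightarrow> real"
  assumes ab: "a < b" and u: "continuous_on {a..b} u" and g: "g absolutely_integrable_on {a..b}"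
    and f: "f \<in> borel_measurable (lebesgue_on {a..b})" "\<And>x. x \<in> {a..b} \<Longrightarrow> \<bar>f x\<bar> \<le> K"
    and W1: "\<And>\<phi>. \<phi> \<in> C1_compact_support {a..b} \<Longrightarrow>
      integral {a..b} (\<lambda>t. u t * deriv \<phi> t) = - integral {a..b} (\<lambda>t. g t * \<phi> t)"
    and W2: "\<And>\<phi>. \<phi> \<in> C1_compact_support {a..b} \<Longrightarrow>
      integral {a..b} (\<lambda>t. g t * deriv \<phi> t) + integral {a..b} (\<lambda>t. f t * \<phi> t) = 0"
  shows "\<exists>dw N. negligible N \<and> (\<forall>t\<in>{a..b} - N. g t = dw t) \<and>
    (\<forall>x\<in>{a<..<b}. (u has_real_derivative dw x) (at x)) \<and>
    (\<forall>x y. a \<le> x \<longrightarrow> x \<le> y \<longrightarrow> y \<le> b \<longrightarrow> (f has_integral (dw y - dw x)) {x..y})"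
proof -
  have f_int: "f integrable_on {a..b}"
  proof -
    have "(\<lambda>x. f x * 1) absolutely_integrable_on {a..b}"
      by (rule absolutely_integrable_bounded_measurable_product_real)
        (use f in \<open>auto simp: bounded_iff intro!: exI[of _ K] absolutely_integrable_continuous_real\<close>)
    then show ?thesis by (simp add: absolutely_integrable_on_def)
  qed
  define F where "F = (\<lambda>x. integral {a..x} f)"
  have cF: "continuous_on {a..b} F" unfolding F_def by (rule indefinite_integral_continuous_1[OF f_int])
  note mult_int = integrable_times_continuous_UNIV
  have parts: "integral {a..b} (\<lambda>t. v t * \<phi> t) + integral {a..b} (\<lambda>t. integral {a..t} v * deriv \<phi> t) = 0"
    if v: "v \<in> borel_measurable (lebesgue_on {a..b})" "\<And>x. x \<in> {a..b} \<Longrightarrow> \<bar>v x\<bar> \<le> M"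
      and \<phi>: "\<phi> \<in> C1_compact_support {a..b}" for v \<phi> M
  proof -
    have "integral {a..b} (\<lambda>t. v t * \<phi> t) + integral {a..b} (\<lambda>t. integral {a..t} v * deriv \<phi> t) =
        integral {a..b} v * \<phi> b"
      using ab has_field_derivative_at_within[OF C1_compact_supportD(1)[OF \<phi>]]
        continuous_on_subset[OF C1_compact_supportD(2)[OF \<phi>]]
      by (intro integral_parts_primitive[OF _ v]) auto
    then show ?thesis using C1_compact_support_Icc_ends[OF \<phi>] by simp
  qed
  have "\<exists>k N. negligible N \<and> (\<forall>t\<in>{a..b} - N. g t - F t = k)"
  proof (rule negligible_nonconst_if_orthogonal_deriv[OF ab])
    show "(\<lambda>t. g t - F t) absolutely_integrable_on {a..b}"
      by (intro set_integral_diff g absolutely_integrable_continuous_real cF)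
    fix \<phi> assume \<phi>: "\<phi> \<in> C1_compact_support {a..b}"
    have "integral {a..b} (\<lambda>t. (g t - F t) * deriv \<phi> t) =
        integral {a..b} (\<lambda>t. g t * deriv \<phi> t) - integral {a..b} (\<lambda>t. F t * deriv \<phi> t)"
      unfolding left_diff_distrib using C1_compact_supportD(2)[OF \<phi>] cF
      by (intro Henstock_Kurzweil_Integration.integral_diff mult_int g absolutely_integrable_continuous_real)
    then show "integral {a..b} (\<lambda>t. (g t - F t) * deriv \<phi> t) = 0"
      using W2[OF \<phi>] parts[OF f \<phi>] by (simp add: F_def)
  qed
  then obtain k N where N: "negligible N" "\<And>t. t \<in> {a..b} - N \<Longrightarrow> g t = F t + k"
    by (auto simp: algebra_simps)
  define dw where "dw = (\<lambda>x. F x + k)"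
  have cdw: "continuous_on {a..b} dw" unfolding dw_def by (intro continuous_intros cF)
  define U where "U = (\<lambda>x. integral {a..x} dw)"
  have cU: "continuous_on {a..b} U"
    unfolding U_def by (rule indefinite_integral_continuous_1[OF integrable_continuous_real[OF cdw]])
  obtain M where M: "\<And>x. x \<in> {a..b} \<Longrightarrow> \<bar>dw x\<bar> \<le> M"
    using continuous_on_Icc_abs_bound[OF cdw] by blast
  have "\<exists>k' N'. negligible N' \<and> (\<forall>t\<in>{a..b} - N'. u t - U t = k')"
  proof (rule negligible_nonconst_if_orthogonal_deriv[OF ab])
    show "(\<lambda>t. u t - U t) absolutely_integrable_on {a..b}"
      by (intro absolutely_integrable_continuous_real continuous_intros u cU)
    fix \<phi> assume \<phi>: "\<phi> \<in> C1_compact_support {a..b}"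
    have "integral {a..b} (\<lambda>t. (u t - U t) * deriv \<phi> t) =
        integral {a..b} (\<lambda>t. u t * deriv \<phi> t) - integral {a..b} (\<lambda>t. U t * deriv \<phi> t)"
      unfolding left_diff_distrib using C1_compact_supportD(2)[OF \<phi>] cU u
      by (intro Henstock_Kurzweil_Integration.integral_diff mult_int absolutely_integrable_continuous_real)
    also have "integral {a..b} (\<lambda>t. u t * deriv \<phi> t) = - integral {a..b} (\<lambda>t. dw t * \<phi> t)"
      unfolding W1[OF \<phi>] using N by (intro arg_cong[where f = uminus] integral_spike[OF N(1)]) (auto simp: dw_def)
    also have "integral {a..b} (\<lambda>t. dw t * \<phi> t) + integral {a..b} (\<lambda>t. U t * deriv \<phi> t) = 0"
      unfolding U_def by (rule parts[OF _ M \<phi>]) (auto intro: continuous_imp_measurable_on_sets_lebesgue cdw)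
    then have "- integral {a..b} (\<lambda>t. dw t * \<phi> t) - integral {a..b} (\<lambda>t. U t * deriv \<phi> t) = 0" by simp
    finally show "integral {a..b} (\<lambda>t. (u t - U t) * deriv \<phi> t) = 0" .
  qed
  then obtain k' N' where N': "negligible N'" "\<And>t. t \<in> {a..b} - N' \<Longrightarrow> u t - U t = k'" by auto
  have "u t - U t - k' = 0" if "t \<in> {a..b}" for t
    by (rule continuous_zero_off_negligible[OF _ ab N'(1) _ that])
      (use N'(2) in \<open>auto intro!: continuous_intros u cU\<close>)
  then have uU: "u t = U t + k'" if "t \<in> {a..b}" for t using that by force
  have "(u has_real_derivative dw x) (at x)" if x: "x \<in> {a<..<b}" for x
  proof -
    have "(U has_vector_derivative dw x) (at x within {a..b})"
      unfolding U_def by (rule integral_has_vector_derivative[OF cdw]) (use x in auto)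
    then have "(U has_real_derivative dw x) (at x)"
      using x by (simp add: at_within_Icc_at has_real_derivative_iff_has_vector_derivative)
    then have "((\<lambda>x. U x + k') has_real_derivative dw x) (at x)"
      using DERIV_add[OF _ DERIV_const] by fastforce
    then show ?thesis
      by (rule has_field_derivative_transform_within_open[where S = "{a<..<b}"]) (use x uU in auto)
  qed
  moreover have "(f has_integral (dw y - dw x)) {x..y}" if "a \<le> x" "x \<le> y" "y \<le> b" for x y
  proof -
    have fi: "f integrable_on {a..y}" "f integrable_on {x..y}"
      using integrable_on_subinterval[OF f_int] that by auto
    have "integral {a..x} f + integral {x..y} f = integral {a..y} f"
      by (rule Henstock_Kurzweil_Integration.integral_combine[OF that(1,2) fi(1)])
    then have "integral {x..y} f = dw y - dw x" by (simp add: dw_def F_def)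
    then show ?thesis using integrable_integral[OF fi(2)] by simp
  qed
  ultimately show ?thesis using N by (intro exI[of _ dw] exI[of _ N]) (auto simp: dw_def)
qed


section \<open>Functions supported on a single edge\<close>

text \<open>Vertices receive the value 0 whatever \<phi> is; it is applied to functions that vanish
  outside the open edge, for which this is continuous.\<close>

definition ext_edge :: "'e \<Rightarrow> (real \<Rightarrow> real) \<Rightarrow> ('v, 'e) point \<Rightarrow> real" where
  "ext_edge e \<phi> P = (case P of Vertex v \<Rightarrow> 0 | Interior e' x \<Rightarrow> if e' = e then \<phi> x else 0)"

definition edge_interior :: "('v, 'e) metric_graph \<Rightarrow> 'e \<Rightarrow> real set" where
  "edge_interior G e = {x. 0 < x \<and> ereal x < edge_length G e}"

text \<open>C1 functions are not enough: test functions of an interval get kinks when they are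
  extended by zero. This class contains those extensions and the C1 test functions and is closed
  under linear combinations; the derivative is given explicitly off a finite set.\<close>

definition lip_test :: "real \<Rightarrow> real \<Rightarrow> (real \<Rightarrow> real) \<Rightarrow> (real \<Rightarrow> real) \<Rightarrow> bool" where
  "lip_test a b \<phi> \<phi>' \<longleftrightarrow> continuous_on UNIV \<phi> \<and> \<phi> a = 0 \<and> \<phi> b = 0 \<and>
     (\<forall>x. x \<notin> {a..b} \<longrightarrow> \<phi> x = 0 \<and> \<phi>' x = 0) \<and>
     (\<exists>S. finite S \<and> (\<forall>x. x \<notin> S \<longrightarrow> (\<phi> has_real_derivative \<phi>' x) (at x))) \<and>
     \<phi>' \<in> borel_measurable lebesgue \<and> bounded (range \<phi>')"

lemma restrict_edge_ext_edge:
  assumes "\<And>x. x \<notin> edge_interior G e \<Longrightarrow> \<phi> x = 0"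
  shows "restrict_edge G (ext_edge e \<phi>) e = \<phi>"
    and "e' \<noteq> e \<Longrightarrow> restrict_edge G (ext_edge e \<phi>) e' = (\<lambda>x. 0)"
  using assms by (auto simp: restrict_edge_def ext_edge_def edge_point_def edge_interior_def fun_eq_iff)

locale graph_edge =
  fixes G :: "('v, 'e) metric_graph" and e :: 'e
  assumes G: "G \<in> G_fin" and e: "e \<in> edges G"
begin

abbreviation "I \<equiv> edge_interval G e"
abbreviation "J \<equiv> edge_interior G e"

lemma edge_length_cases:
  obtains l where "edge_length G e = ereal l" "0 < l" "I = {0..l}" "J = {0<..<l}"
  | "edge_length G e = \<infinity>" "I = {0..}" "J = {0<..}"
proof (cases "edge_length G e")
  case (real l)
  have "0 < edge_length G e" using G e by (auto simp: G_fin_def)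
  then have "0 < l" using real by simp
  moreover have "I = {0..l}" "J = {0<..<l}" using real by (auto simp: edge_interval_def edge_interior_def)
  ultimately show ?thesis using that(1) real by blast
next
  case PInf
  then show ?thesis using that(2) by (auto simp: edge_interval_def edge_interior_def)
next
  case MInf
  then show ?thesis using G e by (auto simp: G_fin_def)
qed

lemma interior_I: "interior I = J"
  by (cases rule: edge_length_cases) (auto simp: interior_atLeastAtMost_real interior_real_atLeast)

lemma J_sub_I: "J \<subseteq> I" using interior_I interior_subset by metis

lemma open_J: "open J" using interior_I by (metis open_interior)

lemma closed_I: "closed I" by (cases rule: edge_length_cases) auto

lemma I_meas: "I \<in> sets lebesgue"
  using closed_I by (simp add: borel_closed lborelD)

lemma negligible_I_minus_J: "negligible (I - J)"
proof (cases rule: edge_length_cases)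
  case (1 l)
  have "I - J \<subseteq> {0, l}" using 1 by auto
  then show ?thesis by (meson finite.emptyI finite.insertI negligible_finite negligible_subset)
next
  case 2
  have "I - J \<subseteq> {0}" using 2 by auto
  then show ?thesis by (meson negligible_sing negligible_subset)
qed

lemma Icc_sub_J: "\<lbrakk>a \<in> J; b \<in> J\<rbrakk> \<Longrightarrow> {a..b} \<subseteq> J"
  by (cases rule: edge_length_cases) auto

end

text \<open>The bridge between Bochner integrals over a whole edge, used in the definitions on the
  graph, and gauge integrals over a compact interval, used in the one-dimensional analysis.\<close>

lemma lebesgue_on_integral_eq:
  fixes F :: "real \<Rightarrow> real"
  assumes "I \<in> sets lebesgue" "{a..b} \<subseteq> I" "\<And>x. x \<in> I - {a..b} \<Longrightarrow> F x = 0"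
    "F absolutely_integrable_on {a..b}"
  shows "(LINT x|lebesgue_on I. F x) = integral {a..b} F" "integrable (lebesgue_on I) F"
proof -
  have eq: "indicator I x *\<^sub>R F x = indicator {a..b} x *\<^sub>R F x" for x
    using assms(2,3) by (auto simp: indicator_def)
  have "(LINT x|lebesgue_on I. F x) = (LINT x|lebesgue. indicator I x *\<^sub>R F x)"
    by (rule integral_restrict_space) (use assms in auto)
  also have "\<dots> = (LINT x|lebesgue. indicator {a..b} x *\<^sub>R F x)" by (simp only: eq)
  also have "\<dots> = integral {a..b} F"
    using set_lebesgue_integral_eq_integral(2)[OF assms(4)] by (simp add: set_lebesgue_integral_def)
  finally show "(LINT x|lebesgue_on I. F x) = integral {a..b} F" .
  have "integrable (lebesgue_on I) F \<longleftrightarrow> integrable lebesgue (\<lambda>x. indicator I x *\<^sub>R F x)"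
    by (rule integrable_restrict_space) (use assms in auto)
  also have "\<dots>" unfolding eq using assms(4) by (simp add: set_integrable_def)
  finally show "integrable (lebesgue_on I) F" by simp
qed

lemma borel_measurable_lebesgue_on_subset:
  fixes f :: "real \<Rightarrow> real"
  assumes "f \<in> borel_measurable (lebesgue_on I)" "S \<subseteq> I" "S \<in> sets lebesgue"
  shows "f \<in> borel_measurable (lebesgue_on S)"
  using measurable_restrict_mono[OF assms(1,2)] .

lemma L2_on_absolutely_integrable:
  assumes g: "g \<in> L2_on I" and sub: "{a..b} \<subseteq> I" and I: "I \<in> sets lebesgue"
  shows "g absolutely_integrable_on {a..b}" "(\<lambda>x. (g x)\<^sup>2) absolutely_integrable_on {a..b}"
proof -
  have m: "g \<in> borel_measurable (lebesgue_on I)" and i: "integrable (lebesgue_on I) (\<lambda>x. (g x)\<^sup>2)"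
    using g by (auto simp: L2_on_def)
  have "(\<lambda>x. (g x)\<^sup>2) absolutely_integrable_on I"
    using i I by (simp add: set_integrable_def integrable_restrict_space)
  then show sq: "(\<lambda>x. (g x)\<^sup>2) absolutely_integrable_on {a..b}"
    by (rule set_integrable_subset) (use sub in auto)
  have m': "g \<in> borel_measurable (lebesgue_on {a..b})"
    by (rule borel_measurable_lebesgue_on_subset[OF m sub]) auto
  show "g absolutely_integrable_on {a..b}"
  proof (rule measurable_bounded_by_integrable_imp_absolutely_integrable[OF m'])
    have "(\<lambda>x. 1 + (g x)\<^sup>2) absolutely_integrable_on {a..b}"
      by (intro set_integral_add sq) (auto intro: absolutely_integrable_continuous_real)
    then show "(\<lambda>x. 1 + (g x)\<^sup>2) integrable_on {a..b}" by (simp add: absolutely_integrable_on_def)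
    fix x
    have "0 \<le> (\<bar>g x\<bar> - 1)\<^sup>2" by simp
    then have "2 * \<bar>g x\<bar> \<le> 1 + (g x)\<^sup>2" by (simp add: power2_diff)
    moreover have "0 \<le> \<bar>g x\<bar>" by simp
    ultimately show "norm (g x) \<le> 1 + (g x)\<^sup>2" unfolding real_norm_def by linarith
  qed auto
qed

lemma AE_lebesgue_onI:
  assumes "negligible N" "\<And>x. x \<in> S - N \<Longrightarrow> P x" "S \<in> sets lebesgue"
  shows "AE x in lebesgue_on S. P x"
proof -
  have "AE x in lebesgue. x \<notin> N" using assms(1) by (simp add: negligible_iff_null_sets AE_not_in)
  then have "AE x in lebesgue. x \<in> S \<longrightarrow> P x" by eventually_elim (use assms(2) in auto)
  then show ?thesis using assms(3) by (simp add: AE_restrict_space_iff)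
qed

section \<open>Weak derivatives on one edge\<close>

context graph_edge
begin

lemma C1_compact_support_Icc_sub:
  "{a..b} \<subseteq> J \<Longrightarrow> C1_compact_support {a..b} \<subseteq> C1_compact_support (interior I)"
  unfolding interior_I by (rule C1_compact_support_mono)

lemma weak_deriv_local:
  assumes sub: "{a..b} \<subseteq> J" and u: "continuous_on I u" and g: "g \<in> L2_on I" "has_weak_deriv I u g"
    and \<phi>: "\<phi> \<in> C1_compact_support {a..b}"
  shows "integral {a..b} (\<lambda>t. u t * deriv \<phi> t) = - integral {a..b} (\<lambda>t. g t * \<phi> t)"
proof -
  note C = C1_compact_supportD[OF \<phi>]
  have subI: "{a..b} \<subseteq> I" using sub J_sub_I by blast
  note out = C1_compact_support_deriv_outside[OF \<phi>]
  have cont: "continuous_on {a..b} \<phi>" "continuous_on {a..b} (deriv \<phi>)" "continuous_on {a..b} u"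
    using C(2,3) u subI continuous_on_subset by blast+
  have "(LINT x|lebesgue_on I. u x * deriv \<phi> x) = integral {a..b} (\<lambda>t. u t * deriv \<phi> t)"
    by (rule lebesgue_on_integral_eq[OF I_meas subI])
      (auto simp: out intro!: absolutely_integrable_continuous_real continuous_intros cont)
  moreover have "(LINT x|lebesgue_on I. g x * \<phi> x) = integral {a..b} (\<lambda>t. g t * \<phi> t)"
    by (rule lebesgue_on_integral_eq[OF I_meas subI])
      (auto simp: C(4) intro!: absolutely_integrable_times_continuous L2_on_absolutely_integrable[OF g(1) subI I_meas] cont)
  moreover have "\<phi> \<in> C1_compact_support (interior I)" using C1_compact_support_Icc_sub[OF sub] \<phi> by blast
  ultimately show ?thesis using g(2) unfolding has_weak_deriv_def by simp
qed

text \<open>On each compact interval with rational endpoints inside the open edge the difference is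
  orthogonal to all C1 test functions. Countably many such intervals cover the open edge, so the
  exceptional sets stay null.\<close>

lemma weak_deriv_unique:
  assumes u: "continuous_on I u" and g1: "g1 \<in> L2_on I" "has_weak_deriv I u g1"
    and g2: "g2 \<in> L2_on I" "has_weak_deriv I u g2"
  shows "AE x in lebesgue_on I. g1 x = g2 x"
proof -
  define Q where "Q = {(a, b). a \<in> \<rat> \<and> b \<in> \<rat> \<and> {a..b} \<subseteq> J}"
  have "countable Q" by (rule countable_subset[of _ "\<rat> \<times> \<rat>"]) (auto simp: Q_def countable_rat)
  have "\<exists>N. negligible N \<and> (\<forall>t\<in>{fst q..snd q} - N. g1 t - g2 t = 0)" if "q \<in> Q" for q
  proof -
    define a b where "a = fst q" and "b = snd q"
    have sub: "{a..b} \<subseteq> J" using that by (auto simp: Q_def a_def b_def)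
    then have subI: "{a..b} \<subseteq> I" using J_sub_I by blast
    note gi = L2_on_absolutely_integrable(1)[OF _ subI I_meas]
    have "\<exists>N. negligible N \<and> (\<forall>t\<in>{a..b} - N. g1 t - g2 t = 0)"
    proof (rule negligible_nonzero_if_orthogonal_C1)
      show "(\<lambda>t. g1 t - g2 t) absolutely_integrable_on {a..b}"
        by (intro set_integral_diff gi g1(1) g2(1))
      fix \<psi> assume \<psi>: "\<psi> \<in> C1_compact_support {a..b}"
      have c: "continuous_on {a..b} \<psi>" using C1_compact_supportD(3)[OF \<psi>] continuous_on_subset by blast
      have "integral {a..b} (\<lambda>t. g1 t * \<psi> t - g2 t * \<psi> t) =
          integral {a..b} (\<lambda>t. g1 t * \<psi> t) - integral {a..b} (\<lambda>t. g2 t * \<psi> t)"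
        using absolutely_integrable_times_continuous[OF gi[OF g1(1)] c]
          absolutely_integrable_times_continuous[OF gi[OF g2(1)] c]
        by (intro Henstock_Kurzweil_Integration.integral_diff) (auto simp: absolutely_integrable_on_def)
      then show "integral {a..b} (\<lambda>t. (g1 t - g2 t) * \<psi> t) = 0"
        using weak_deriv_local[OF sub u g1 \<psi>] weak_deriv_local[OF sub u g2 \<psi>]
        by (simp add: left_diff_distrib)
    qed
    then show ?thesis by (simp add: a_def b_def)
  qed
  then obtain N where N: "\<And>q. q \<in> Q \<Longrightarrow> negligible (N q)"
    "\<And>q t. \<lbrakk>q \<in> Q; t \<in> {fst q..snd q} - N q\<rbrakk> \<Longrightarrow> g1 t - g2 t = 0" by metis
  define M where "M = (I - J) \<union> \<Union> (N ` Q)"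
  have "negligible (\<Union> (N ` Q))"
    by (rule negligible_countable_Union) (use \<open>countable Q\<close> N(1) in auto)
  then have "negligible M" unfolding M_def using negligible_I_minus_J by (rule negligible_Un[rotated])
  then show ?thesis
  proof (rule AE_lebesgue_onI[OF _ _ I_meas])
    fix x assume x: "x \<in> I - M"
    then have "x \<in> J" by (auto simp: M_def)
    then obtain d where d: "d > 0" "ball x d \<subseteq> J" using open_J openE by blast
    obtain a where a: "a \<in> \<rat>" "x - d < a" "a < x" using Rats_dense_in_real[of "x - d" x] d by auto
    obtain b where b: "b \<in> \<rat>" "x < b" "b < x + d" using Rats_dense_in_real[of x "x + d"] d by auto
    have "{a..b} \<subseteq> ball x d" using a b by (auto simp: dist_real_def)
    then have "(a, b) \<in> Q" using a b d by (auto simp: Q_def)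
    then show "g1 x = g2 x" using N(2)[of "(a, b)" x] a b x by (auto simp: M_def)
  qed
qed

lemma weak_deriv_AE:
  assumes u: "continuous_on I u" and g: "g \<in> L2_on I" "has_weak_deriv I u g"
  shows "weak_deriv I u \<in> L2_on I" "has_weak_deriv I u (weak_deriv I u)"
    "AE x in lebesgue_on I. weak_deriv I u x = g x"
proof -
  show *: "weak_deriv I u \<in> L2_on I" "has_weak_deriv I u (weak_deriv I u)"
    unfolding weak_deriv_def using someI_ex[of "\<lambda>g. g \<in> L2_on I \<and> has_weak_deriv I u g"] g by blast+
  show "AE x in lebesgue_on I. weak_deriv I u x = g x" by (rule weak_deriv_unique[OF u * g])
qed

lemma lip_test_integrable:
  assumes "lip_test a b \<phi> \<phi>'"
  shows "\<phi>' absolutely_integrable_on {c..d}" "(\<lambda>x. (\<phi>' x)\<^sup>2) absolutely_integrable_on {c..d}"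
proof -
  obtain B where B: "\<And>x. \<bar>\<phi>' x\<bar> \<le> B" using assms by (auto simp: lip_test_def bounded_iff)
  have m: "\<phi>' \<in> borel_measurable lebesgue" using assms by (simp add: lip_test_def)
  show 1: "\<phi>' absolutely_integrable_on {c..d}"
    using bounded_measurable_times_continuous_integrable[OF m B, of c d "\<lambda>_. 1"] by simp
  have "(\<lambda>x. \<phi>' x * \<phi>' x) absolutely_integrable_on {c..d}"
    by (rule absolutely_integrable_bounded_measurable_product_real[OF _ _ _ 1])
      (use m B in \<open>auto simp: bounded_iff measurable_restrict_space1 intro!: exI[of _ B]\<close>)
  then show "(\<lambda>x. (\<phi>' x)\<^sup>2) absolutely_integrable_on {c..d}" by (simp add: power2_eq_square)
qed

lemma lip_test_H1:
  assumes sub: "{a..b} \<subseteq> J" "a \<le> b" and t: "lip_test a b \<phi> \<phi>'"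
  shows "\<phi> \<in> L2_on I" "\<phi>' \<in> L2_on I" "has_weak_deriv I \<phi> \<phi>'"
proof -
  have subI: "{a..b} \<subseteq> I" using sub J_sub_I by blast
  have c: "continuous_on UNIV \<phi>" and m: "\<phi>' \<in> borel_measurable lebesgue"
    and out: "\<And>x. x \<notin> {a..b} \<Longrightarrow> \<phi> x = 0 \<and> \<phi>' x = 0" and ends: "\<phi> a = 0" "\<phi> b = 0"
    using t by (auto simp: lip_test_def)
  obtain S where S: "finite S" "\<And>x. x \<notin> S \<Longrightarrow> (\<phi> has_real_derivative \<phi>' x) (at x)"
    using t by (auto simp: lip_test_def)
  have cab: "continuous_on {a..b} \<phi>" using c continuous_on_subset by blast
  show "\<phi> \<in> L2_on I"
  proof -
    have "\<phi> \<in> borel_measurable lebesgue"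
      using c by (simp add: borel_measurable_continuous_onI measurable_completion)
    moreover have "integrable (lebesgue_on I) (\<lambda>x. (\<phi> x)\<^sup>2)"
      by (rule lebesgue_on_integral_eq(2)[OF I_meas subI])
        (use out in \<open>auto intro!: absolutely_integrable_continuous_real continuous_intros cab\<close>)
    ultimately show ?thesis by (simp add: L2_on_def measurable_restrict_space1)
  qed
  show "\<phi>' \<in> L2_on I"
  proof -
    have "integrable (lebesgue_on I) (\<lambda>x. (\<phi>' x)\<^sup>2)"
      by (rule lebesgue_on_integral_eq(2)[OF I_meas subI]) (use out lip_test_integrable[OF t] in auto)
    then show ?thesis using m by (simp add: L2_on_def measurable_restrict_space1)
  qed
  show "has_weak_deriv I \<phi> \<phi>'"
    unfolding has_weak_deriv_def
  proof
    fix \<theta> assume \<theta>: "\<theta> \<in> C1_compact_support (interior I)"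
    note C = C1_compact_supportD[OF \<theta>]
    have c\<theta>: "continuous_on {a..b} \<theta>" "continuous_on {a..b} (deriv \<theta>)" using C(2,3) continuous_on_subset by blast+
    have 1: "(LINT x|lebesgue_on I. \<phi> x * deriv \<theta> x) = integral {a..b} (\<lambda>x. \<phi> x * deriv \<theta> x)"
      by (rule lebesgue_on_integral_eq(1)[OF I_meas subI])
        (use out in \<open>auto intro!: absolutely_integrable_continuous_real continuous_intros cab c\<theta>\<close>)
    have ai: "(\<lambda>x. \<phi>' x * \<theta> x) absolutely_integrable_on {a..b}"
      by (intro absolutely_integrable_times_continuous lip_test_integrable[OF t] c\<theta>)
    have 2: "(LINT x|lebesgue_on I. \<phi>' x * \<theta> x) = integral {a..b} (\<lambda>x. \<phi>' x * \<theta> x)"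
      by (rule lebesgue_on_integral_eq(1)[OF I_meas subI _ ai]) (use out in auto)
    \<comment> \<open>The product rule holds off the finite exceptional set, which suffices for the
      fundamental theorem because the product is continuous.\<close>
    have "((\<lambda>x. \<phi>' x * \<theta> x + \<phi> x * deriv \<theta> x) has_integral \<phi> b * \<theta> b - \<phi> a * \<theta> a) {a..b}"
    proof (rule fundamental_theorem_of_calculus_interior_strong[OF S(1) sub(2)])
      fix x assume "x \<in> {a<..<b} - S"
      then have "((\<lambda>x. \<phi> x * \<theta> x) has_real_derivative \<phi>' x * \<theta> x + deriv \<theta> x * \<phi> x) (at x)"
        by (intro DERIV_mult S(2) C(1)) auto
      then show "((\<lambda>x. \<phi> x * \<theta> x) has_vector_derivative \<phi>' x * \<theta> x + \<phi> x * deriv \<theta> x) (at x)"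
        by (simp add: has_real_derivative_iff_has_vector_derivative mult.commute)
    qed (intro continuous_intros cab c\<theta>)
    then have "integral {a..b} (\<lambda>x. \<phi>' x * \<theta> x + \<phi> x * deriv \<theta> x) = 0"
      using ends by (simp add: integral_unique)
    moreover have "integral {a..b} (\<lambda>x. \<phi>' x * \<theta> x + \<phi> x * deriv \<theta> x) =
        integral {a..b} (\<lambda>x. \<phi>' x * \<theta> x) + integral {a..b} (\<lambda>x. \<phi> x * deriv \<theta> x)"
    proof (rule Henstock_Kurzweil_Integration.integral_add)
      show "(\<lambda>x. \<phi>' x * \<theta> x) integrable_on {a..b}" using ai by (simp add: absolutely_integrable_on_def)
    qed (intro integrable_continuous_real continuous_intros cab c\<theta>)
    ultimately show "(LINT x|lebesgue_on I. \<phi> x * deriv \<theta> x) = - (LINT x|lebesgue_on I. \<phi>' x * \<theta> x)"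
      unfolding 1 2 by simp
  qed
qed

end

section \<open>Continuity and compact support in the quotient topology\<close>

lemma edge_point_in_points:
  assumes "G \<in> G_fin" "e \<in> edges G" "x \<in> edge_interval G e"
  shows "edge_point G e x \<in> points G"
  using assms by (auto simp: edge_point_def points_def edge_interval_def G_fin_def less_le)

lemma C_graph_restrict_continuous:
  assumes u: "u \<in> C_graph G" and G: "G \<in> G_fin" and e: "e \<in> edges G"
  shows "continuous_on (edge_interval G e) (restrict_edge G u e)"
  unfolding continuous_openin_preimage_eq
proof (intro allI impI)
  fix B :: "real set" assume "open B"
  then have "openin (graph_topology G) {P \<in> topspace (graph_topology G). u P \<in> B}"
    by (intro openin_continuous_map_preimage[of _ euclideanreal]) (use u in \<open>simp_all add: C_graph_def\<close>)
  then have "openin (top_of_set (edge_interval G e))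
      {x \<in> edge_interval G e. edge_point G e x \<in> {P \<in> points G. u P \<in> B}}"
    using e unfolding topspace_graph_topology[OF G] openin_graph_topology by blast
  also have "{x \<in> edge_interval G e. edge_point G e x \<in> {P \<in> points G. u P \<in> B}} =
      edge_interval G e \<inter> restrict_edge G u e -` B"
    using edge_point_in_points[OF G e] by (auto simp: restrict_edge_def)
  finally show "openin (top_of_set (edge_interval G e)) (edge_interval G e \<inter> restrict_edge G u e -` B)" .
qed

lemma C_graphI:
  assumes G: "G \<in> G_fin" and out: "\<And>P. P \<notin> points G \<Longrightarrow> u P = 0"
    and cont: "\<And>e. e \<in> edges G \<Longrightarrow> continuous_on (edge_interval G e) (restrict_edge G u e)"
  shows "u \<in> C_graph G"
proof -
  have "openin (graph_topology G) {P \<in> points G. u P \<in> B}" if "open B" for B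
    unfolding openin_graph_topology
  proof (intro conjI ballI)
    fix e assume e: "e \<in> edges G"
    have "{x \<in> edge_interval G e. edge_point G e x \<in> {P \<in> points G. u P \<in> B}} =
        edge_interval G e \<inter> restrict_edge G u e -` B"
      using edge_point_in_points[OF G e] by (auto simp: restrict_edge_def)
    moreover have "openin (top_of_set (edge_interval G e)) (edge_interval G e \<inter> restrict_edge G u e -` B)"
      using cont[OF e] \<open>open B\<close> unfolding continuous_openin_preimage_eq by blast
    ultimately show "openin (top_of_set (edge_interval G e))
        {x \<in> edge_interval G e. edge_point G e x \<in> {P \<in> points G. u P \<in> B}}" by simp
  qed auto
  then have "continuous_map (graph_topology G) euclideanreal u"
    by (simp add: continuous_map_def topspace_graph_topology[OF G])
  then show ?thesis using out by (simp add: C_graph_def)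
qed

context graph_edge
begin

lemma ext_edge_C_graph:
  assumes c: "continuous_on UNIV \<phi>" and out: "\<And>x. x \<notin> J \<Longrightarrow> \<phi> x = 0"
  shows "ext_edge e \<phi> \<in> C_graph G"
proof (rule C_graphI[OF G])
  fix P assume P: "P \<notin> points G"
  show "ext_edge e \<phi> P = 0"
  proof (cases P)
    case (Interior e' x)
    then show ?thesis using P e out by (auto simp: ext_edge_def points_def edge_interior_def)
  qed (simp add: ext_edge_def)
next
  fix e' assume "e' \<in> edges G"
  show "continuous_on (edge_interval G e') (restrict_edge G (ext_edge e \<phi>) e')"
    using restrict_edge_ext_edge(1)[of G e \<phi>, OF out] restrict_edge_ext_edge(2)[of G e \<phi> e', OF out] c
    by (cases "e' = e") (auto intro: continuous_on_subset)
qed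

lemma edge_point_continuous_map:
  "continuous_map (top_of_set I) (graph_topology G) (edge_point G e)"
  unfolding continuous_map_def topspace_graph_topology[OF G]
proof (intro conjI allI impI)
  show "edge_point G e \<in> topspace (top_of_set I) \<rightarrow> points G" using edge_point_in_points[OF G e] by auto
  fix U assume "openin (graph_topology G) U"
  then show "openin (top_of_set I) {x \<in> topspace (top_of_set I). edge_point G e x \<in> U}"
    using e unfolding openin_graph_topology by simp
qed

text \<open>The image of \<open>{a..b}\<close> is compact, and it is closed because its preimage is
  \<open>{a..b}\<close> on the edge itself and empty on every other edge. So it contains the closure
  of the support.\<close>

lemma ext_edge_Cc_graph:
  assumes c: "continuous_on UNIV \<phi>" and sub: "{a..b} \<subseteq> J" and out: "\<And>x. x \<notin> {a..b} \<Longrightarrow> \<phi> x = 0"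
  shows "ext_edge e \<phi> \<in> Cc_graph G"
proof -
  have C: "ext_edge e \<phi> \<in> C_graph G" by (rule ext_edge_C_graph[OF c]) (use out sub in blast)
  define K where "K = edge_point G e ` {a..b}"
  have subI: "{a..b} \<subseteq> I" using sub J_sub_I by blast
  have Kc: "compactin (graph_topology G) K"
    unfolding K_def by (rule image_compactin[OF _ edge_point_continuous_map])
      (use subI in \<open>simp add: compactin_subtopology\<close>)
  have pt: "edge_point G e x = Interior e x" if "x \<in> {a..b}" for x
    using that sub by (auto simp: edge_point_def edge_interior_def)
  have Kpts: "K \<subseteq> points G" using edge_point_in_points[OF G e] subI by (auto simp: K_def)
  have "openin (graph_topology G) (points G - K)"
    unfolding openin_graph_topology
  proof (intro conjI ballI)
    fix e' assume e': "e' \<in> edges G"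
    let ?T = "{x \<in> edge_interval G e'. edge_point G e' x \<in> points G - K}"
    show "openin (top_of_set (edge_interval G e')) ?T"
    proof (cases "e' = e")
      case False
      then have "edge_point G e' x \<notin> K" for x
        unfolding K_def using pt by (auto simp: edge_point_def)
      then have "?T = edge_interval G e'" using edge_point_in_points[OF G e'] by auto
      then show ?thesis by simp
    next
      case True
      have "edge_point G e x \<in> K \<longleftrightarrow> x \<in> {a..b}" if "x \<in> I" for x
      proof
        assume "edge_point G e x \<in> K"
        then obtain y where y: "y \<in> {a..b}" "edge_point G e x = Interior e y" using pt by (auto simp: K_def)
        then show "x \<in> {a..b}" by (auto simp: edge_point_def split: if_splits)
      qed (auto simp: K_def)
      then have "?T = I \<inter> - {a..b}" using True edge_point_in_points[OF G e] by auto
      then show ?thesis using True by (auto intro: openin_open_Int)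
    qed
  qed auto
  then have Kcl: "closedin (graph_topology G) K"
    using Kpts by (simp add: closedin_def topspace_graph_topology[OF G])
  have "{P \<in> points G. ext_edge e \<phi> P \<noteq> 0} \<subseteq> K"
  proof
    fix P assume "P \<in> {P \<in> points G. ext_edge e \<phi> P \<noteq> 0}"
    then obtain x where x: "P = Interior e x" "\<phi> x \<noteq> 0"
      by (auto simp: ext_edge_def split: point.splits if_splits)
    then have "x \<in> {a..b}" using out by blast
    then show "P \<in> K" using x pt by (force simp: K_def)
  qed
  then have "graph_topology G closure_of {P \<in> points G. ext_edge e \<phi> P \<noteq> 0} \<subseteq> K"
    by (rule closure_of_minimal[OF _ Kcl])
  then have "compactin (graph_topology G) (graph_topology G closure_of {P \<in> points G. ext_edge e \<phi> P \<noteq> 0})"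
    by (rule closed_compactin[OF Kc _ closedin_closure_of])
  then show ?thesis using C by (simp add: Cc_graph_def)
qed

lemma zero_weak_deriv_AE:
  "AE x in lebesgue_on I. weak_deriv I (\<lambda>x. 0) x = 0"
proof (rule weak_deriv_AE(3))
  show "(\<lambda>x. 0) \<in> L2_on I" by (simp add: L2_on_def)
  show "has_weak_deriv I (\<lambda>x. 0) (\<lambda>x. 0)" by (simp add: has_weak_deriv_def)
qed simp

end

lemma (in graph_edge) ext_edge_H1_graph:
  assumes sub: "{a..b} \<subseteq> J" "a \<le> b" and t: "lip_test a b \<phi> \<phi>'"
  shows "ext_edge e \<phi> \<in> H1_graph G \<inter> Cc_graph G"
    and "AE x in lebesgue_on I. edge_deriv G (ext_edge e \<phi>) e x = \<phi>' x"
    and "edge_deriv G (ext_edge e \<phi>) e \<in> L2_on I"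
    and "restrict_edge G (ext_edge e \<phi>) e = \<phi>"
    and "\<And>e'. \<lbrakk>e' \<in> edges G; e' \<noteq> e\<rbrakk> \<Longrightarrow> restrict_edge G (ext_edge e \<phi>) e' = (\<lambda>x. 0)"
    and "\<And>e'. \<lbrakk>e' \<in> edges G; e' \<noteq> e\<rbrakk> \<Longrightarrow>
      AE x in lebesgue_on (edge_interval G e'). edge_deriv G (ext_edge e \<phi>) e' x = 0"
proof -
  have c: "continuous_on UNIV \<phi>" and out: "\<And>x. x \<notin> {a..b} \<Longrightarrow> \<phi> x = 0"
    using t by (auto simp: lip_test_def)
  have outJ: "\<And>x. x \<notin> J \<Longrightarrow> \<phi> x = 0" using out sub by blast
  note H = lip_test_H1[OF sub t]
  note R = restrict_edge_ext_edge[of G e \<phi>, OF outJ]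
  show "restrict_edge G (ext_edge e \<phi>) e = \<phi>" using R(1) .
  show R2: "restrict_edge G (ext_edge e \<phi>) e' = (\<lambda>x. 0)" if "e' \<in> edges G" "e' \<noteq> e" for e'
    using R(2) that by blast
  have cI: "continuous_on I \<phi>" using c continuous_on_subset by blast
  have E: "edge_deriv G (ext_edge e \<phi>) e = weak_deriv I \<phi>"
    unfolding edge_deriv_def by (rule arg_cong[where f = "weak_deriv I", OF R(1)])
  show "AE x in lebesgue_on I. edge_deriv G (ext_edge e \<phi>) e x = \<phi>' x"
    "edge_deriv G (ext_edge e \<phi>) e \<in> L2_on I"
    unfolding E using weak_deriv_AE[OF cI H(2,3)] by auto
  show "AE x in lebesgue_on (edge_interval G e'). edge_deriv G (ext_edge e \<phi>) e' x = 0"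
    if "e' \<in> edges G" "e' \<noteq> e" for e'
  proof -
    interpret e': graph_edge G e' by unfold_locales (use G that in auto)
    show ?thesis unfolding edge_deriv_def R2[OF that] by (rule e'.zero_weak_deriv_AE)
  qed
  have "restrict_edge G (ext_edge e \<phi>) e' \<in> H1_on (edge_interval G e')" if "e' \<in> edges G" for e'
  proof (cases "e' = e")
    case True
    then show ?thesis using R(1) H by (auto simp: H1_on_def)
  next
    case False
    have "(\<lambda>x. 0) \<in> L2_on (edge_interval G e')" by (simp add: L2_on_def)
    moreover have "has_weak_deriv (edge_interval G e') (\<lambda>x. 0) (\<lambda>x. 0)" by (simp add: has_weak_deriv_def)
    ultimately show ?thesis unfolding R2[OF that False] H1_on_def by blast
  qed
  moreover have Cc: "ext_edge e \<phi> \<in> Cc_graph G" by (rule ext_edge_Cc_graph[OF c sub(1) out])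
  moreover from Cc have "ext_edge e \<phi> \<in> C_graph G" by (simp add: Cc_graph_def)
  ultimately show "ext_edge e \<phi> \<in> H1_graph G \<inter> Cc_graph G" by (simp add: H1_graph_def)
qed


section \<open>Restriction of solutions to an edge, and the Morse index\<close>

lemma lip_test_zero: "lip_test a b (\<lambda>x. 0) (\<lambda>x. 0)"
  by (auto simp: lip_test_def intro!: exI[of _ "{}"])

lemma lip_test_add_scale:
  assumes 1: "lip_test a b \<phi> \<phi>'" and 2: "lip_test a b \<psi> \<psi>'"
  shows "lip_test a b (\<lambda>x. \<phi> x + t * \<psi> x) (\<lambda>x. \<phi>' x + t * \<psi>' x)"
proof -
  obtain S T where S: "finite S" "\<And>x. x \<notin> S \<Longrightarrow> (\<phi> has_real_derivative \<phi>' x) (at x)"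
    and T: "finite T" "\<And>x. x \<notin> T \<Longrightarrow> (\<psi> has_real_derivative \<psi>' x) (at x)"
    using 1 2 unfolding lip_test_def by blast
  obtain B C where B: "\<And>x. \<bar>\<phi>' x\<bar> \<le> B" and C: "\<And>x. \<bar>\<psi>' x\<bar> \<le> C"
    using 1 2 by (auto simp: lip_test_def bounded_iff)
  have "\<bar>\<phi>' x + t * \<psi>' x\<bar> \<le> B + \<bar>t\<bar> * C" for x
  proof -
    have "\<bar>\<phi>' x + t * \<psi>' x\<bar> \<le> \<bar>\<phi>' x\<bar> + \<bar>t * \<psi>' x\<bar>" by (rule abs_triangle_ineq)
    also have "\<dots> \<le> B + \<bar>t\<bar> * C"
      using B[of x] C[of x] by (auto simp: abs_mult intro!: add_mono mult_left_mono)
    finally show ?thesis .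
  qed
  then have "bounded (range (\<lambda>x. \<phi>' x + t * \<psi>' x))" by (auto simp: bounded_iff)
  moreover have "\<exists>U. finite U \<and> (\<forall>x. x \<notin> U \<longrightarrow>
      ((\<lambda>x. \<phi> x + t * \<psi> x) has_real_derivative \<phi>' x + t * \<psi>' x) (at x))"
    using S T by (intro exI[of _ "S \<union> T"]) (auto intro!: DERIV_add DERIV_cmult)
  moreover have "(\<lambda>x. \<phi>' x + t * \<psi>' x) \<in> borel_measurable lebesgue"
    using 1 2 by (intro borel_measurable_add borel_measurable_times borel_measurable_const) (auto simp: lip_test_def)
  moreover have "continuous_on UNIV (\<lambda>x. \<phi> x + t * \<psi> x)"
    using 1 2 by (intro continuous_intros) (auto simp: lip_test_def)
  ultimately show ?thesis using 1 2 unfolding lip_test_def by simp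
qed

lemma lip_test_sum:
  fixes k :: nat
  assumes "\<And>i. i < k \<Longrightarrow> lip_test a b (\<Phi> i) (\<Phi>' i)"
  shows "lip_test a b (\<lambda>x. \<Sum>i<k. t i * \<Phi> i x) (\<lambda>x. \<Sum>i<k. t i * \<Phi>' i x)"
  using assms
proof (induction k)
  case 0
  then show ?case by (simp add: lip_test_zero)
next
  case (Suc k)
  then show ?case using lip_test_add_scale[of a b _ _ "\<Phi> k" "\<Phi>' k" "t k"] by simp
qed

lemma test_fun_lip_test:
  assumes t: "test_fun c d \<phi> \<phi>'" and cd: "a \<le> c" "d \<le> b"
  shows "lip_test a b (\<lambda>x. if x \<in> {c..d} then \<phi> x else 0) (\<lambda>x. if x \<in> {c..d} then \<phi>' x else 0)"
    (is "lip_test a b ?\<Phi> ?\<Phi>'")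
proof -
  have lt: "c < d" and ends: "\<phi> c = 0" "\<phi> d = 0" and c': "continuous_on {c..d} \<phi>'"
    and D: "\<And>x. x \<in> {c..d} \<Longrightarrow> (\<phi> has_real_derivative \<phi>' x) (at x within {c..d})"
    using t by (auto simp: test_fun_def)
  have c: "continuous_on {c..d} \<phi>" using test_fun_continuous[OF t] by simp
  have "continuous_on ({..c} \<union> ({c..d} \<union> {d..})) ?\<Phi>"
  proof (intro continuous_on_closed_Un)
    show "continuous_on {..c} ?\<Phi>"
      by (rule continuous_on_eq[of _ "\<lambda>x. 0"]) (use ends lt in \<open>auto simp: order_antisym_conv\<close>)
    show "continuous_on {c..d} ?\<Phi>" by (rule continuous_on_eq[OF c]) auto
    show "continuous_on {d..} ?\<Phi>"
      by (rule continuous_on_eq[of _ "\<lambda>x. 0"]) (use ends lt in \<open>auto simp: order_antisym_conv\<close>)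
  qed auto
  also have "{..c} \<union> ({c..d} \<union> {d..}) = UNIV" by auto
  finally have 1: "continuous_on UNIV ?\<Phi>" .
  have 2: "(?\<Phi> has_real_derivative ?\<Phi>' x) (at x)" if x: "x \<notin> {c, d}" for x
  proof (cases "x \<in> {c<..<d}")
    case True
    then have "(\<phi> has_real_derivative \<phi>' x) (at x)" using D[of x] by (simp add: at_within_Icc_at)
    then have "(?\<Phi> has_real_derivative \<phi>' x) (at x)"
      by (rule has_field_derivative_transform_within_open[where S = "{c<..<d}"]) (use True in auto)
    then show ?thesis using True by simp
  next
    case False
    then have x': "x \<in> - {c..d}" using x by auto
    have "((\<lambda>x. 0) has_real_derivative 0) (at x)" by simp
    then have "(?\<Phi> has_real_derivative 0) (at x)"
      by (rule has_field_derivative_transform_within_open[where S = "- {c..d}"]) (use x' in auto)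
    then show ?thesis using x' by auto
  qed
  have 3: "?\<Phi>' \<in> borel_measurable lebesgue"
    by (rule borel_measurable_if_I) (use c' in \<open>auto intro: continuous_imp_measurable_on_sets_lebesgue\<close>)
  obtain B where B: "\<And>x. x \<in> {c..d} \<Longrightarrow> \<bar>\<phi>' x\<bar> \<le> B"
    using continuous_on_Icc_abs_bound[OF c'] by blast
  have "\<bar>?\<Phi>' x\<bar> \<le> max B 0" for x using B[of x] by auto
  then have 4: "bounded (range ?\<Phi>')"
    by (intro boundedI[where B = "max B 0"]) (elim rangeE, simp only: real_norm_def)
  have 5: "?\<Phi> a = 0" "?\<Phi> b = 0" using ends cd lt by (auto simp: order_antisym_conv dest: order_antisym)
  have "\<exists>S. finite S \<and> (\<forall>x. x \<notin> S \<longrightarrow> (?\<Phi> has_real_derivative ?\<Phi>' x) (at x))"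
    using 2 by (intro exI[of _ "{c, d}"]) blast
  then show ?thesis unfolding lip_test_def using 1 3 4 5 cd by auto
qed

lemma C1_compact_support_lip_test:
  assumes "\<phi> \<in> C1_compact_support {a..b}"
  shows "lip_test a b \<phi> (deriv \<phi>)"
proof -
  note C = C1_compact_supportD[OF assms]
  note out = C1_compact_support_deriv_outside[OF assms]
  have "continuous_on {a..b} (deriv \<phi>)" using C(2) continuous_on_subset by blast
  from compact_imp_bounded[OF compact_continuous_image[OF this compact_Icc]]
  obtain B where B: "\<And>x. x \<in> {a..b} \<Longrightarrow> \<bar>deriv \<phi> x\<bar> \<le> B"
    unfolding bounded_iff by force
  have "\<bar>deriv \<phi> x\<bar> \<le> max B 0" for x using B[of x] out[of x] by (cases "x \<in> {a..b}") auto
  then have "bounded (range (deriv \<phi>))" by (auto simp: bounded_iff intro!: exI[of _ "max B 0"])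
  moreover have "deriv \<phi> \<in> borel_measurable lebesgue"
    using C(2) by (simp add: borel_measurable_continuous_onI measurable_completion)
  moreover have "\<exists>S. finite S \<and> (\<forall>x. x \<notin> S \<longrightarrow> (\<phi> has_real_derivative deriv \<phi> x) (at x))"
    using C(1) by blast
  ultimately show ?thesis
    unfolding lip_test_def using C(3,4) out C1_compact_support_Icc_ends[OF assms] by blast
qed

lemma lebesgue_on_integral_AE_eq:
  fixes F F' :: "real \<Rightarrow> real"
  assumes I: "I \<in> sets lebesgue" "{a..b} \<subseteq> I" and out: "\<And>x. x \<in> I - {a..b} \<Longrightarrow> F' x = 0"
    and ai: "F' absolutely_integrable_on {a..b}"
    and F: "F \<in> borel_measurable (lebesgue_on I)" "AE x in lebesgue_on I. F x = F' x"
  shows "(LINT x|lebesgue_on I. F x) = integral {a..b} F'"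
proof -
  note E = lebesgue_on_integral_eq[OF I out ai]
  have "(LINT x|lebesgue_on I. F x) = (LINT x|lebesgue_on I. F' x)"
    by (rule integral_cong_AE) (use F E(2) in auto)
  then show ?thesis using E(1) by simp
qed

text \<open>Links a solution on the graph with the one-dimensional setting: \<open>V\<close> and
  \<open>r\<close> are everywhere bounded representatives of \<open>W + l\<close> and
  \<open>\<rho>\<close> on the edge.\<close>

locale edge_problem = graph_edge G e + edge_coeffs p K \<rho>\<^sub>0 R V r
  for G :: "('v, 'e) metric_graph" and e :: 'e and p K \<rho>\<^sub>0 R V r +
  fixes W \<rho> :: "('v, 'e) point \<Rightarrow> real" and l :: real and u :: "('v, 'e) point \<Rightarrow> real"
  assumes W_meas: "restrict_edge G W e \<in> borel_measurable (lebesgue_on (edge_interval G e))"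
    and \<rho>_meas: "restrict_edge G \<rho> e \<in> borel_measurable (lebesgue_on (edge_interval G e))"
    and V_eq: "AE x in lebesgue_on (edge_interval G e). restrict_edge G W e x + l = V x"
    and r_eq: "AE x in lebesgue_on (edge_interval G e). restrict_edge G \<rho> e x = r x"
    and u: "solves_E G p W \<rho> l u"
begin

abbreviation "w \<equiv> restrict_edge G u e"

lemma w_contI: "continuous_on I w"
  using u G e C_graph_restrict_continuous[of u G e] by (auto simp: solves_E_def H1_graph_def)

lemma w_measI: "w \<in> borel_measurable (lebesgue_on I)"
  by (rule continuous_imp_measurable_on_sets_lebesgue[OF w_contI I_meas])

lemma w_cont_on: "{a..b} \<subseteq> J \<Longrightarrow> continuous_on {a..b} w"
  using w_contI J_sub_I continuous_on_subset by blast

lemma w_weak_deriv: "edge_deriv G u e \<in> L2_on I" "has_weak_deriv I w (edge_deriv G u e)"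
proof -
  have "w \<in> H1_on I" using u e by (auto simp: solves_E_def H1_graph_def)
  then obtain g where "g \<in> L2_on I" "has_weak_deriv I w g" by (auto simp: H1_on_def)
  from weak_deriv_AE[OF w_contI this]
  show "edge_deriv G u e \<in> L2_on I" "has_weak_deriv I w (edge_deriv G u e)" by (auto simp: edge_deriv_def)
qed

lemma graph_integral_single_edge:
  assumes "\<And>e'. \<lbrakk>e' \<in> edges G; e' \<noteq> e\<rbrakk> \<Longrightarrow> AE x in lebesgue_on (edge_interval G e'). F e' x = 0"
  shows "graph_integral G F = (LINT x|lebesgue_on I. F e x)"
proof -
  have fin: "finite (edges G)" using G by (simp add: G_fin_def)
  have "(LINT x|lebesgue_on (edge_interval G e'). F e' x) = 0" if "e' \<in> edges G - {e}" for e'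
    using assms[of e'] that by (intro integral_eq_zero_AE) auto
  then show ?thesis
    unfolding graph_integral_def using sum.remove[OF fin e, of "\<lambda>e. LINT x|lebesgue_on (edge_interval G e). F e x"]
    by simp
qed

text \<open>A function supported in the open edge vanishes on all other edges, so the weak
  formulation on the graph becomes one on this edge, to which regularity applies.\<close>

lemma ex_edge_solution:
  assumes sub: "{a..b} \<subseteq> J" "a < b"
  shows "\<exists>dw. edge_solution p K \<rho>\<^sub>0 R V r w dw a b"
proof -
  obtain d1 where d1: "d1 > 0" "cball a d1 \<subseteq> J"
    using open_J sub open_contains_cball[of J] by (metis atLeastAtMost_iff less_imp_le order_refl subsetD)
  obtain d2 where d2: "d2 > 0" "cball b d2 \<subseteq> J"
    using open_J sub open_contains_cball[of J] by (metis atLeastAtMost_iff less_imp_le order_refl subsetD)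
  \<comment> \<open>The margin is needed because regularity gives two-sided derivatives only in the
    open interval, and they are wanted at \<open>a\<close> and \<open>b\<close> as well.\<close>
  define a' b' where "a' = a - d1" and "b' = b + d2"
  have ab': "a' < a" "b < b'" "a' < b'" using d1 d2 sub by (auto simp: a'_def b'_def)
  have "a' \<in> J" "b' \<in> J" using d1 d2 by (auto simp: a'_def b'_def dist_real_def subset_iff)
  then have subJ: "{a'..b'} \<subseteq> J" by (rule Icc_sub_J)
  then have subI: "{a'..b'} \<subseteq> I" using J_sub_I by blast
  note cw = w_cont_on[OF subJ]
  let ?g = "edge_deriv G u e" and ?f = "nl_rhs p V r w"
  note g = w_weak_deriv
  have gai: "?g absolutely_integrable_on {a'..b'}"
    by (rule L2_on_absolutely_integrable[OF g(1) subI I_meas])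
  have Vai: "(\<lambda>x. V x * h x) absolutely_integrable_on {a'..b'}"
    and rai: "(\<lambda>x. r x * h x) absolutely_integrable_on {a'..b'}" if "continuous_on {a'..b'} h" for h
    using bounded_measurable_times_continuous_integrable[OF V_meas V_le that]
      bounded_measurable_times_continuous_integrable[OF r_meas r_abs that] by auto
  have cpw: "continuous_on {a'..b'} (\<lambda>x. \<bar>w x\<bar> powr (p - 2) * w x)"
    by (intro continuous_intros continuous_on_pot cw)
  have fai: "?f absolutely_integrable_on {a'..b'}"
    unfolding nl_rhs_def by (intro set_integral_diff Vai rai cw cpw)
  have fm: "?f \<in> borel_measurable (lebesgue_on {a'..b'})"
    using fai by (intro integrable_imp_measurable) (auto simp: absolutely_integrable_on_def)
  obtain M where M: "\<And>x. x \<in> {a'..b'} \<Longrightarrow> \<bar>w x\<bar> \<le> M"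
    using continuous_on_Icc_abs_bound[OF cw] by blast
  have f_bd: "\<bar>?f x\<bar> \<le> K * M + R * (M powr (p - 2) * M)" if x: "x \<in> {a'..b'}" for x
    using M[OF x] by (rule nl_rhs_abs_le)
  have W2: "integral {a'..b'} (\<lambda>t. ?g t * deriv \<phi> t) + integral {a'..b'} (\<lambda>t. ?f t * \<phi> t) = 0"
    if \<phi>: "\<phi> \<in> C1_compact_support {a'..b'}" for \<phi>
  proof -
    have lt: "lip_test a' b' \<phi> (deriv \<phi>)" by (rule C1_compact_support_lip_test[OF \<phi>])
    note E = ext_edge_H1_graph[OF subJ less_imp_le[OF ab'(3)] lt]
    note C = C1_compact_supportD[OF \<phi>]
    have c\<phi>: "continuous_on {a'..b'} \<phi>" "continuous_on {a'..b'} (deriv \<phi>)"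
      using C(2,3) continuous_on_subset by blast+
    have out: "\<phi> x = 0" "deriv \<phi> x = 0" if "x \<notin> {a'..b'}" for x
      using lt that by (auto simp: lip_test_def)
    let ?\<phi> = "ext_edge e \<phi> :: ('v, 'e) point \<Rightarrow> real"
    let ?L = "\<lambda>e x. edge_deriv G u e x * edge_deriv G ?\<phi> e x +
          (restrict_edge G W e x + l) * restrict_edge G u e x * restrict_edge G ?\<phi> e x"
    let ?Rt = "\<lambda>e x. restrict_edge G \<rho> e x * \<bar>restrict_edge G u e x\<bar> powr (p - 2) *
          restrict_edge G u e x * restrict_edge G ?\<phi> e x"
    have \<phi>m: "\<phi> \<in> borel_measurable (lebesgue_on I)"
      by (rule continuous_imp_measurable_on_sets_lebesgue[OF _ I_meas]) (use C(3) continuous_on_subset in blast)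
    have [measurable]: "edge_deriv G u e \<in> borel_measurable (lebesgue_on I)"
      "edge_deriv G ?\<phi> e \<in> borel_measurable (lebesgue_on I)"
      using g(1) E(3) by (auto simp: L2_on_def)
    note [measurable] = W_meas \<rho>_meas w_measI \<phi>m
    have "graph_integral G ?L = (LINT x|lebesgue_on I. ?L e x)"
    proof (rule graph_integral_single_edge)
      fix e' assume e': "e' \<in> edges G" "e' \<noteq> e"
      show "AE x in lebesgue_on (edge_interval G e'). ?L e' x = 0"
        using E(6)[OF e'] by eventually_elim (simp add: E(5)[OF e'])
    qed
    also have "\<dots> = integral {a'..b'} (\<lambda>x. ?g x * deriv \<phi> x + V x * (w x * \<phi> x))"
    proof (rule lebesgue_on_integral_AE_eq[OF I_meas subI])
      show "(\<lambda>x. ?g x * deriv \<phi> x + V x * (w x * \<phi> x)) absolutely_integrable_on {a'..b'}"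
        by (intro set_integral_add absolutely_integrable_times_continuous gai c\<phi> Vai continuous_intros cw)
      show "AE x in lebesgue_on I. ?L e x = ?g x * deriv \<phi> x + V x * (w x * \<phi> x)"
        using E(2) V_eq by eventually_elim (simp add: E(4) mult.assoc)
      show "?L e \<in> borel_measurable (lebesgue_on I)" unfolding E(4) by measurable
    qed (use out in auto)
    finally have 1: "graph_integral G ?L = integral {a'..b'} (\<lambda>x. ?g x * deriv \<phi> x + V x * (w x * \<phi> x))" .
    have "graph_integral G ?Rt = (LINT x|lebesgue_on I. ?Rt e x)"
    proof (rule graph_integral_single_edge)
      fix e' assume e': "e' \<in> edges G" "e' \<noteq> e"
      show "AE x in lebesgue_on (edge_interval G e'). ?Rt e' x = 0" by (simp add: E(5)[OF e'])
    qed
    also have "\<dots> = integral {a'..b'} (\<lambda>x. r x * (\<bar>w x\<bar> powr (p - 2) * w x * \<phi> x))"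
    proof (rule lebesgue_on_integral_AE_eq[OF I_meas subI])
      show "(\<lambda>x. r x * (\<bar>w x\<bar> powr (p - 2) * w x * \<phi> x)) absolutely_integrable_on {a'..b'}"
        by (intro rai continuous_intros cpw c\<phi>)
      show "AE x in lebesgue_on I. ?Rt e x = r x * (\<bar>w x\<bar> powr (p - 2) * w x * \<phi> x)"
        using r_eq by eventually_elim (simp add: E(4) mult.assoc)
      show "?Rt e \<in> borel_measurable (lebesgue_on I)" unfolding E(4) by measurable
    qed (use out in auto)
    finally have 2: "graph_integral G ?Rt = integral {a'..b'} (\<lambda>x. r x * (\<bar>w x\<bar> powr (p - 2) * w x * \<phi> x))" .
    have eq: "graph_integral G ?L = graph_integral G ?Rt"
      using u E(1) unfolding solves_E_def by blast
    have i1: "(\<lambda>x. ?g x * deriv \<phi> x) integrable_on {a'..b'}"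
      using absolutely_integrable_times_continuous[OF gai c\<phi>(2)] by (simp add: absolutely_integrable_on_def)
    have i2: "(\<lambda>x. V x * (w x * \<phi> x)) integrable_on {a'..b'}"
      by (intro V_int continuous_intros cw c\<phi>)
    have i3: "(\<lambda>x. r x * (\<bar>w x\<bar> powr (p - 2) * w x * \<phi> x)) integrable_on {a'..b'}"
      by (intro r_int continuous_intros cpw c\<phi>)
    have "integral {a'..b'} (\<lambda>t. ?f t * \<phi> t) =
        integral {a'..b'} (\<lambda>x. V x * (w x * \<phi> x) - r x * (\<bar>w x\<bar> powr (p - 2) * w x * \<phi> x))"
      by (rule Henstock_Kurzweil_Integration.integral_cong) (simp add: nl_rhs_def left_diff_distrib mult.assoc)
    also have "\<dots> = integral {a'..b'} (\<lambda>x. V x * (w x * \<phi> x)) - integral {a'..b'} (\<lambda>x. r x * (\<bar>w x\<bar> powr (p - 2) * w x * \<phi> x))"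
      by (rule Henstock_Kurzweil_Integration.integral_diff[OF i2 i3])
    finally show ?thesis
      using eq unfolding 1 2 Henstock_Kurzweil_Integration.integral_add[OF i1 i2] by simp
  qed
  have W1: "integral {a'..b'} (\<lambda>t. w t * deriv \<phi> t) = - integral {a'..b'} (\<lambda>t. ?g t * \<phi> t)"
    if "\<phi> \<in> C1_compact_support {a'..b'}" for \<phi>
    by (rule weak_deriv_local[OF subJ w_contI g that])
  obtain dw where dw: "\<And>x. x \<in> {a'<..<b'} \<Longrightarrow> (w has_real_derivative dw x) (at x)"
    "\<And>x y. \<lbrakk>a' \<le> x; x \<le> y; y \<le> b'\<rbrakk> \<Longrightarrow> (?f has_integral (dw y - dw x)) {x..y}"
    using weak_solution_regular[OF ab'(3) cw gai fm f_bd W1 W2] by blast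
  have "edge_solution p K \<rho>\<^sub>0 R V r w dw a b"
    by unfold_locales (use dw ab' in auto)
  then show ?thesis by blast
qed

lemma second_variation_ext_edge:
  assumes sub: "{a..b} \<subseteq> J" "a \<le> b" and t: "lip_test a b \<phi> \<phi>'"
  shows "second_variation G p W \<rho> l u (ext_edge e \<phi>) = integral {a..b} (\<lambda>x. (\<phi>' x)\<^sup>2 + V x * (\<phi> x)\<^sup>2 -
     (p - 1) * r x * \<bar>w x\<bar> powr (p - 2) * (\<phi> x)\<^sup>2)"
proof -
  have subI: "{a..b} \<subseteq> I" using sub J_sub_I by blast
  note E = ext_edge_H1_graph[OF sub t]
  note cw = w_cont_on[OF sub(1)]
  have c: "continuous_on UNIV \<phi>" and out: "\<And>x. x \<notin> {a..b} \<Longrightarrow> \<phi> x = 0 \<and> \<phi>' x = 0"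
    using t by (auto simp: lip_test_def)
  have c\<phi>: "continuous_on {a..b} \<phi>" using c continuous_on_subset by blast
  have \<phi>m: "\<phi> \<in> borel_measurable (lebesgue_on I)"
    by (rule continuous_imp_measurable_on_sets_lebesgue[OF _ I_meas]) (use c continuous_on_subset in blast)
  let ?\<phi> = "ext_edge e \<phi> :: ('v, 'e) point \<Rightarrow> real"
  have [measurable]: "edge_deriv G ?\<phi> e \<in> borel_measurable (lebesgue_on I)"
    using E(3) by (auto simp: L2_on_def)
  note [measurable] = W_meas \<rho>_meas w_measI \<phi>m
  let ?L = "\<lambda>e x. \<bar>edge_deriv G ?\<phi> e x\<bar>\<^sup>2 +
       (restrict_edge G W e x + l) * (restrict_edge G ?\<phi> e x)\<^sup>2 -
       (p - 1) * restrict_edge G \<rho> e x * \<bar>restrict_edge G u e x\<bar> powr (p - 2) *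
         (restrict_edge G ?\<phi> e x)\<^sup>2"
  have "second_variation G p W \<rho> l u ?\<phi> = (LINT x|lebesgue_on I. ?L e x)"
    unfolding second_variation_def
  proof (rule graph_integral_single_edge)
    fix e' assume e': "e' \<in> edges G" "e' \<noteq> e"
    show "AE x in lebesgue_on (edge_interval G e'). ?L e' x = 0"
      using E(6)[OF e'] by eventually_elim (simp add: E(5)[OF e'])
  qed
  also have "\<dots> = integral {a..b} (\<lambda>x. (\<phi>' x)\<^sup>2 + V x * (\<phi> x)\<^sup>2 -
     (p - 1) * r x * \<bar>w x\<bar> powr (p - 2) * (\<phi> x)\<^sup>2)"
  proof (rule lebesgue_on_integral_AE_eq[OF I_meas subI])
    have "(\<lambda>x. (\<phi>' x)\<^sup>2 + V x * (\<phi> x)\<^sup>2 - r x * ((p - 1) * \<bar>w x\<bar> powr (p - 2) * (\<phi> x)\<^sup>2))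
        absolutely_integrable_on {a..b}"
      by (intro set_integral_diff set_integral_add lip_test_integrable[OF t]
          bounded_measurable_times_continuous_integrable[OF V_meas V_le]
          bounded_measurable_times_continuous_integrable[OF r_meas r_abs]
          continuous_intros continuous_on_pot cw c\<phi>)
    then show "(\<lambda>x. (\<phi>' x)\<^sup>2 + V x * (\<phi> x)\<^sup>2 - (p - 1) * r x * \<bar>w x\<bar> powr (p - 2) * (\<phi> x)\<^sup>2)
        absolutely_integrable_on {a..b}" by (simp only: mult.assoc mult.left_commute)
    show "AE x in lebesgue_on I. ?L e x = (\<phi>' x)\<^sup>2 + V x * (\<phi> x)\<^sup>2 -
        (p - 1) * r x * \<bar>w x\<bar> powr (p - 2) * (\<phi> x)\<^sup>2"
      using E(2) V_eq r_eq by eventually_elim (simp add: E(4))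
    show "?L e \<in> borel_measurable (lebesgue_on I)" unfolding E(4) by measurable
  qed (use out in auto)
  finally show ?thesis .
qed

end

lemma sum_fun_apply: "(\<Sum>i\<in>A. f i) x = (\<Sum>i\<in>A. (f i x :: real))"
  by (induction A rule: infinite_finite_induct) (auto simp: zero_fun_def)

context edge_problem
begin

text \<open>The zero extensions of the \<open>k\<close> negative directions overlap at most in
  endpoints, so the second variation of a combination with coefficients \<open>t\<close> is the
  diagonal form with terms \<open>(t i)\<^sup>2 * Q i\<close>, all \<open>Q i\<close> being
  negative. It is therefore negative definite on their span.\<close>

lemma disjoint_unstable_morse_index:
  assumes sub: "{a..b} \<subseteq> J" "a \<le> b" and un: "disjoint_unstable p V r w k a b"
  shows "enat k \<le> morse_index G p W \<rho> l u"
proof -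
  obtain c d where cd: "\<And>i. i < k \<Longrightarrow> a \<le> c i \<and> d i \<le> b \<and> unstable_on p V r w (c i) (d i)"
    and disj: "\<And>i j. \<lbrakk>i < k; j < k; i \<noteq> j\<rbrakk> \<Longrightarrow> d i \<le> c j \<or> d j \<le> c i"
    using un unfolding disjoint_unstable_def by blast
  have "\<exists>\<phi> \<phi>'. test_fun (c i) (d i) \<phi> \<phi>' \<and> quad_form p V r w (c i) (d i) \<phi> \<phi>' < 0" if "i < k" for i
    using cd[OF that] unfolding unstable_on_def by blast
  then obtain \<phi> \<phi>' where tf: "\<And>i. i < k \<Longrightarrow> test_fun (c i) (d i) (\<phi> i) (\<phi>' i)"
    and neg: "\<And>i. i < k \<Longrightarrow> quad_form p V r w (c i) (d i) (\<phi> i) (\<phi>' i) < 0" by metis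
  define \<Phi> where "\<Phi> = (\<lambda>i x. if x \<in> {c i..d i} then \<phi> i x else 0)"
  define \<Phi>' where "\<Phi>' = (\<lambda>i x. if x \<in> {c i..d i} then \<phi>' i x else 0)"
  define Q where "Q = (\<lambda>i. quad_form p V r w (c i) (d i) (\<phi> i) (\<phi>' i))"
  have lt: "lip_test a b (\<Phi> i) (\<Phi>' i)" if "i < k" for i
    unfolding \<Phi>_def \<Phi>'_def by (rule test_fun_lip_test[OF tf[OF that]]) (use cd[OF that] in auto)
  define q where "q = (\<lambda>f f' x. (f' x)\<^sup>2 + V x * (f x)\<^sup>2 - (p - 1) * r x * \<bar>w x\<bar> powr (p - 2) * (f x)\<^sup>2)"
  have qi: "(q (\<Phi> i) (\<Phi>' i) has_integral Q i) {a..b}" if i: "i < k" for i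
  proof -
    have sub': "{c i..d i} \<subseteq> {a..b}" using cd[OF i] by auto
    have "q (\<phi> i) (\<phi>' i) integrable_on {c i..d i}"
      unfolding q_def
      by (rule quad_form_integrable[OF w_cont_on test_fun_continuous[OF tf[OF i]]]) (use sub sub' in auto)
    then have "(q (\<phi> i) (\<phi>' i) has_integral Q i) {c i..d i}"
      unfolding Q_def quad_form_def q_def by (rule integrable_integral)
    then have "((\<lambda>x. if x \<in> {c i..d i} then q (\<phi> i) (\<phi>' i) x else 0) has_integral Q i) {a..b}"
      unfolding has_integral_restrict[OF sub'] .
    moreover have "(\<lambda>x. if x \<in> {c i..d i} then q (\<phi> i) (\<phi>' i) x else 0) = q (\<Phi> i) (\<Phi>' i)"
      by (auto simp: q_def \<Phi>_def \<Phi>'_def fun_eq_iff)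
    ultimately show ?thesis by simp
  qed
  let ?S = "\<lambda>t x. \<Sum>i<k. t i * \<Phi> i x" and ?S' = "\<lambda>t x. \<Sum>i<k. t i * \<Phi>' i x"
  have sv: "second_variation G p W \<rho> l u (ext_edge e (?S t)) = (\<Sum>i<k. (t i)\<^sup>2 * Q i)" for t
  proof -
    have int: "((\<lambda>x. \<Sum>i<k. (t i)\<^sup>2 * q (\<Phi> i) (\<Phi>' i) x) has_integral (\<Sum>i<k. (t i)\<^sup>2 * Q i)) {a..b}"
      by (intro has_integral_sum has_integral_mult_right qi) auto
    \<comment> \<open>Only at these finitely many endpoints can two of the functions meet; elsewhere
      at most one term of the sum is nonzero.\<close>
    have null: "negligible (c ` {..<k} \<union> d ` {..<k})" by (intro negligible_finite) auto
    have pw: "q (?S t) (?S' t) x = (\<Sum>i<k. (t i)\<^sup>2 * q (\<Phi> i) (\<Phi>' i) x)"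
      if x: "x \<in> {a..b} - (c ` {..<k} \<union> d ` {..<k})" for x
    proof (cases "\<exists>j<k. x \<in> {c j..d j}")
      case False
      then have "\<Phi> i x = 0" "\<Phi>' i x = 0" if "i < k" for i using that by (auto simp: \<Phi>_def \<Phi>'_def)
      then show ?thesis by (simp add: q_def)
    next
      case True
      then obtain j where j: "j < k" "x \<in> {c j..d j}" by blast
      have xj: "c j < x" "x < d j" using j x by (auto simp: less_le)
      have z: "\<Phi> i x = 0" "\<Phi>' i x = 0" if "i < k" "i \<noteq> j" for i
        using disj[OF that(1) j(1) that(2)] xj by (auto simp: \<Phi>_def \<Phi>'_def)
      have only: "(\<Sum>i<k. g i) = g j" if "\<And>i. \<lbrakk>i < k; i \<noteq> j\<rbrakk> \<Longrightarrow> g i = 0" for g :: "nat \<Rightarrow> real"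
        using sum.remove[of "{..<k}" j g] j(1) that by simp
      have e12: "?S t x = t j * \<Phi> j x" "?S' t x = t j * \<Phi>' j x"
        by (rule only; simp add: z)+
      have e3: "(\<Sum>i<k. (t i)\<^sup>2 * q (\<Phi> i) (\<Phi>' i) x) = (t j)\<^sup>2 * q (\<Phi> j) (\<Phi>' j) x"
        by (rule only) (simp add: z q_def)
      show ?thesis unfolding e3 unfolding q_def e12 by algebra
    qed
    have "(q (?S t) (?S' t) has_integral (\<Sum>i<k. (t i)\<^sup>2 * Q i)) {a..b}"
      by (rule has_integral_spike[OF null pw int])
    then have "integral {a..b} (q (?S t) (?S' t)) = (\<Sum>i<k. (t i)\<^sup>2 * Q i)" by (rule integral_unique)
    moreover have "lip_test a b (?S t) (?S' t)" by (rule lip_test_sum[OF lt])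
    ultimately show ?thesis using second_variation_ext_edge[OF sub] by (simp add: q_def)
  qed
  have sv_neg: "second_variation G p W \<rho> l u (ext_edge e (?S t)) < 0" if "i < k" "t i \<noteq> 0" for t i
  proof -
    have "0 < (\<Sum>i<k. - ((t i)\<^sup>2 * Q i))"
    proof (rule sum_pos2)
      show "0 < - ((t i)\<^sup>2 * Q i)" using neg[OF that(1)] that(2) by (simp add: Q_def mult_pos_neg)
      show "0 \<le> - ((t j)\<^sup>2 * Q j)" if "j \<in> {..<k}" for j
        using neg[of j] that by (simp add: Q_def mult_nonneg_nonpos)
    qed (use that in auto)
    then show ?thesis unfolding sv by (simp add: sum_negf)
  qed
  define \<Psi> :: "nat \<Rightarrow> ('v, 'e) point \<Rightarrow> real" where "\<Psi> = (\<lambda>i. ext_edge e (\<Phi> i))"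
  have comb: "(\<Sum>i<k. fun_scale (t i) (\<Psi> i)) = ext_edge e (?S t)" for t
  proof
    fix P :: "('v, 'e) point"
    show "(\<Sum>i<k. fun_scale (t i) (\<Psi> i)) P = ext_edge e (?S t) P"
      unfolding sum_fun_apply fun_scale_def \<Psi>_def by (cases P) (auto simp: ext_edge_def)
  qed
  have "ext_edge e (?S (\<lambda>i. 0)) = (0 :: ('v, 'e) point \<Rightarrow> real)"
    by (rule ext) (simp add: ext_edge_def split: point.splits)
  then have sv0: "second_variation G p W \<rho> l u 0 = 0" using sv[of "\<lambda>i. 0"] by simp
  \<comment> \<open>Negativity already gives linear independence: a vanishing combination has second
    variation 0, so no coefficient can be nonzero.\<close>
  have zero: "t i = 0" if "ext_edge e (?S t) = (0 :: ('v, 'e) point \<Rightarrow> real)" "i < k" for t i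
    using sv_neg[OF that(2), of t] that(1) sv0 by force
  have inj: "inj_on \<Psi> {..<k}"
  proof (rule inj_onI, rule ccontr)
    fix i j assume ij: "i \<in> {..<k}" "j \<in> {..<k}" "\<Psi> i = \<Psi> j" "i \<noteq> j"
    \<comment> \<open>Two equal functions would give a vanishing combination with coefficients 1 and
      -1.\<close>
    define t :: "nat \<Rightarrow> real" where "t = (\<lambda>n. if n = i then 1 else if n = j then - 1 else 0)"
    have "(\<Sum>n<k. fun_scale (t n) (\<Psi> n)) = (\<Sum>n\<in>{i, j}. fun_scale (t n) (\<Psi> n))"
      by (rule sum.mono_neutral_right) (use ij in \<open>auto simp: t_def fun_scale_def fun_eq_iff zero_fun_def\<close>)
    also have "\<dots> = 0" using ij by (simp add: t_def fun_scale_def fun_eq_iff plus_fun_def zero_fun_def)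
    finally have "t i = 0" using zero[of t i] ij unfolding comb by auto
    then show False by (simp add: t_def)
  qed
  let ?B = "\<Psi> ` {..<k}"
  have fin: "finite ?B" by simp
  have sum_B: "(\<Sum>v\<in>?B. fun_scale (g v) v) = ext_edge e (?S (\<lambda>i. g (\<Psi> i)))" for g
    unfolding comb[symmetric] using sum.reindex[OF inj, of "\<lambda>v. fun_scale (g v) v"] by simp
  have indep: "fun_vs.independent ?B"
  proof (rule fun_vs.independent_if_scalars_zero[OF fin])
    fix g v assume "(\<Sum>v\<in>?B. fun_scale (g v) v) = 0" "v \<in> ?B"
    then show "g v = 0" unfolding sum_B using zero[of "\<lambda>i. g (\<Psi> i)"] by auto
  qed
  define X where "X = fun_vs.span ?B"
  have X: "\<exists>t. \<psi> = ext_edge e (?S t)" if "\<psi> \<in> X" for \<psi>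
    using that unfolding X_def fun_vs.span_finite[OF fin] sum_B by auto
  have "X \<subseteq> H1_graph G \<inter> Cc_graph G"
  proof
    fix \<psi> assume "\<psi> \<in> X"
    then obtain t where "\<psi> = ext_edge e (?S t)" using X by blast
    then show "\<psi> \<in> H1_graph G \<inter> Cc_graph G"
      using ext_edge_H1_graph(1)[OF sub lip_test_sum[OF lt]] by simp
  qed
  moreover have "second_variation G p W \<rho> l u \<psi> < 0" if "\<psi> \<in> X - {0}" for \<psi>
  proof -
    obtain t where t: "\<psi> = ext_edge e (?S t)" using X \<open>\<psi> \<in> X - {0}\<close> by blast
    have "\<exists>i<k. t i \<noteq> 0"
    proof (rule ccontr)
      assume "\<not> ?thesis"
      then have "\<psi> = 0" unfolding t by (intro ext) (simp add: ext_edge_def split: point.splits)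
      then show False using that by simp
    qed
    then show ?thesis unfolding t using sv_neg by blast
  qed
  moreover have "fun_vs.subspace X" unfolding X_def by (rule fun_vs.subspace_span)
  moreover have "fun_edim X = enat k"
  proof -
    have "\<exists>B. finite B \<and> X \<subseteq> fun_vs.span B" using fin unfolding X_def by blast
    moreover have "fun_vs.dim X = k"
      unfolding X_def using fun_vs.dim_span_eq_card_independent[OF indep] card_image[OF inj] by simp
    ultimately show ?thesis by (simp add: fun_edim_def)
  qed
  ultimately show ?thesis
    unfolding morse_index_def by (intro Sup_upper CollectI exI[of _ X]) auto
qed

end


section \<open>Bounds on a single edge\<close>

text \<open>Interior estimates require a minimal length \<open>L\<close>, so the whole exhausting
  sequence has to stay at least that long; this is why \<open>2 * L\<close> must fit into the
  edge.\<close>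

lemma (in graph_edge) exhausting_intervals:
  assumes L: "0 < L" "ereal (2 * L) \<le> edge_length G e"
  shows "\<exists>a b :: nat \<Rightarrow> real. (\<forall>n. {a n..b n} \<subseteq> J) \<and> (\<forall>n. L \<le> b n - a n) \<and>
    (\<forall>x\<in>J. \<forall>\<^sub>F n in sequentially. x \<in> {a n..b n})"
proof (cases rule: edge_length_cases)
  case (1 l)
  \<comment> \<open>The shift by 4 cuts off at most a quarter of the edge at each end, leaving at
    least \<open>l / 2\<close>, which is at least \<open>L\<close>.\<close>
  define a where "a = (\<lambda>n. l / real (n + 4))"
  have a: "0 < a n" for n using 1 by (simp add: a_def)
  have a4: "a n \<le> l / 4" for n unfolding a_def by (rule divide_left_mono) (use 1 in auto)
  have lim: "a \<longlonglongrightarrow> 0" unfolding a_def by real_asymp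
  show ?thesis
  proof (rule exI[of _ a], rule exI[of _ "\<lambda>n. l - a n"], intro conjI allI ballI)
    show "{a n..l - a n} \<subseteq> J" for n using a[of n] 1 by auto
    show "L \<le> l - a n - a n" for n using a4[of n] 1 L by auto
    fix x assume "x \<in> J"
    then have "0 < x" "0 < l - x" using 1 by auto
    then have "\<forall>\<^sub>F n in sequentially. a n < x" "\<forall>\<^sub>F n in sequentially. a n < l - x"
      using lim by (auto intro: order_tendstoD)
    then show "\<forall>\<^sub>F n in sequentially. x \<in> {a n..l - a n}" by eventually_elim auto
  qed
next
  case 2
  define a where "a = (\<lambda>n. 1 / (real n + 1))"
  have a: "0 < a n" "a n \<le> 1" for n by (auto simp: a_def)
  have lim: "a \<longlonglongrightarrow> 0" unfolding a_def by real_asymp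
  show ?thesis
  proof (rule exI[of _ a], rule exI[of _ "\<lambda>n. real n + 1 + L"], intro conjI allI ballI)
    show "{a n..real n + 1 + L} \<subseteq> J" for n using a[of n] 2 by auto
    show "L \<le> real n + 1 + L - a n" for n using a[of n] by auto
    fix x assume "x \<in> J"
    then have "0 < x" using 2 by auto
    then have "\<forall>\<^sub>F n in sequentially. a n < x" using lim by (auto intro: order_tendstoD)
    moreover have "\<forall>\<^sub>F n in sequentially. x \<le> real n"
      using filterlim_real_sequentially by (simp add: filterlim_at_top)
    ultimately show "\<forall>\<^sub>F n in sequentially. x \<in> {a n..real n + 1 + L}"
      by eventually_elim (use L in auto)
  qed
qed

context edge_problem
begin

lemma not_disjoint_unstable:
  assumes "{a..b} \<subseteq> J" "a \<le> b" "morse_index G p W \<rho> l u \<le> enat m"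
  shows "\<not> disjoint_unstable p V r w (Suc m) a b"
proof
  assume "disjoint_unstable p V r w (Suc m) a b"
  from order_trans[OF disjoint_unstable_morse_index[OF assms(1,2) this] assms(3)] show False by simp
qed

lemma sup_bound_edge:
  assumes m: "morse_index G p W \<rho> l u \<le> enat m" and h: "0 < h" "h\<^sup>2 * K \<le> 1 / 2"
    and len: "ereal (4 * h) \<le> edge_length G e" and x: "x \<in> J"
  shows "\<bar>w x\<bar> \<le> window_const p \<rho>\<^sub>0 R (Suc m) * h powr (- 2 / (p - 2))"
proof -
  have "\<exists>a. x \<in> {a..a + h} \<and> {a..a + h} \<subseteq> J"
  proof (cases rule: edge_length_cases)
    case (1 k)
    show ?thesis
    proof (cases "x \<le> k / 2")
      case True
      then show ?thesis using 1 x h len by (intro exI[of _ x]) auto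
    next
      case False
      then show ?thesis using 1 x h len by (intro exI[of _ "x - h"]) auto
    qed
  next
    case 2
    then show ?thesis using x h by (intro exI[of _ x]) auto
  qed
  then obtain a where a: "x \<in> {a..a + h}" "{a..a + h} \<subseteq> J" by blast
  obtain dw where "edge_solution p K \<rho>\<^sub>0 R V r w dw a (a + h)"
    using ex_edge_solution[OF a(2)] h by auto
  then interpret edge_solution p K \<rho>\<^sub>0 R V r w dw a "a + h" .
  show ?thesis
    by (rule window_bound[OF h _ _ _ not_disjoint_unstable[OF a(2) _ m] a(1)]) (use h in auto)
qed

lemma square_integrableI: "integrable (lebesgue_on I) (\<lambda>x. (w x)\<^sup>2)"
  using u e by (auto simp: solves_E_def H1_graph_def H1_on_def L2_on_def)

text \<open>Membership in H1 makes \<open>w\<^sup>2\<close> integrable over the edge, so it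
  dominates its own restrictions to the exhausting intervals, and the uniform bound passes to the
  limit.\<close>

lemma L2_le_of_compact:
  assumes L: "0 < L" "ereal (2 * L) \<le> edge_length G e"
    and C: "\<And>a b. \<lbrakk>{a..b} \<subseteq> J; L \<le> b - a\<rbrakk> \<Longrightarrow> integral {a..b} (\<lambda>x. (w x)\<^sup>2) \<le> C"
  shows "(LINT x|lebesgue_on I. (w x)\<^sup>2) \<le> C"
proof -
  obtain a b where ab: "\<And>n. {a n..b n} \<subseteq> J" "\<And>n. L \<le> b n - a n"
    "\<And>x. x \<in> J \<Longrightarrow> \<forall>\<^sub>F n in sequentially. x \<in> {a n..b n}"
    using exhausting_intervals[OF L] by blast
  let ?s = "\<lambda>n x. indicator {a n..b n} x * (w x)\<^sup>2"
  have sm: "?s n \<in> borel_measurable (lebesgue_on I)" for n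
  proof -
    have "{a n..b n} \<in> sets lebesgue" by simp
    moreover have sub: "{a n..b n} \<subseteq> I" using ab(1) J_sub_I by blast
    ultimately have "{a n..b n} \<in> sets (lebesgue_on I)"
      using I_meas by (simp add: sets_restrict_space_iff)
    moreover have "{x \<in> space (lebesgue_on I). x \<in> {a n..b n}} = {a n..b n}"
      using sub by (auto simp: space_restrict_space)
    ultimately have "{x \<in> space (lebesgue_on I). x \<in> {a n..b n}} \<in> sets (lebesgue_on I)" by simp
    then have "indicator {a n..b n} \<in> borel_measurable (lebesgue_on I)"
      by (intro borel_measurable_indicator') auto
    then show ?thesis using w_measI by (intro borel_measurable_times borel_measurable_power)
  qed
  have AEJ: "AE x in lebesgue_on I. x \<in> J"
    by (rule AE_lebesgue_onI[OF negligible_I_minus_J _ I_meas]) auto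
  have "(\<lambda>n. LINT x|lebesgue_on I. ?s n x) \<longlonglongrightarrow> (LINT x|lebesgue_on I. (w x)\<^sup>2)"
  proof (rule integral_dominated_convergence[where w = "\<lambda>x. (w x)\<^sup>2"])
    show "AE x in lebesgue_on I. (\<lambda>n. ?s n x) \<longlonglongrightarrow> (w x)\<^sup>2"
      using AEJ
    proof eventually_elim
      fix x assume "x \<in> J"
      from ab(3)[OF this] have "\<forall>\<^sub>F n in sequentially. ?s n x = (w x)\<^sup>2"
        by eventually_elim (simp add: indicator_def)
      then show "(\<lambda>n. ?s n x) \<longlonglongrightarrow> (w x)\<^sup>2" by (rule tendsto_eventually)
    qed
    show "AE x in lebesgue_on I. norm (?s n x) \<le> (w x)\<^sup>2" for n
      by (intro AE_I2) (simp add: indicator_def)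
  qed (use square_integrableI sm w_measI in auto)
  moreover have "(LINT x|lebesgue_on I. ?s n x) \<le> C" for n
  proof -
    have sub: "{a n..b n} \<subseteq> I" using ab(1) J_sub_I by blast
    have "(LINT x|lebesgue_on I. ?s n x) = integral {a n..b n} (?s n)"
    proof (rule lebesgue_on_integral_eq(1)[OF I_meas sub])
      have "(\<lambda>x. (w x)\<^sup>2) absolutely_integrable_on {a n..b n}"
        by (intro absolutely_integrable_continuous_real continuous_intros w_cont_on ab(1))
      then show "?s n absolutely_integrable_on {a n..b n}"
        by (rule set_integrable_cong[THEN iffD1, rotated -1]) auto
    qed auto
    also have "\<dots> = integral {a n..b n} (\<lambda>x. (w x)\<^sup>2)"
      by (rule Henstock_Kurzweil_Integration.integral_cong) auto
    also have "\<dots> \<le> C" by (rule C[OF ab(1,2)])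
    finally show ?thesis .
  qed
  ultimately show ?thesis by (intro LIMSEQ_le_const2) auto
qed

lemma L2_le_of_sup:
  assumes k: "edge_length G e = ereal k" and C: "\<And>x. x \<in> J \<Longrightarrow> \<bar>w x\<bar> \<le> C"
  shows "(LINT x|lebesgue_on I. (w x)\<^sup>2) \<le> C\<^sup>2 * k"
proof (rule L2_le_of_compact)
  have k0: "k > 0" and Jk: "J = {0<..<k}" using k by (cases rule: edge_length_cases; auto)+
  show "0 < k / 2" "ereal (2 * (k / 2)) \<le> edge_length G e" using k k0 by auto
  fix a b assume ab: "{a..b} \<subseteq> J" "k / 2 \<le> b - a"
  have "a \<in> J" "b \<in> J" using ab k0 by auto
  then have ab': "b - a \<le> k" unfolding Jk by auto
  have "integral {a..b} (\<lambda>x. (w x)\<^sup>2) \<le> integral {a..b} (\<lambda>x. C\<^sup>2)"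
  proof (rule integral_le)
    show "(\<lambda>x. (w x)\<^sup>2) integrable_on {a..b}"
      by (intro integrable_continuous_real continuous_intros w_cont_on ab)
    fix x assume "x \<in> {a..b}"
    then have "\<bar>w x\<bar> \<le> C" using C ab by blast
    then show "(w x)\<^sup>2 \<le> C\<^sup>2" using power_mono[of "\<bar>w x\<bar>" C 2] by simp
  qed auto
  also have "\<dots> = C\<^sup>2 * (b - a)" using ab k0 by simp
  also have "\<dots> \<le> C\<^sup>2 * k" using ab' by (intro mult_left_mono) auto
  finally show "integral {a..b} (\<lambda>x. (w x)\<^sup>2) \<le> C\<^sup>2 * k" .
qed

lemma L2_le_mass:
  assumes m: "morse_index G p W \<rho> l u \<le> enat m" and \<kappa>: "0 < \<kappa>" "\<And>x. \<kappa> / 2 \<le> V x" "K \<le> 2 * \<kappa>"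
    and len: "ereal (2 * (sqrt (27 * (p - 1) / (p - 2)) / sqrt \<kappa>)) \<le> edge_length G e"
  shows "(LINT x|lebesgue_on I. (w x)\<^sup>2) \<le>
    mass_const p \<rho>\<^sub>0 R (Suc m) * \<kappa> powr ((6 - p) / (2 * (p - 2)))"
proof (rule L2_le_of_compact[OF _ len])
  let ?L = "sqrt (27 * (p - 1) / (p - 2)) / sqrt \<kappa>"
  show L0: "0 < ?L" using p \<kappa> by simp
  fix a b assume ab: "{a..b} \<subseteq> J" "?L \<le> b - a"
  have lt: "a < b" using ab(2) L0 by linarith
  obtain dw where "edge_solution p K \<rho>\<^sub>0 R V r w dw a b" using ex_edge_solution[OF ab(1) lt] by blast
  then interpret edge_solution p K \<rho>\<^sub>0 R V r w dw a b .
  show "integral {a..b} (\<lambda>x. (w x)\<^sup>2) \<le>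
      mass_const p \<rho>\<^sub>0 R (Suc m) * \<kappa> powr ((6 - p) / (2 * (p - 2)))"
  proof (rule square_integral_bound[OF \<kappa> _ _ not_disjoint_unstable[OF ab(1) less_imp_le[OF lt] m]])
    show "sqrt (27 * (p - 1) / (p - 2)) \<le> (b - a) * sqrt \<kappa>"
      using ab(2) \<kappa>(1) by (simp add: pos_divide_le_eq)
  qed simp
qed

lemma esssup_le_of_sup:
  assumes "\<And>x. x \<in> J \<Longrightarrow> \<bar>w x\<bar> \<le> C"
  shows "esssup (lebesgue_on I) (\<lambda>x. ereal \<bar>w x\<bar>) \<le> ereal C"
proof (rule esssup_I)
  show "(\<lambda>x. ereal \<bar>w x\<bar>) \<in> borel_measurable (lebesgue_on I)"
    using w_measI by measurable
  show "AE x in lebesgue_on I. ereal \<bar>w x\<bar> \<le> ereal C"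
    by (rule AE_lebesgue_onI[OF negligible_I_minus_J _ I_meas]) (use assms in auto)
qed

end

text \<open>The coefficients are clamped to their almost everywhere bounds. This changes them on a
  null set of the edge and also supplies bounded values outside it.\<close>

lemma edge_problem_core:
  assumes G: "G \<in> G_fin" and e: "e \<in> edges G" and p: "p > 2"
    and Linf: "W \<in> Linf_graph G" "\<rho> \<in> Linf_graph G"
    and W: "AE x in lebesgue_on (edge_interval G e). \<bar>restrict_edge G W e x\<bar> \<le> KW" and KW: "0 \<le> KW"
    and \<rho>: "AE x in lebesgue_on (edge_interval G e). \<rho>\<^sub>0 \<le> restrict_edge G \<rho> e x \<and> restrict_edge G \<rho> e x \<le> R"
    and \<rho>\<^sub>0: "0 < \<rho>\<^sub>0" "\<rho>\<^sub>0 \<le> R" and K: "\<bar>l\<bar> + KW \<le> K" and u: "solves_E G p W \<rho> l u"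
  obtains V r where "edge_problem G e p K \<rho>\<^sub>0 R V r W \<rho> l u" "\<And>x. l - KW \<le> V x"
proof -
  interpret graph_edge G e by unfold_locales (use G e in auto)
  define V where "V = (\<lambda>x. l + max (- KW) (min KW (if x \<in> I then restrict_edge G W e x else 0)))"
  define r where "r = (\<lambda>x. max \<rho>\<^sub>0 (min R (if x \<in> I then restrict_edge G \<rho> e x else 0)))"
  have m: "restrict_edge G W e \<in> borel_measurable (lebesgue_on I)"
    "restrict_edge G \<rho> e \<in> borel_measurable (lebesgue_on I)"
    using Linf e by (auto simp: Linf_graph_def)
  have "edge_problem G e p K \<rho>\<^sub>0 R V r W \<rho> l u"
  proof unfold_locales
    have "(\<lambda>x. if x \<in> I then restrict_edge G W e x else 0) \<in> borel_measurable lebesgue"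
      by (rule borel_measurable_if_I[OF m(1) I_meas])
    then show "V \<in> borel_measurable lebesgue" unfolding V_def by measurable
    have "(\<lambda>x. if x \<in> I then restrict_edge G \<rho> e x else 0) \<in> borel_measurable lebesgue"
      by (rule borel_measurable_if_I[OF m(2) I_meas])
    then show "r \<in> borel_measurable lebesgue" unfolding r_def by measurable
    show "\<bar>V x\<bar> \<le> K" for x using K KW by (auto simp: V_def)
    show "\<rho>\<^sub>0 \<le> r x" "r x \<le> R" for x using \<rho>\<^sub>0 by (auto simp: r_def)
    have inI: "AE x in lebesgue_on I. x \<in> I" by (rule AE_I2) (simp add: space_restrict_space)
    show "AE x in lebesgue_on I. restrict_edge G W e x + l = V x"
      using W inI by eventually_elim (auto simp: V_def)
    show "AE x in lebesgue_on I. restrict_edge G \<rho> e x = r x"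
      using \<rho> inI by eventually_elim (auto simp: r_def)
  qed (use p \<rho>\<^sub>0 m u in auto)
  moreover have "l - KW \<le> V x" for x using KW by (auto simp: V_def)
  ultimately show ?thesis using that by blast
qed

lemma edge_problem_half_line:
  assumes G: "G \<in> G_fin" and e: "e \<in> edges G" and p: "p > 2"
    and Linf: "W \<in> Linf_graph G" "\<rho> \<in> Linf_graph G"
    and W: "AE x in lebesgue_on (edge_interval G e). restrict_edge G W e x = 0"
    and \<rho>: "AE x in lebesgue_on (edge_interval G e). restrict_edge G \<rho> e x = 1"
    and \<rho>\<^sub>0: "0 < \<rho>\<^sub>0" "\<rho>\<^sub>0 \<le> 1" "1 \<le> R" and K: "\<bar>l\<bar> \<le> K" and u: "solves_E G p W \<rho> l u"
  shows "edge_problem G e p K \<rho>\<^sub>0 R (\<lambda>x. l) (\<lambda>x. 1) W \<rho> l u"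
proof -
  interpret graph_edge G e by unfold_locales (use G e in auto)
  show ?thesis
  proof unfold_locales
    show "AE x in lebesgue_on I. restrict_edge G W e x + l = l" using W by eventually_elim simp
  qed (use assms in \<open>auto simp: Linf_graph_def\<close>)
qed

text \<open>The instability of long intervals under a negative potential does not depend on the
  solution, so for negative \<open>l\<close> even the zero solution has infinite Morse
  index.\<close>

lemma half_line_negative_no_solution:
  assumes "edge_problem G e p K \<rho>\<^sub>0 R (\<lambda>x. l) (\<lambda>x. 1) W \<rho> l u"
    and len: "edge_length G e = \<infinity>" and l: "l < 0"
  shows "\<not> morse_index G p W \<rho> l u \<le> enat m"
proof
  assume m: "morse_index G p W \<rho> l u \<le> enat m"
  interpret edge_problem G e p K \<rho>\<^sub>0 R "\<lambda>x. l" "\<lambda>x. 1" W \<rho> l u by fact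
  have J: "J = {0<..}" using len by (auto simp: edge_interior_def)
  \<comment> \<open>Then \<open>(- l) * L = - l + 11 > 10\<close>, and \<open>L \<ge> 1\<close>
    allows \<open>L\<close> to be replaced by its square.\<close>
  define L where "L = 1 + 11 / (- l)"
  have L: "1 \<le> L" "10 < (- l) * L\<^sup>2"
  proof -
    show L1: "1 \<le> L" using l by (simp add: L_def field_simps)
    have "10 < (- l) * L" using l by (simp add: L_def field_simps)
    also have "\<dots> \<le> (- l) * L\<^sup>2"
      using l L1 by (intro mult_left_mono) (auto simp: power2_eq_square)
    finally show "10 < (- l) * L\<^sup>2" .
  qed
  define c where "c = (\<lambda>i. 1 + real i * L)"
  have cSuc: "c (Suc i) = c i + L" for i by (simp add: c_def algebra_simps)
  have c1: "1 \<le> c i" for i using L by (simp add: c_def)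
  have c_mono: "c i \<le> c j" if "i \<le> j" for i j
    unfolding c_def using that L by (auto intro!: mult_right_mono)
  have un: "unstable_on p (\<lambda>x. l) (\<lambda>x. 1) w (c i) (c (Suc i))" for i
  proof (rule unstable_on_negative_potential[where \<mu> = "- l"])
    have "0 < c i" using c1[of i] by linarith
    then have "{c i..c (Suc i)} \<subseteq> J" unfolding J by auto
    then show "continuous_on {c i..c (Suc i)} w" by (rule w_cont_on)
    show "c i < c (Suc i)" using cSuc[of i] L(1) by linarith
    have "c (Suc i) - c i = L" using cSuc[of i] by simp
    then show "10 < - l * (c (Suc i) - c i)\<^sup>2" using L(2) by (simp only:)
  qed simp
  have "disjoint_unstable p (\<lambda>x. l) (\<lambda>x. 1) w (card {..<Suc m}) 1 (c (Suc m))"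
  proof (rule disjoint_unstable_family[where c = c and d = "\<lambda>i. c (Suc i)"])
    fix i assume "i \<in> {..<Suc m}"
    then show "1 \<le> c i \<and> c (Suc i) \<le> c (Suc m) \<and> unstable_on p (\<lambda>x. l) (\<lambda>x. 1) w (c i) (c (Suc i))"
      using c1[of i] un[of i] c_mono[of "Suc i" "Suc m"] by simp
  next
    fix i j :: nat assume "i \<noteq> j"
    then have "Suc i \<le> j \<or> Suc j \<le> i" by auto
    then show "c (Suc i) \<le> c j \<or> c (Suc j) \<le> c i" using c_mono[of "Suc i" j] c_mono[of "Suc j" i] by linarith
  qed simp
  then have "disjoint_unstable p (\<lambda>x. l) (\<lambda>x. 1) w (Suc m) 1 (c (Suc m))" by simp
  moreover have "{1..c (Suc m)} \<subseteq> J" unfolding J by auto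
  ultimately show False using not_disjoint_unstable[OF _ c1 m] by blast
qed

text \<open>With \<open>K = 0\<close> the smallness condition on \<open>h\<^sup>2 * K\<close> is
  empty, and every window length fits into a half-line.\<close>

lemma half_line_zero_solution:
  assumes "edge_problem G e p 0 \<rho>\<^sub>0 R (\<lambda>x. 0) (\<lambda>x. 1) W \<rho> 0 u"
    and len: "edge_length G e = \<infinity>" and m: "morse_index G p W \<rho> 0 u \<le> enat m"
    and x: "x \<in> edge_interval G e"
  shows "restrict_edge G u e x = 0"
proof -
  interpret edge_problem G e p 0 \<rho>\<^sub>0 R "\<lambda>x. 0" "\<lambda>x. 1" W \<rho> 0 u by fact
  have I: "I = {0..}" and J: "J = {0<..}" using len by (auto simp: edge_interior_def edge_interval_def)
  have z: "w y = 0" if y: "y \<in> J" for y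
  proof -
    let ?C = "window_const p \<rho>\<^sub>0 R (Suc m)"
    have "((\<lambda>h. ?C * h powr (- 2 / (p - 2))) \<longlongrightarrow> ?C * 0) at_top"
      using p by (intro tendsto_mult tendsto_const tendsto_neg_powr) (auto simp: filterlim_ident)
    moreover have "\<forall>\<^sub>F h in at_top. \<bar>w y\<bar> \<le> ?C * h powr (- 2 / (p - 2))"
      using eventually_gt_at_top[of 0]
      by eventually_elim (rule sup_bound_edge[OF m _ _ _ y], use len in auto)
    ultimately have "\<bar>w y\<bar> \<le> ?C * 0"
      by (intro tendsto_lowerbound[of _ _ at_top]) auto
    then show ?thesis by simp
  qed
  \<comment> \<open>The sup bound concerns interior points only; the vertex of the half-line follows
    by continuity.\<close>
  have "w y = 0" if "y \<in> {0..1}" for y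
  proof (rule continuous_zero_off_negligible[of 0 1 w "{0}"])
    show "continuous_on {0..1} w" using w_contI I continuous_on_subset by fastforce
    show "w t = 0" if "t \<in> {0..1} - {0}" for t using z[of t] that J by auto
  qed (use that in auto)
  then show ?thesis using z[of x] x I J by (cases "x = 0") auto
qed


section \<open>Summation over the edges\<close>

lemma ereal_finite_pos_lower_bound:
  fixes f :: "'a \<Rightarrow> ereal"
  assumes "finite A" "\<And>x. x \<in> A \<Longrightarrow> 0 < f x"
  shows "\<exists>c>0. \<forall>x\<in>A. ereal c \<le> f x"
  using assms
proof (induction A rule: finite_induct)
  case empty
  then show ?case by (auto intro: exI[of _ 1])
next
  case (insert x A)
  then obtain c where c: "c > 0" "\<forall>y\<in>A. ereal c \<le> f y" by auto
  have "0 < f x" using insert by simp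
  then obtain d where d: "0 < ereal d" "ereal d < f x" using ereal_dense2 by blast
  show ?case
  proof (intro exI[of _ "min c d"] conjI ballI)
    show "0 < min c d" using c d by simp
    fix y assume "y \<in> insert x A"
    then consider "y = x" | "y \<in> A" by blast
    then show "ereal (min c d) \<le> f y"
    proof cases
      case 1
      have "ereal (min c d) \<le> ereal d" by simp
      then show ?thesis using 1 d(2) by (meson less_imp_le order_trans)
    next
      case 2
      have "ereal (min c d) \<le> ereal c" by simp
      then show ?thesis using 2 c(2) by (meson order_trans)
    qed
  qed
qed

lemma Linf_graph_AE_bound:
  assumes "f \<in> Linf_graph G"
  shows "\<exists>K\<ge>0. \<forall>e\<in>edges G. AE x in lebesgue_on (edge_interval G e). \<bar>restrict_edge G f e x\<bar> \<le> K"
proof -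
  have "Linf_norm_graph G f < \<infinity>" using assms by (simp add: Linf_graph_def)
  then obtain K where K: "Linf_norm_graph G f \<le> ereal K"
    by (cases "Linf_norm_graph G f") auto
  have "AE x in lebesgue_on (edge_interval G e). \<bar>restrict_edge G f e x\<bar> \<le> max K 0" if e: "e \<in> edges G" for e
  proof -
    have "esssup (lebesgue_on (edge_interval G e)) (\<lambda>x. ereal \<bar>restrict_edge G f e x\<bar>) \<le> Linf_norm_graph G f"
      unfolding Linf_norm_graph_def by (rule SUP_upper[OF e])
    then have le: "esssup (lebesgue_on (edge_interval G e)) (\<lambda>x. ereal \<bar>restrict_edge G f e x\<bar>) \<le> ereal K"
      using K by (rule order_trans)
    show ?thesis
      using esssup_AE[of "\<lambda>x. ereal \<bar>restrict_edge G f e x\<bar>" "lebesgue_on (edge_interval G e)"]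
    proof eventually_elim
      fix x assume "ereal \<bar>restrict_edge G f e x\<bar> \<le>
        esssup (lebesgue_on (edge_interval G e)) (\<lambda>x. ereal \<bar>restrict_edge G f e x\<bar>)"
      from order_trans[OF this le] show "\<bar>restrict_edge G f e x\<bar> \<le> max K 0" by simp
    qed
  qed
  then show ?thesis by (intro exI[of _ "max K 0"]) auto
qed

lemma core_ess_inf_AE_bound:
  assumes "0 < core_ess_inf G f"
  shows "\<exists>c>0. \<forall>e\<in>bounded_edges G. AE x in lebesgue_on (edge_interval G e). c \<le> restrict_edge G f e x"
proof -
  \<comment> \<open>The infimum is infinite when there are no bounded edges, so a finite number
    strictly below it is taken.\<close>
  obtain c where c: "0 < ereal c" "ereal c < core_ess_inf G f" using assms ereal_dense2 by blast
  have "AE x in lebesgue_on (edge_interval G e). c \<le> restrict_edge G f e x" if e: "e \<in> bounded_edges G" for e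
  proof -
    let ?s = "esssup (lebesgue_on (edge_interval G e)) (\<lambda>x. - ereal (restrict_edge G f e x))"
    have "core_ess_inf G f \<le> - ?s"
      unfolding core_ess_inf_def ess_inf_def[symmetric] by (rule INF_lower[OF e])
    then have "ereal c \<le> - ?s" using c(2) by (meson less_imp_le order_trans)
    then have "- (- ?s) \<le> - ereal c" by (simp only: ereal_minus_le_minus)
    then have le: "?s \<le> - ereal c" by simp
    show ?thesis
      using esssup_AE[of "\<lambda>x. - ereal (restrict_edge G f e x)" "lebesgue_on (edge_interval G e)"]
    proof eventually_elim
      fix x assume "- ereal (restrict_edge G f e x) \<le> ?s"
      from order_trans[OF this le] show "c \<le> restrict_edge G f e x" by simp
    qed
  qed
  then show ?thesis using c(1) by auto
qed

lemma q_mass_le: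
  assumes "0 \<le> X"
    and "\<And>u. \<lbrakk>solves_E G p W \<rho> l u; morse_index G p W \<rho> l u \<le> enat m\<rbrakk> \<Longrightarrow> L2_norm_graph G u \<le> X"
  shows "q_mass G p W \<rho> m l \<le> ereal X"
  unfolding q_mass_def Let_def using assms by (auto intro!: SUP_least)

lemma half_line_iff: "\<lbrakk>G \<in> G_fin; e \<in> edges G\<rbrakk> \<Longrightarrow> e \<in> half_lines G \<or> e \<in> bounded_edges G"
  by (auto simp: half_lines_def bounded_edges_def less_top[symmetric])

text \<open>Here \<Lambda> is an enlarged threshold. For \<open>l \<ge> \<Lambda>\<close> the second
  condition on it gives \<open>l / 2 \<le> W + l\<close>, and the third makes the shortest edge at
  least twice as long as the length required by the mass bound.\<close>

locale half_line_problem =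
  fixes G :: "('v, 'e) metric_graph" and p :: real and m :: nat and W \<rho> :: "('v, 'e) point \<Rightarrow> real"
    and KW \<rho>\<^sub>0 R lm \<Lambda> :: real
  assumes G: "G \<in> G_fin" and half: "half_lines G \<noteq> {}" and p: "p > 2"
    and W: "W \<in> Linf_graph G" and \<rho>: "\<rho> \<in> Linf_graph G"
    and W_half: "\<And>e. e \<in> half_lines G \<Longrightarrow> AE x in lebesgue_on (edge_interval G e). restrict_edge G W e x = 0"
    and \<rho>_half: "\<And>e. e \<in> half_lines G \<Longrightarrow> AE x in lebesgue_on (edge_interval G e). restrict_edge G \<rho> e x = 1"
    and KW: "0 \<le> KW" "\<And>e. e \<in> edges G \<Longrightarrow> AE x in lebesgue_on (edge_interval G e). \<bar>restrict_edge G W e x\<bar> \<le> KW"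
    and \<rho>\<^sub>0: "0 < \<rho>\<^sub>0" "\<rho>\<^sub>0 \<le> 1" "1 \<le> R"
    and \<rho>_core: "\<And>e. e \<in> bounded_edges G \<Longrightarrow> AE x in lebesgue_on (edge_interval G e).
      \<rho>\<^sub>0 \<le> restrict_edge G \<rho> e x \<and> restrict_edge G \<rho> e x \<le> R"
    and lm: "0 < lm" "\<And>e. e \<in> edges G \<Longrightarrow> ereal lm \<le> edge_length G e"
    and \<Lambda>: "0 < \<Lambda>" "2 * KW \<le> \<Lambda>" "(2 * sqrt (27 * (p - 1) / (p - 2)) / lm)\<^sup>2 \<le> \<Lambda>"
begin

abbreviation admissible :: "real \<Rightarrow> (('v, 'e) point \<Rightarrow> real) \<Rightarrow> bool" where
  "admissible l u \<equiv> solves_E G p W \<rho> l u \<and> morse_index G p W \<rho> l u \<le> enat m"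

lemma half_line_edge: "e \<in> half_lines G \<Longrightarrow> e \<in> edges G \<and> edge_length G e = \<infinity>"
  by (simp add: half_lines_def)

lemma half_line_edge_problem:
  assumes "e \<in> half_lines G" "solves_E G p W \<rho> l u" "\<bar>l\<bar> \<le> K"
  shows "edge_problem G e p K \<rho>\<^sub>0 R (\<lambda>x. l) (\<lambda>x. 1) W \<rho> l u"
  by (rule edge_problem_half_line[OF G _ p W \<rho> W_half \<rho>_half \<rho>\<^sub>0 assms(3,2)])
    (use assms(1) half_line_edge in auto)

lemma ex_edge_problem:
  assumes e: "e \<in> edges G" and u: "solves_E G p W \<rho> l u" and K: "\<bar>l\<bar> + KW \<le> K"
  shows "\<exists>V r. edge_problem G e p K \<rho>\<^sub>0 R V r W \<rho> l u \<and> (\<forall>x. l - KW \<le> V x)"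
proof (cases "e \<in> half_lines G")
  case True
  have "edge_problem G e p K \<rho>\<^sub>0 R (\<lambda>x. l) (\<lambda>x. 1) W \<rho> l u"
    by (rule half_line_edge_problem[OF True u]) (use K KW in simp)
  then show ?thesis using KW(1) by fastforce
next
  case False
  then have eb: "e \<in> bounded_edges G" using half_line_iff[OF G e] by blast
  have "\<rho>\<^sub>0 \<le> R" using \<rho>\<^sub>0 by simp
  from edge_problem_core[OF G e p W \<rho> KW(2)[OF e] KW(1) \<rho>_core[OF eb] \<rho>\<^sub>0(1) this K u]
  show ?thesis by blast
qed

text \<open>The window length is limited by the shortest edge, where \<open>4 * h\<close> must fit,
  and by \<open>h\<^sup>2 * (KW + \<Lambda>) \<le> 1 / 2\<close>. The absolute value makes the
  constant nonnegative by form.\<close>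

definition sup_const :: real where
  "sup_const = \<bar>window_const p \<rho>\<^sub>0 R (Suc m) *
     (min (lm / 4) (1 / sqrt (2 * (KW + \<Lambda>)))) powr (- 2 / (p - 2))\<bar>"

lemma sup_le:
  assumes eE: "e \<in> edges G" and l: "0 \<le> l" "l \<le> \<Lambda>" and adm: "admissible l u" and x: "x \<in> edge_interior G e"
  shows "\<bar>restrict_edge G u e x\<bar> \<le> sup_const"
proof -
  obtain V r where "edge_problem G e p (KW + \<Lambda>) \<rho>\<^sub>0 R V r W \<rho> l u"
    using ex_edge_problem[OF eE, of l u "KW + \<Lambda>"] adm l by auto
  then interpret edge_problem G e p "KW + \<Lambda>" \<rho>\<^sub>0 R V r W \<rho> l u .
  define h where "h = min (lm / 4) (1 / sqrt (2 * (KW + \<Lambda>)))"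
  have K: "0 < KW + \<Lambda>" using KW(1) \<Lambda>(1) by simp
  have h: "0 < h" using lm K by (simp add: h_def)
  have "h\<^sup>2 \<le> (1 / sqrt (2 * (KW + \<Lambda>)))\<^sup>2" by (intro power_mono) (use h in \<open>auto simp: h_def\<close>)
  also have "\<dots> = 1 / (2 * (KW + \<Lambda>))" using K by (simp add: power_divide)
  finally have hK: "h\<^sup>2 * (KW + \<Lambda>) \<le> 1 / 2" using K by (simp add: field_simps)
  have "ereal (4 * h) \<le> ereal lm" by (simp add: h_def)
  then have len: "ereal (4 * h) \<le> edge_length G e" using lm(2)[OF eE] by (rule order_trans)
  have "\<bar>w x\<bar> \<le> window_const p \<rho>\<^sub>0 R (Suc m) * h powr (- 2 / (p - 2))"
    by (rule sup_bound_edge[OF _ h hK len x]) (use adm in blast)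
  then show ?thesis unfolding sup_const_def h_def by linarith
qed

lemma Linf_le:
  assumes l: "0 \<le> l" "l \<le> \<Lambda>" and adm: "admissible l u"
  shows "Linf_norm_graph G u \<le> ereal sup_const"
  unfolding Linf_norm_graph_def
proof (rule SUP_least)
  fix e assume eE: "e \<in> edges G"
  obtain V r where "edge_problem G e p (KW + \<Lambda>) \<rho>\<^sub>0 R V r W \<rho> l u"
    using ex_edge_problem[OF eE, of l u "KW + \<Lambda>"] adm l by auto
  then interpret edge_problem G e p "KW + \<Lambda>" \<rho>\<^sub>0 R V r W \<rho> l u .
  show "esssup (lebesgue_on (edge_interval G e)) (\<lambda>x. ereal \<bar>restrict_edge G u e x\<bar>) \<le> ereal sup_const"
    by (rule esssup_le_of_sup[OF sup_le[OF eE l adm]])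
qed

lemma no_solution_negative:
  assumes "l < 0" shows "\<not> admissible l u"
proof
  assume u: "admissible l u"
  obtain e where e: "e \<in> half_lines G" using half by blast
  have "edge_problem G e p \<bar>l\<bar> \<rho>\<^sub>0 R (\<lambda>x. l) (\<lambda>x. 1) W \<rho> l u"
    by (rule half_line_edge_problem[OF e]) (use u in auto)
  from half_line_negative_no_solution[OF this _ assms] show False using u half_line_edge[OF e] by blast
qed

lemma zero_on_half_line:
  assumes "admissible 0 u" "e \<in> half_lines G" "x \<in> edge_interval G e"
  shows "restrict_edge G u e x = 0"
proof -
  have "edge_problem G e p 0 \<rho>\<^sub>0 R (\<lambda>x. 0) (\<lambda>x. 1) W \<rho> 0 u"
    by (rule half_line_edge_problem) (use assms in auto)
  from half_line_zero_solution[OF this] show ?thesis using assms half_line_edge by blast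
qed

definition mass :: real where "mass = \<bar>mass_const p \<rho>\<^sub>0 R (Suc m)\<bar>"

abbreviation "expo \<equiv> (6 - p) / (4 * (p - 2))"

lemma expo2: "(6 - p) / (2 * (p - 2)) = 2 * expo"
  using p by (simp add: field_simps)

lemma L2_edge_core:
  assumes eE: "e \<in> bounded_edges G" and l: "0 \<le> l" "l \<le> \<Lambda>" and adm: "admissible l u"
  shows "(LINT x|lebesgue_on (edge_interval G e). (restrict_edge G u e x)\<^sup>2) \<le>
    sup_const\<^sup>2 * real_of_ereal (edge_length G e)"
proof -
  have e': "e \<in> edges G" "edge_length G e < \<infinity>" using eE by (auto simp: bounded_edges_def)
  obtain V r where "edge_problem G e p (KW + \<Lambda>) \<rho>\<^sub>0 R V r W \<rho> l u"
    using ex_edge_problem[OF e'(1), of l u "KW + \<Lambda>"] adm l by auto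
  then interpret edge_problem G e p "KW + \<Lambda>" \<rho>\<^sub>0 R V r W \<rho> l u .
  obtain k where k: "edge_length G e = ereal k" using e'(2) by (cases rule: edge_length_cases) auto
  show ?thesis using L2_le_of_sup[OF k sup_le[OF e'(1) l adm]] k by simp
qed

text \<open>On a half-line \<open>W\<close> vanishes and length is no restriction, so the power
  bound holds for every positive \<open>l\<close>, however small.\<close>

lemma L2_edge_half:
  assumes eE: "e \<in> half_lines G" and l: "0 < l" and adm: "admissible l u"
  shows "(LINT x|lebesgue_on (edge_interval G e). (restrict_edge G u e x)\<^sup>2) \<le> mass * l powr (2 * expo)"
proof -
  have "edge_problem G e p (2 * l) \<rho>\<^sub>0 R (\<lambda>x. l) (\<lambda>x. 1) W \<rho> l u"
    by (rule half_line_edge_problem[OF eE]) (use adm l in auto)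
  then interpret edge_problem G e p "2 * l" \<rho>\<^sub>0 R "\<lambda>x. l" "\<lambda>x. 1" W \<rho> l u .
  have "(LINT x|lebesgue_on I. (w x)\<^sup>2) \<le>
      mass_const p \<rho>\<^sub>0 R (Suc m) * l powr ((6 - p) / (2 * (p - 2)))"
    by (rule L2_le_mass) (use adm l half_line_edge[OF eE] in auto)
  also have "\<dots> \<le> mass * l powr (2 * expo)"
    unfolding expo2 mass_def by (intro mult_right_mono) auto
  finally show ?thesis .
qed

lemma L2_edge_large:
  assumes eE: "e \<in> edges G" and l: "\<Lambda> \<le> l" and adm: "admissible l u"
  shows "(LINT x|lebesgue_on (edge_interval G e). (restrict_edge G u e x)\<^sup>2) \<le> mass * l powr (2 * expo)"
proof -
  have l0: "0 < l" and lK: "2 * KW \<le> l" using \<Lambda> l by auto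
  obtain V r where V: "edge_problem G e p (l + KW) \<rho>\<^sub>0 R V r W \<rho> l u" "\<forall>x. l - KW \<le> V x"
    using ex_edge_problem[OF eE, of l u "l + KW"] adm l0 by auto
  interpret edge_problem G e p "l + KW" \<rho>\<^sub>0 R V r W \<rho> l u by (rule V(1))
  let ?N = "sqrt (27 * (p - 1) / (p - 2))"
  have "(LINT x|lebesgue_on I. (w x)\<^sup>2) \<le>
      mass_const p \<rho>\<^sub>0 R (Suc m) * l powr ((6 - p) / (2 * (p - 2)))"
  proof (rule L2_le_mass[OF _ l0])
    show "l / 2 \<le> V x" for x using spec[OF V(2), of x] lK by linarith
    have "2 * ?N / lm \<le> sqrt l"
      using \<Lambda>(3) l by (intro real_le_rsqrt) linarith
    then have "2 * (?N / sqrt l) \<le> lm" using lm(1) l0 by (simp add: field_simps)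
    then have "ereal (2 * (?N / sqrt l)) \<le> ereal lm" by simp
    then show "ereal (2 * (?N / sqrt l)) \<le> edge_length G e" using lm(2)[OF eE] by (rule order_trans)
  qed (use adm lK KW(1) in auto)
  also have "\<dots> \<le> mass * l powr (2 * expo)"
    unfolding expo2 mass_def by (intro mult_right_mono) auto
  finally show ?thesis .
qed

text \<open>Half-lines contribute nothing to this sum, because \<open>real_of_ereal\<close> sends
  \<infinity> to 0.\<close>

definition core_mass :: real where
  "core_mass = sqrt (\<Sum>e\<in>edges G. sup_const\<^sup>2 * real_of_ereal (edge_length G e))"

definition soliton_mass :: real where
  "soliton_mass = sqrt (real (card (edges G)) * mass)"

lemma consts_nonneg: "0 \<le> sup_const" "0 \<le> mass" "0 \<le> core_mass" "0 \<le> soliton_mass"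
  by (auto simp: sup_const_def mass_def core_mass_def soliton_mass_def zero_le_mult_iff
      intro!: sum_nonneg real_of_ereal_pos) 
    (use G in \<open>auto simp: G_fin_def intro: less_imp_le\<close>)

lemma core_mass_sq: "(\<Sum>e\<in>edges G. sup_const\<^sup>2 * real_of_ereal (edge_length G e)) = core_mass\<^sup>2"
proof -
  have "0 \<le> (\<Sum>e\<in>edges G. sup_const\<^sup>2 * real_of_ereal (edge_length G e))"
    by (intro sum_nonneg mult_nonneg_nonneg real_of_ereal_pos) (use G in \<open>auto simp: G_fin_def intro: less_imp_le\<close>)
  then show ?thesis by (simp add: core_mass_def)
qed

lemma soliton_mass_powr:
  "sqrt (real (card (edges G)) * (mass * l powr (2 * expo))) = soliton_mass * l powr expo"
proof -
  have "sqrt (l powr (2 * expo)) = (l powr (2 * expo)) powr (1 / 2)" by (simp add: powr_half_sqrt)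
  also have "\<dots> = l powr expo"
  proof -
    have "2 * x * (1 / 2) = x" for x :: real by simp
    then show ?thesis by (simp only: powr_powr)
  qed
  finally show ?thesis by (simp add: soliton_mass_def real_sqrt_mult)
qed

lemma L2_small:
  assumes l: "0 < l" "l \<le> \<Lambda>" and u: "admissible l u"
  shows "L2_norm_graph G u \<le> core_mass + soliton_mass * l powr expo"
proof -
  have "graph_integral G (\<lambda>e x. (restrict_edge G u e x)\<^sup>2) \<le>
      (\<Sum>e\<in>edges G. sup_const\<^sup>2 * real_of_ereal (edge_length G e) + mass * l powr (2 * expo))"
    unfolding graph_integral_def
  proof (rule sum_mono)
    fix e assume e: "e \<in> edges G"
    have "0 \<le> edge_length G e" using G e by (auto simp: G_fin_def intro: less_imp_le)
    then have *: "0 \<le> sup_const\<^sup>2 * real_of_ereal (edge_length G e)" "0 \<le> mass * l powr (2 * expo)"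
      using consts_nonneg by (auto intro!: mult_nonneg_nonneg real_of_ereal_pos)
    show "(LINT x|lebesgue_on (edge_interval G e). (restrict_edge G u e x)\<^sup>2) \<le>
        sup_const\<^sup>2 * real_of_ereal (edge_length G e) + mass * l powr (2 * expo)"
      using half_line_iff[OF G e]
    proof
      assume "e \<in> half_lines G"
      from L2_edge_half[OF this l(1) u] show ?thesis using * by linarith
    next
      assume "e \<in> bounded_edges G"
      from L2_edge_core[OF this less_imp_le[OF l(1)] l(2) u] show ?thesis using * by linarith
    qed
  qed
  also have "\<dots> = core_mass\<^sup>2 + real (card (edges G)) * (mass * l powr (2 * expo))"
    by (simp add: sum.distrib core_mass_sq)
  finally have "L2_norm_graph G u \<le> sqrt (core_mass\<^sup>2 + real (card (edges G)) * (mass * l powr (2 * expo)))"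
    unfolding L2_norm_graph_def by (rule real_sqrt_le_mono)
  also have "\<dots> \<le> sqrt (core_mass\<^sup>2) + sqrt (real (card (edges G)) * (mass * l powr (2 * expo)))"
    by (rule sqrt_add_le_add_sqrt) (use consts_nonneg in auto)
  finally show ?thesis unfolding soliton_mass_powr using consts_nonneg by simp
qed

lemma L2_large:
  assumes l: "\<Lambda> \<le> l" and u: "admissible l u"
  shows "L2_norm_graph G u \<le> soliton_mass * l powr expo"
proof -
  have "graph_integral G (\<lambda>e x. (restrict_edge G u e x)\<^sup>2) \<le> (\<Sum>e\<in>edges G. mass * l powr (2 * expo))"
    unfolding graph_integral_def by (rule sum_mono) (rule L2_edge_large[OF _ l u])
  also have "\<dots> = real (card (edges G)) * (mass * l powr (2 * expo))" by simp
  finally have "L2_norm_graph G u \<le> sqrt (real (card (edges G)) * (mass * l powr (2 * expo)))"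
    unfolding L2_norm_graph_def by (rule real_sqrt_le_mono)
  then show ?thesis unfolding soliton_mass_powr .
qed

lemma L2_zero:
  assumes u: "admissible 0 u"
  shows "L2_norm_graph G u \<le> core_mass"
proof -
  have "graph_integral G (\<lambda>e x. (restrict_edge G u e x)\<^sup>2) \<le>
      (\<Sum>e\<in>edges G. sup_const\<^sup>2 * real_of_ereal (edge_length G e))"
    unfolding graph_integral_def
  proof (rule sum_mono)
    fix e assume e: "e \<in> edges G"
    show "(LINT x|lebesgue_on (edge_interval G e). (restrict_edge G u e x)\<^sup>2) \<le>
        sup_const\<^sup>2 * real_of_ereal (edge_length G e)"
      using half_line_iff[OF G e]
    proof
      assume h: "e \<in> half_lines G"
      have "(LINT x|lebesgue_on (edge_interval G e). (restrict_edge G u e x)\<^sup>2) =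
          (LINT x|lebesgue_on (edge_interval G e). 0)"
        by (rule Bochner_Integration.integral_cong)
          (use zero_on_half_line[OF u h] in \<open>auto simp: space_restrict_space\<close>)
      then show ?thesis using half_line_edge[OF h] by simp
    next
      assume "e \<in> bounded_edges G"
      from L2_edge_core[OF this _ _ u] show ?thesis using \<Lambda>(1) by simp
    qed
  qed
  then have "L2_norm_graph G u \<le> sqrt (core_mass\<^sup>2)"
    unfolding L2_norm_graph_def core_mass_sq by (rule real_sqrt_le_mono)
  then show ?thesis using consts_nonneg by simp
qed

end

section \<open>Choice of the constants and assembly of the five claims\<close>

theorem theorem4p26:
  fixes G :: "('v, 'e) metric_graph" and p :: real and m :: nat
    and W \<rho> :: "('v, 'e) point \<Rightarrow> real"
  assumes "G \<in> G_fin"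
    and "half_lines G \<noteq> {}"
    and "p > 2"
    and "m > 0"
    and "W \<in> Linf_graph G"
    and "\<rho> \<in> Linf_graph G"
    and "core_ess_inf G \<rho> > 0"
    and "\<forall>e \<in> half_lines G. AE x in lebesgue_on (edge_interval G e). restrict_edge G W e x = 0"
    and "\<forall>e \<in> half_lines G. AE x in lebesgue_on (edge_interval G e). restrict_edge G \<rho> e x = 1"
  shows "\<forall>\<Lambda>>0. \<exists>C>0. \<exists>D>0. \<forall>l::real.
    (l < 0 \<longrightarrow> q_mass G p W \<rho> m l = 0) \<and>
    (\<forall>u \<in> H1_graph G. l \<in> {0..\<Lambda>} \<and> solves_E G p W \<rho> l u \<and> morse_index G p W \<rho> l u \<le> enat m
       \<longrightarrow> Linf_norm_graph G u \<le> ereal C) \<and>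
    (q_mass G p W \<rho> m 0 \<le> ereal C \<and>
     (\<forall>u \<in> H1_graph G. solves_E G p W \<rho> 0 u \<and> morse_index G p W \<rho> 0 u \<le> enat m
        \<longrightarrow> (\<forall>e \<in> half_lines G. \<forall>x \<in> edge_interval G e. restrict_edge G u e x = 0))) \<and>
    (0 < l \<and> l \<le> \<Lambda> \<longrightarrow>
       q_mass G p W \<rho> m l \<le> ereal (D + C * l powr ((6 - p) / (4 * (p - 2))))) \<and>
    (l \<ge> \<Lambda> \<longrightarrow> q_mass G p W \<rho> m l \<le> ereal (C * l powr ((6 - p) / (4 * (p - 2)))))"
proof (intro allI impI, goal_cases)
  case (1 \<Lambda>)
  note \<Lambda>0 = 1
  obtain KW where KW: "0 \<le> KW"
    "\<And>e. e \<in> edges G \<Longrightarrow> AE x in lebesgue_on (edge_interval G e). \<bar>restrict_edge G W e x\<bar> \<le> KW"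
    using Linf_graph_AE_bound[OF assms(5)] by blast
  obtain R where R:
    "\<And>e. e \<in> edges G \<Longrightarrow> AE x in lebesgue_on (edge_interval G e). \<bar>restrict_edge G \<rho> e x\<bar> \<le> R"
    using Linf_graph_AE_bound[OF assms(6)] by blast
  obtain \<rho>\<^sub>0 where \<rho>\<^sub>0: "0 < \<rho>\<^sub>0"
    "\<And>e. e \<in> bounded_edges G \<Longrightarrow> AE x in lebesgue_on (edge_interval G e). \<rho>\<^sub>0 \<le> restrict_edge G \<rho> e x"
    using core_ess_inf_AE_bound[OF assms(7)] by blast
  have "finite (edges G)" "\<And>e. e \<in> edges G \<Longrightarrow> 0 < edge_length G e" using assms(1) by (auto simp: G_fin_def)
  from ereal_finite_pos_lower_bound[of "edges G" "edge_length G", OF this] obtain lm where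
    lm: "0 < lm" "\<And>e. e \<in> edges G \<Longrightarrow> ereal lm \<le> edge_length G e" by blast
  \<comment> \<open>Above this value the cell estimate applies to all edges; below it the sup bound
    controls the core.\<close>
  define \<Lambda>\<^sub>1 where "\<Lambda>\<^sub>1 = max \<Lambda> (max (2 * KW) ((2 * sqrt (27 * (p - 1) / (p - 2)) / lm)\<^sup>2))"
  have \<Lambda>1: "\<Lambda> \<le> \<Lambda>\<^sub>1" by (simp add: \<Lambda>\<^sub>1_def)
  interpret half_line_problem G p m W \<rho> KW "min 1 \<rho>\<^sub>0" "max 1 R" lm \<Lambda>\<^sub>1
  proof
    fix e assume e: "e \<in> bounded_edges G"
    then have "e \<in> edges G" by (simp add: bounded_edges_def)
    from R[OF this] \<rho>\<^sub>0(2)[OF e]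
    show "AE x in lebesgue_on (edge_interval G e).
      min 1 \<rho>\<^sub>0 \<le> restrict_edge G \<rho> e x \<and> restrict_edge G \<rho> e x \<le> max 1 R"
      by eventually_elim auto
  qed (use assms KW \<rho>\<^sub>0 lm \<Lambda>0 in \<open>auto simp: \<Lambda>\<^sub>1_def\<close>)
  \<comment> \<open>A positive lower bound for the power of \<open>l\<close> between the two
    thresholds. The sign of the exponent depends on whether \<open>p\<close> exceeds 6, so both ends
    are taken into account.\<close>
  define c where "c = min (\<Lambda> powr expo) (\<Lambda>\<^sub>1 powr expo)"
  have c: "0 < c" using \<Lambda>0 \<Lambda>1 by (simp add: c_def)
  have c_le: "c \<le> l powr expo" if "\<Lambda> \<le> l" "l \<le> \<Lambda>\<^sub>1" for l
  proof (cases "0 \<le> expo")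
    case True
    have "\<Lambda> powr expo \<le> l powr expo" by (rule powr_mono2[OF True]) (use that \<Lambda>0 in auto)
    then show ?thesis by (simp add: c_def)
  next
    case False
    have "\<Lambda>\<^sub>1 powr expo \<le> l powr expo" by (rule powr_mono2') (use that \<Lambda>0 False in auto)
    then show ?thesis by (simp add: c_def)
  qed
  \<comment> \<open>The last summand turns the constant \<open>core_mass\<close> into a multiple of
    \<open>l powr expo\<close> for \<open>l\<close> between \<open>\<Lambda>\<close> and
    \<open>\<Lambda>\<^sub>1\<close>, where claim 5 admits no additive constant.\<close>
  define C where "C = 1 + sup_const + core_mass + soliton_mass + core_mass / c"
  define D where "D = 1 + core_mass"
  have parts: "0 \<le> sup_const" "0 \<le> core_mass" "0 \<le> soliton_mass" "0 \<le> core_mass / c"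
    using consts_nonneg c by auto
  have C: "0 < C" "sup_const \<le> C" "core_mass \<le> C" "soliton_mass \<le> C" "core_mass / c + soliton_mass \<le> C"
    using parts by (auto simp: C_def)
  have D: "0 < D" "core_mass \<le> D" using parts by (auto simp: D_def)
  have neg: "q_mass G p W \<rho> m l = 0" if "l < 0" for l
  proof -
    have "{u \<in> H1_graph G - {0}. solves_E G p W \<rho> l u \<and> morse_index G p W \<rho> l u \<le> enat m} = {}"
      using no_solution_negative[OF that] by blast
    then show ?thesis by (simp add: q_mass_def Let_def)
  qed
  have sup: "Linf_norm_graph G u \<le> ereal C" if "l \<in> {0..\<Lambda>}" "admissible l u" for l u
  proof -
    have "Linf_norm_graph G u \<le> ereal sup_const" by (rule Linf_le[OF _ _ that(2)]) (use that(1) \<Lambda>1 in auto)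
    also have "\<dots> \<le> ereal C" using C by simp
    finally show ?thesis .
  qed
  have zero: "q_mass G p W \<rho> m 0 \<le> ereal C"
    by (rule q_mass_le) (use C L2_zero in \<open>force\<close>)+
  have small: "q_mass G p W \<rho> m l \<le> ereal (D + C * l powr expo)" if "0 < l" "l \<le> \<Lambda>" for l
  proof (rule q_mass_le)
    show "0 \<le> D + C * l powr expo" using C D by (intro add_nonneg_nonneg mult_nonneg_nonneg) auto
    fix u assume "solves_E G p W \<rho> l u" "morse_index G p W \<rho> l u \<le> enat m"
    then have "L2_norm_graph G u \<le> core_mass + soliton_mass * l powr expo"
      using that \<Lambda>1 by (intro L2_small) auto
    also have "\<dots> \<le> D + C * l powr expo" using C D by (intro add_mono mult_right_mono) auto
    finally show "L2_norm_graph G u \<le> D + C * l powr expo" .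
  qed
  have large: "q_mass G p W \<rho> m l \<le> ereal (C * l powr expo)" if l: "\<Lambda> \<le> l" for l
  proof (rule q_mass_le)
    show "0 \<le> C * l powr expo" using C by simp
    fix u assume u: "solves_E G p W \<rho> l u" "morse_index G p W \<rho> l u \<le> enat m"
    show "L2_norm_graph G u \<le> C * l powr expo"
    proof (cases "l \<le> \<Lambda>\<^sub>1")
      case True
      have "L2_norm_graph G u \<le> core_mass + soliton_mass * l powr expo"
        using l \<Lambda>0 True u by (intro L2_small) auto
      also have "core_mass \<le> core_mass / c * l powr expo"
        using mult_left_mono[OF c_le[OF l True] parts(4)] c by simp
      also have "core_mass / c * l powr expo + soliton_mass * l powr expo =
          (core_mass / c + soliton_mass) * l powr expo" by (simp add: distrib_right)
      also have "\<dots> \<le> C * l powr expo" using C by (intro mult_right_mono) auto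
      finally show ?thesis by simp
    next
      case False
      then have "L2_norm_graph G u \<le> soliton_mass * l powr expo" using u by (intro L2_large) auto
      also have "\<dots> \<le> C * l powr expo" using C by (intro mult_right_mono) auto
      finally show ?thesis .
    qed
  qed
  show ?case
  proof (rule exI[of _ C], rule conjI[OF C(1)], rule exI[of _ D], rule conjI[OF D(1)], intro allI, goal_cases)
    case (1 l)
    then show ?case using neg sup zero zero_on_half_line small large by blast
  qed
qed

end
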